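(* Let $\mathbf{k}$ be a commutative ring. The graded $\mathbf{k}$-module $\operatorname{PNSym}$, with its comultiplication $\Delta$, becomes a connected graded cocommutative Hopf algebra when equipped with the external multiplication $\cdot$, and a (non-graded) non-unital bialgebra when equipped with the internal multiplication $\ast$. In particular, both multiplications are associative.
   Context: $\mathbb{N}=\{0,1,2,\ldots\}$; $[k]=\{1,\ldots,k\}$; $\mathfrak{S}_k$ is the group of permutations of $[k]$. All modules and tensor products are over the commutative ring $\mathbf{k}$. A weak composition is a finite tuple of nonnegative integers; a composition is a finite tuple of positive integers; $|\alpha|$ is the sum of the entries of $\alpha$. A mopiscotion (resp. weak mopiscotion) is a pair $(\alpha,\sigma)$ where $\alpha$ is a composition (resp. weak composition) of some length $k\in\mathbb{N}$ and $\sigma\in\mathfrak{S}_k$. The standardization of a list $w=(w_1,\ldots,w_h)$ of integers is the unique $\sigma\in\mathfrak{S}_h$ such that for all $a<b$ in $[h]$ we have $\sigma(a)<\sigma(b)\Leftrightarrow w_a\le w_b$. For a weak mopiscotion $(\alpha,\sigma)$ with $\alpha=(\alpha_1,\ldots,\alpha_k)$, let $(j_1<\cdots<j_h)$ be the list of all $i\in[k]$ with $\alpha_i\ne0$, let $\operatorname{red}\alpha:=(\alpha_{j_1},\ldots,\alpha_{j_h})$, let $\tau$ be the standardization of $(\sigma(j_1),\ldots,\sigma(j_h))$, and set $\operatorname{red}(\alpha,\sigma):=(\operatorname{red}\alpha,\tau)$, a mopiscotion. For $\sigma\in\mathfrak{S}_k$, $\tau\in\mathfrak{S}_\ell$: $\sigma\oplus\tau\in\mathfrak{S}_{k+\ell}$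 sends each $i\le k$ to $\sigma(i)$ and each $j>k$ to $k+\tau(j-k)$; and $\tau[\sigma]\in\mathfrak{S}_{k\ell}$ sends each $\ell(i-1)+j$ ($i\in[k]$, $j\in[\ell]$) to $k(\tau(j)-1)+\sigma(i)$. The concatenation of $\alpha$ and $\beta$ is denoted $\alpha\beta$. $\operatorname{PNSym}$ is the free $\mathbf{k}$-module with basis $(F_{\alpha,\sigma})$ indexed by all mopiscotions $(\alpha,\sigma)$. For any weak mopiscotion $(\alpha,\sigma)$ set $F_{\alpha,\sigma}:=F_{\beta,\tau}$ where $(\beta,\tau)=\operatorname{red}(\alpha,\sigma)$. It is graded by letting $F_{\alpha,\sigma}$ be homogeneous of degree $|\alpha|$. The following operations are defined ((bi)linearly) on basis elements: External multiplication: $F_{\alpha,\sigma}\cdot F_{\beta,\tau}=F_{\alpha\beta,\sigma\oplus\tau}$. Internal multiplication (for $\alpha$ of length $k$, $\beta$ of length $\ell$): $F_{\alpha,\sigma}\ast F_{\beta,\tau}=\sum F_{(\gamma_{1,1},\gamma_{1,2},\ldots,\gamma_{k,\ell}),\,\tau[\sigma]}$, where the sum is over all matrices $(\gamma_{i,j})\in\mathbb{N}^{k\times\ell}$ with $\sum_{j}\gamma_{i,j}=\alpha_i$ for all $i\in[k]$ and $\sum_i\gamma_{i,j}=\beta_j$ for all $j\in[\ell]$, and $(\gamma_{1,1},\gamma_{1,2},\ldots,\gamma_{k,\ell})$ lists all entries in lexicographic order of $(i,j)$. Comultiplication (for $\alpha$ of length $k$): $\Delta(F_{\alpha,\sigma})=\sum_{\beta,\gamma\in\mathbb{N}^k;\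 \beta+\gamma=\alpha\text{ (entrywise)}}F_{\beta,\sigma}\otimes F_{\gamma,\sigma}$. A graded bialgebra has graded structure maps (no sign twists in tensor products) and is connected if its degree-$0$ component is $\mathbf{k}\cdot1$. A non-unital bialgebra is defined like a bialgebra except that the (associative) multiplication need not have a unity. *)

theory Defs
  imports "HOL-Library.Poly_Mapping" "HOL-Combinatorics.Permutations" "HOL.Hull"
begin

section \<open>Modules over a commutative ring, and free modules\<close>

text \<open>
  The sort \<open>{comm_ring, comm_monoid_mult}\<close> is the sort of commutative rings with unity,
  without the axiom \<open>0 \<noteq> 1\<close> that is part of the class \<open>comm_ring_1\<close> (and hence of the
  locale \<open>module\<close> of the library).
\<close>

locale kmodule =
  fixes scl :: "'k::{comm_ring,comm_monoid_mult} \<Rightarrow> 'v::ab_group_add \<Rightarrow> 'v"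
  assumes scl_add_right: "scl c (x + y) = scl c x + scl c y"
    and scl_add_left: "scl (c + d) x = scl c x + scl d x"
    and scl_scl: "scl c (scl d x) = scl (c * d) x"
    and scl_one: "scl 1 x = x"

definition linear_map ::
  "('k \<Rightarrow> 'v::ab_group_add \<Rightarrow> 'v) \<Rightarrow> ('k \<Rightarrow> 'w::ab_group_add \<Rightarrow> 'w) \<Rightarrow> ('v \<Rightarrow> 'w) \<Rightarrow> bool" where
  "linear_map s t f \<longleftrightarrow>
     (\<forall>x y. f (x + y) = f x + f y) \<and> (\<forall>c x. f (s c x) = t c (f x))"

definition bilinear_map ::
  "('k \<Rightarrow> 'u::ab_group_add \<Rightarrow> 'u) \<Rightarrow> ('k \<Rightarrow> 'v::ab_group_add \<Rightarrow> 'v) \<Rightarrow>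
   ('k \<Rightarrow> 'w::ab_group_add \<Rightarrow> 'w) \<Rightarrow> ('u \<Rightarrow> 'v \<Rightarrow> 'w) \<Rightarrow> bool" where
  "bilinear_map s t u m \<longleftrightarrow>
     (\<forall>x. linear_map t u (\<lambda>y. m x y)) \<and> (\<forall>y. linear_map s u (\<lambda>x. m x y))"

text \<open>
  The free module with basis \<open>'b\<close> is the type \<open>'b \<Rightarrow>\<^sub>0 'k\<close> of finitely supported functions;
  the basis element belonging to \<open>b\<close> is \<open>Poly_Mapping.single b 1\<close>.
\<close>

definition scale :: "'k::{comm_ring,comm_monoid_mult} \<Rightarrow> ('b \<Rightarrow>\<^sub>0 'k) \<Rightarrow> ('b \<Rightarrow>\<^sub>0 'k)" where
  "scale c x = Poly_Mapping.map ((*) c) x"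

abbreviation basis :: "'b \<Rightarrow> ('b \<Rightarrow>\<^sub>0 'k::{comm_ring,comm_monoid_mult})" where
  "basis b \<equiv> Poly_Mapping.single b 1"

definition submodule :: "('b \<Rightarrow>\<^sub>0 'k::{comm_ring,comm_monoid_mult}) set \<Rightarrow> bool" where
  "submodule U \<longleftrightarrow> 0 \<in> U \<and> (\<forall>x\<in>U. \<forall>y\<in>U. x + y \<in> U) \<and> (\<forall>c. \<forall>x\<in>U. scale c x \<in> U)"

definition kspan :: "('b \<Rightarrow>\<^sub>0 'k::{comm_ring,comm_monoid_mult}) set \<Rightarrow> ('b \<Rightarrow>\<^sub>0 'k) set" where
  "kspan X = submodule hull X"

definition linear_ext ::
  "('b \<Rightarrow> ('c \<Rightarrow>\<^sub>0 'k)) \<Rightarrow> ('b \<Rightarrow>\<^sub>0 'k::{comm_ring,comm_monoid_mult}) \<Rightarrow> ('c \<Rightarrow>\<^sub>0 'k)" where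
  "linear_ext f x = (\<Sum>b\<in>Poly_Mapping.keys x. scale (Poly_Mapping.lookup x b) (f b))"

definition bilinear_ext ::
  "('a \<Rightarrow> 'b \<Rightarrow> ('c \<Rightarrow>\<^sub>0 'k)) \<Rightarrow> ('a \<Rightarrow>\<^sub>0 'k::{comm_ring,comm_monoid_mult}) \<Rightarrow> ('b \<Rightarrow>\<^sub>0 'k) \<Rightarrow>
   ('c \<Rightarrow>\<^sub>0 'k)" where
  "bilinear_ext f x y = linear_ext (\<lambda>a. linear_ext (\<lambda>b. f a b) y) x"

text \<open>
  The tensor product of the free modules with bases \<open>'a\<close> and \<open>'b\<close> is the free module with
  basis \<open>'a \<times> 'b\<close>; \<open>tensor_universal\<close> below is its universal property.
\<close>

definition tensor ::
  "('a \<Rightarrow>\<^sub>0 'k::{comm_ring,comm_monoid_mult}) \<Rightarrow> ('b \<Rightarrow>\<^sub>0 'k) \<Rightarrow> ('a \<times> 'b \<Rightarrow>\<^sub>0 'k)" where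
  "tensor x y = bilinear_ext (\<lambda>a b. basis (a, b)) x y"

definition tensor_map ::
  "(('a \<Rightarrow>\<^sub>0 'k) \<Rightarrow> ('c \<Rightarrow>\<^sub>0 'k)) \<Rightarrow> (('b \<Rightarrow>\<^sub>0 'k) \<Rightarrow> ('d \<Rightarrow>\<^sub>0 'k)) \<Rightarrow>
   ('a \<times> 'b \<Rightarrow>\<^sub>0 'k::{comm_ring,comm_monoid_mult}) \<Rightarrow> ('c \<times> 'd \<Rightarrow>\<^sub>0 'k)" where
  "tensor_map f g t = linear_ext (\<lambda>(a, b). tensor (f (basis a)) (g (basis b))) t"

definition tensor_assoc ::
  "(('a \<times> 'b) \<times> 'c \<Rightarrow>\<^sub>0 'k::{comm_ring,comm_monoid_mult}) \<Rightarrow> ('a \<times> ('b \<times> 'c) \<Rightarrow>\<^sub>0 'k)" where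
  "tensor_assoc t = linear_ext (\<lambda>((a, b), c). basis (a, (b, c))) t"

definition tensor_swap ::
  "('a \<times> 'b \<Rightarrow>\<^sub>0 'k::{comm_ring,comm_monoid_mult}) \<Rightarrow> ('b \<times> 'a \<Rightarrow>\<^sub>0 'k)" where
  "tensor_swap t = linear_ext (\<lambda>(a, b). basis (b, a)) t"

text \<open>
  For a linear functional \<open>e\<close>, these are \<open>e \<otimes> id\<close> and \<open>id \<otimes> e\<close>, followed by the canonical
  identifications of \<open>k \<otimes> M\<close> and \<open>M \<otimes> k\<close> with \<open>M\<close>.
\<close>

definition apply_left ::
  "(('a \<Rightarrow>\<^sub>0 'k) \<Rightarrow> 'k) \<Rightarrow> ('a \<times> 'b \<Rightarrow>\<^sub>0 'k::{comm_ring,comm_monoid_mult}) \<Rightarrow> ('b \<Rightarrow>\<^sub>0 'k)" where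
  "apply_left e t = linear_ext (\<lambda>(a, b). scale (e (basis a)) (basis b)) t"

definition apply_right ::
  "(('b \<Rightarrow>\<^sub>0 'k) \<Rightarrow> 'k) \<Rightarrow> ('a \<times> 'b \<Rightarrow>\<^sub>0 'k::{comm_ring,comm_monoid_mult}) \<Rightarrow> ('a \<Rightarrow>\<^sub>0 'k)" where
  "apply_right e t = linear_ext (\<lambda>(a, b). scale (e (basis b)) (basis a)) t"

definition mult_map ::
  "(('b \<Rightarrow>\<^sub>0 'k) \<Rightarrow> ('b \<Rightarrow>\<^sub>0 'k) \<Rightarrow> ('b \<Rightarrow>\<^sub>0 'k)) \<Rightarrow>
   ('b \<times> 'b \<Rightarrow>\<^sub>0 'k::{comm_ring,comm_monoid_mult}) \<Rightarrow> ('b \<Rightarrow>\<^sub>0 'k)" where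
  "mult_map m t = linear_ext (\<lambda>(a, b). m (basis a) (basis b)) t"

text \<open>The multiplication \<open>(a \<otimes> b) (c \<otimes> d) = ac \<otimes> bd\<close> of the tensor square, with no sign twist.\<close>

definition tensor_mult ::
  "(('b \<Rightarrow>\<^sub>0 'k) \<Rightarrow> ('b \<Rightarrow>\<^sub>0 'k) \<Rightarrow> ('b \<Rightarrow>\<^sub>0 'k)) \<Rightarrow>
   ('b \<times> 'b \<Rightarrow>\<^sub>0 'k::{comm_ring,comm_monoid_mult}) \<Rightarrow> ('b \<times> 'b \<Rightarrow>\<^sub>0 'k) \<Rightarrow> ('b \<times> 'b \<Rightarrow>\<^sub>0 'k)" where
  "tensor_mult m s t =
     bilinear_ext (\<lambda>(a, b) (c, d). tensor (m (basis a) (basis c)) (m (basis b) (basis d))) s t"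

lemma lookup_scale: "Poly_Mapping.lookup (scale c x) b = c * Poly_Mapping.lookup x b"
  by (simp add: scale_def Poly_Mapping.map.rep_eq when_def)

lemma scale_single: "scale c (Poly_Mapping.single b d) = Poly_Mapping.single b (c * d)"
  by (rule poly_mapping_eqI) (simp add: lookup_scale lookup_single when_def)

lemma basis_expansion:
  "x = (\<Sum>b\<in>Poly_Mapping.keys x. scale (Poly_Mapping.lookup x b) (basis b))"
  by (rule poly_mapping_eqI)
    (simp add: lookup_sum scale_single lookup_single when_def in_keys_iff)

lemma linear_map_zero:
  assumes "linear_map s t f" shows "f 0 = 0"
  using assms unfolding linear_map_def by (metis add_cancel_right_right)

lemma linear_map_sum:
  assumes "linear_map s t f"
  shows "f (\<Sum>i\<in>I. h i) = (\<Sum>i\<in>I. f (h i))"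
proof (induction I rule: infinite_finite_induct)
  case (insert i I)
  then show ?case using assms by (simp add: linear_map_def)
qed (use linear_map_zero[OF assms] in simp_all)

lemma linear_map_compose:
  assumes "linear_map s t f" "linear_map t u g"
  shows "linear_map s u (\<lambda>x. g (f x))"
  using assms by (simp add: linear_map_def)

lemma linear_map_expand:
  assumes "linear_map scale s f"
  shows "f x = (\<Sum>b\<in>Poly_Mapping.keys x. s (Poly_Mapping.lookup x b) (f (basis b)))"
proof -
  have "f x = f (\<Sum>b\<in>Poly_Mapping.keys x. scale (Poly_Mapping.lookup x b) (basis b))"
    using basis_expansion[of x] by simp
  also have "\<dots> = (\<Sum>b\<in>Poly_Mapping.keys x. s (Poly_Mapping.lookup x b) (f (basis b)))"
    using assms by (simp add: linear_map_sum[OF assms] linear_map_def)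
  finally show ?thesis .
qed

lemma lookup_tensor:
  "Poly_Mapping.lookup (tensor x y) (a, b) = Poly_Mapping.lookup x a * Poly_Mapping.lookup y b"
proof -
  have inner: "Poly_Mapping.lookup
      (\<Sum>b'\<in>Poly_Mapping.keys y. scale (Poly_Mapping.lookup y b') (basis (a', b'))) (a, b) =
      (if a' = a then Poly_Mapping.lookup y b else 0)" for a'
    by (auto simp: lookup_sum scale_single lookup_single when_def in_keys_iff)
  have "Poly_Mapping.lookup (tensor x y) (a, b) =
      (\<Sum>a'\<in>Poly_Mapping.keys x. if a' = a
        then Poly_Mapping.lookup x a' * Poly_Mapping.lookup y b else 0)"
    unfolding tensor_def bilinear_ext_def linear_ext_def
    by (subst lookup_sum, intro sum.cong refl, simp only: lookup_scale inner, simp)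
  then show ?thesis by (auto simp: in_keys_iff)
qed

lemma bilinear_map_tensor: "bilinear_map scale scale scale tensor"
  unfolding bilinear_map_def linear_map_def
  by (auto intro!: poly_mapping_eqI
      simp: lookup_tensor lookup_add lookup_scale distrib_left distrib_right mult_ac)

lemma tensor_basis: "tensor (basis a) (basis b) = basis (a, b)"
proof (rule poly_mapping_eqI)
  fix p :: "'a \<times> 'b"
  show "Poly_Mapping.lookup (tensor (basis a) (basis b)) p = Poly_Mapping.lookup (basis (a, b)) p"
    by (cases p) (auto simp: lookup_tensor lookup_single when_def)
qed

lemma kmodule_linear_extension:
  fixes h :: "'b \<Rightarrow> 'v::ab_group_add"
    and s :: "'k::{comm_ring,comm_monoid_mult} \<Rightarrow> 'v \<Rightarrow> 'v"
  assumes "kmodule s"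
  shows "linear_map scale s
    (\<lambda>x. \<Sum>b\<in>Poly_Mapping.keys x. s (Poly_Mapping.lookup x b) (h b))" (is "linear_map _ _ ?g")
proof -
  interpret kmodule s by fact
  have zero: "s 0 v = 0" for v
    using scl_add_left[of 0 0 v] by simp
  have zero': "s c 0 = 0" for c
    using scl_add_right[of c 0 0] by simp
  have sum: "s c (\<Sum>i\<in>I. w i) = (\<Sum>i\<in>I. s c (w i))" for c and I :: "'b set" and w
    by (induction I rule: infinite_finite_induct) (simp_all add: zero' scl_add_right)
  have g: "?g x = (\<Sum>b\<in>A. s (Poly_Mapping.lookup x b) (h b))"
    if "finite A" "Poly_Mapping.keys x \<subseteq> A" for x A
    using that by (intro sum.mono_neutral_left) (auto simp: in_keys_iff zero)
  have "?g (x + y) = ?g x + ?g y" for x y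
    by (subst (1 2 3) g[of "Poly_Mapping.keys x \<union> Poly_Mapping.keys y"])
      (use keys_add[of x y] in \<open>auto simp: lookup_add scl_add_left sum.distrib\<close>)
  moreover have "?g (scale c x) = s c (?g x)" for c x
    by (subst g[of "Poly_Mapping.keys x"]) (auto simp: in_keys_iff lookup_scale scl_scl sum)
  ultimately show ?thesis
    unfolding linear_map_def by blast
qed

theorem tensor_universal:
  fixes s :: "'k::{comm_ring,comm_monoid_mult} \<Rightarrow> 'v::ab_group_add \<Rightarrow> 'v"
    and f :: "('a \<Rightarrow>\<^sub>0 'k) \<Rightarrow> ('b \<Rightarrow>\<^sub>0 'k) \<Rightarrow> 'v"
  assumes s: "kmodule s" and f: "bilinear_map scale scale s f"
  shows "\<exists>!g. linear_map scale s g \<and> (\<forall>x y. g (tensor x y) = f x y)"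
proof (rule ex1I, rule conjI)
  let ?g = "\<lambda>t. \<Sum>p\<in>Poly_Mapping.keys t.
    s (Poly_Mapping.lookup t p) (f (basis (fst p)) (basis (snd p)))"
  interpret kmodule s by fact
  show lin: "linear_map scale s ?g"
    by (rule kmodule_linear_extension[OF s])
  have zero: "s 0 v = 0" for v
    using scl_add_left[of 0 0 v] by simp
  have gb: "?g (basis p) = f (basis (fst p)) (basis (snd p))" for p
  proof (cases "(1::'k) = 0")
    case True
    then have triv: "v = 0" for v :: 'v
      using scl_one[of v] zero[of v] by simp
    show ?thesis by (rule trans[OF triv triv[symmetric]])
  next
    case False
    then show ?thesis by (simp add: scl_one)
  qed
  show "\<forall>x y. ?g (tensor x y) = f x y"
  proof (intro allI)
    fix x :: "'a \<Rightarrow>\<^sub>0 'k" and y :: "'b \<Rightarrow>\<^sub>0 'k"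
    have lin1: "linear_map scale s (\<lambda>x. ?g (tensor x y))" for y :: "'b \<Rightarrow>\<^sub>0 'k"
      proof (rule linear_map_compose[OF _ lin])
        show "linear_map scale scale (\<lambda>x. tensor x y)"
          using bilinear_map_tensor unfolding bilinear_map_def by blast
      qed
    have lin2: "linear_map scale s (\<lambda>y. ?g (tensor x y))" for x :: "'a \<Rightarrow>\<^sub>0 'k"
      proof (rule linear_map_compose[OF _ lin])
        show "linear_map scale scale (\<lambda>y. tensor x y)"
          using bilinear_map_tensor unfolding bilinear_map_def by blast
      qed
    have f1: "linear_map scale s (\<lambda>x. f x y)" for y
      using f unfolding bilinear_map_def by blast
    have f2: "linear_map scale s (\<lambda>y. f x y)" for x
      using f unfolding bilinear_map_def by blast
    have "?g (tensor (basis a) y) = f (basis a) y" for a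
      unfolding linear_map_expand[OF lin2, of "basis a" y] linear_map_expand[OF f2, of "basis a" y]
        tensor_basis gb fst_conv snd_conv by (rule refl)
    then show "?g (tensor x y) = f x y"
      unfolding linear_map_expand[OF lin1, of x y] linear_map_expand[OF f1, of x y]
      by (simp only:)
  qed
next
  fix g
  assume g: "linear_map scale s g \<and> (\<forall>x y. g (tensor x y) = f x y)"
  have "g t = (\<Sum>p\<in>Poly_Mapping.keys t.
    s (Poly_Mapping.lookup t p) (f (basis (fst p)) (basis (snd p))))" for t
    unfolding linear_map_expand[OF conjunct1[OF g], of t]
    by (intro sum.cong refl) (metis g tensor_basis prod.collapse)
  then show "g = (\<lambda>t. \<Sum>p\<in>Poly_Mapping.keys t.
    s (Poly_Mapping.lookup t p) (f (basis (fst p)) (basis (snd p))))"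
    by blast
qed


section \<open>Bialgebras and Hopf algebras\<close>

locale nonunital_algebra =
  fixes mult :: "('b \<Rightarrow>\<^sub>0 'k::{comm_ring,comm_monoid_mult}) \<Rightarrow> ('b \<Rightarrow>\<^sub>0 'k) \<Rightarrow> ('b \<Rightarrow>\<^sub>0 'k)"
  assumes mult_bilinear: "bilinear_map scale scale scale mult"
    and mult_assoc: "mult (mult x y) z = mult x (mult y z)"

locale unital_algebra = nonunital_algebra mult
  for mult :: "('b \<Rightarrow>\<^sub>0 'k::{comm_ring,comm_monoid_mult}) \<Rightarrow> ('b \<Rightarrow>\<^sub>0 'k) \<Rightarrow> ('b \<Rightarrow>\<^sub>0 'k)" +
  fixes unity :: "'b \<Rightarrow>\<^sub>0 'k"
  assumes unity_left: "mult unity x = x"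
    and unity_right: "mult x unity = x"

locale coalgebra =
  fixes comult :: "('b \<Rightarrow>\<^sub>0 'k::{comm_ring,comm_monoid_mult}) \<Rightarrow> ('b \<times> 'b \<Rightarrow>\<^sub>0 'k)"
    and counit :: "('b \<Rightarrow>\<^sub>0 'k) \<Rightarrow> 'k"
  assumes comult_linear: "linear_map scale scale comult"
    and counit_linear: "linear_map scale (*) counit"
    and coassoc: "tensor_assoc (tensor_map comult id (comult x)) = tensor_map id comult (comult x)"
    and counit_left: "apply_left counit (comult x) = x"
    and counit_right: "apply_right counit (comult x) = x"

locale nonunital_bialgebra = nonunital_algebra mult + coalgebra comult counit
  for mult :: "('b \<Rightarrow>\<^sub>0 'k::{comm_ring,comm_monoid_mult}) \<Rightarrow> ('b \<Rightarrow>\<^sub>0 'k) \<Rightarrow> ('b \<Rightarrow>\<^sub>0 'k)"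
    and comult :: "('b \<Rightarrow>\<^sub>0 'k) \<Rightarrow> ('b \<times> 'b \<Rightarrow>\<^sub>0 'k)"
    and counit :: "('b \<Rightarrow>\<^sub>0 'k) \<Rightarrow> 'k" +
  assumes comult_mult: "comult (mult x y) = tensor_mult mult (comult x) (comult y)"
    and counit_mult: "counit (mult x y) = counit x * counit y"

locale bialgebra = nonunital_bialgebra mult comult counit + unital_algebra mult unity
  for mult :: "('b \<Rightarrow>\<^sub>0 'k::{comm_ring,comm_monoid_mult}) \<Rightarrow> ('b \<Rightarrow>\<^sub>0 'k) \<Rightarrow> ('b \<Rightarrow>\<^sub>0 'k)"
    and unity :: "'b \<Rightarrow>\<^sub>0 'k"
    and comult :: "('b \<Rightarrow>\<^sub>0 'k) \<Rightarrow> ('b \<times> 'b \<Rightarrow>\<^sub>0 'k)"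
    and counit :: "('b \<Rightarrow>\<^sub>0 'k) \<Rightarrow> 'k" +
  assumes comult_unity: "comult unity = tensor unity unity"
    and counit_unity: "counit unity = 1"

locale hopf_algebra = bialgebra mult unity comult counit
  for mult :: "('b \<Rightarrow>\<^sub>0 'k::{comm_ring,comm_monoid_mult}) \<Rightarrow> ('b \<Rightarrow>\<^sub>0 'k) \<Rightarrow> ('b \<Rightarrow>\<^sub>0 'k)"
    and unity :: "'b \<Rightarrow>\<^sub>0 'k"
    and comult :: "('b \<Rightarrow>\<^sub>0 'k) \<Rightarrow> ('b \<times> 'b \<Rightarrow>\<^sub>0 'k)"
    and counit :: "('b \<Rightarrow>\<^sub>0 'k) \<Rightarrow> 'k" +
  fixes antipode :: "('b \<Rightarrow>\<^sub>0 'k) \<Rightarrow> ('b \<Rightarrow>\<^sub>0 'k)"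
  assumes antipode_linear: "linear_map scale scale antipode"
    and antipode_left: "mult_map mult (tensor_map antipode id (comult x)) = scale (counit x) unity"
    and antipode_right: "mult_map mult (tensor_map id antipode (comult x)) = scale (counit x) unity"

locale graded_module =
  fixes comp :: "nat \<Rightarrow> ('b \<Rightarrow>\<^sub>0 'k::{comm_ring,comm_monoid_mult}) set"
  assumes comp_submodule: "submodule (comp n)"
    and direct_sum: "\<exists>!c :: nat \<Rightarrow>\<^sub>0 ('b \<Rightarrow>\<^sub>0 'k).
      (\<forall>n. Poly_Mapping.lookup c n \<in> comp n) \<and>
      x = (\<Sum>n\<in>Poly_Mapping.keys c. Poly_Mapping.lookup c n)"

definition tensor_comp ::
  "(nat \<Rightarrow> ('b \<Rightarrow>\<^sub>0 'k::{comm_ring,comm_monoid_mult}) set) \<Rightarrow> nat \<Rightarrow> ('b \<times> 'b \<Rightarrow>\<^sub>0 'k) set" where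
  "tensor_comp G n = kspan {tensor x y |x y i j. x \<in> G i \<and> y \<in> G j \<and> i + j = n}"

text \<open>All structure maps are graded; the ring \<open>k\<close> itself is concentrated in degree 0.\<close>

locale graded_hopf_algebra =
  graded_module comp + hopf_algebra mult unity comult counit antipode
  for comp :: "nat \<Rightarrow> ('b \<Rightarrow>\<^sub>0 'k::{comm_ring,comm_monoid_mult}) set"
    and mult :: "('b \<Rightarrow>\<^sub>0 'k) \<Rightarrow> ('b \<Rightarrow>\<^sub>0 'k) \<Rightarrow> ('b \<Rightarrow>\<^sub>0 'k)"
    and unity :: "'b \<Rightarrow>\<^sub>0 'k"
    and comult :: "('b \<Rightarrow>\<^sub>0 'k) \<Rightarrow> ('b \<times> 'b \<Rightarrow>\<^sub>0 'k)"
    and counit :: "('b \<Rightarrow>\<^sub>0 'k) \<Rightarrow> 'k"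
    and antipode :: "('b \<Rightarrow>\<^sub>0 'k) \<Rightarrow> ('b \<Rightarrow>\<^sub>0 'k)" +
  assumes mult_graded: "x \<in> comp i \<Longrightarrow> y \<in> comp j \<Longrightarrow> mult x y \<in> comp (i + j)"
    and unity_graded: "unity \<in> comp 0"
    and comult_graded: "x \<in> comp n \<Longrightarrow> comult x \<in> tensor_comp comp n"
    and counit_graded: "x \<in> comp n \<Longrightarrow> n \<noteq> 0 \<Longrightarrow> counit x = 0"
    and antipode_graded: "x \<in> comp n \<Longrightarrow> antipode x \<in> comp n"

locale connected_graded_cocommutative_hopf_algebra =
  graded_hopf_algebra comp mult unity comult counit antipode
  for comp :: "nat \<Rightarrow> ('b \<Rightarrow>\<^sub>0 'k::{comm_ring,comm_monoid_mult}) set"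
    and mult :: "('b \<Rightarrow>\<^sub>0 'k) \<Rightarrow> ('b \<Rightarrow>\<^sub>0 'k) \<Rightarrow> ('b \<Rightarrow>\<^sub>0 'k)"
    and unity :: "'b \<Rightarrow>\<^sub>0 'k"
    and comult :: "('b \<Rightarrow>\<^sub>0 'k) \<Rightarrow> ('b \<times> 'b \<Rightarrow>\<^sub>0 'k)"
    and counit :: "('b \<Rightarrow>\<^sub>0 'k) \<Rightarrow> 'k"
    and antipode :: "('b \<Rightarrow>\<^sub>0 'k) \<Rightarrow> ('b \<Rightarrow>\<^sub>0 'k)" +
  assumes connected: "comp 0 = {scale c unity |c. True}"
    and cocommutative: "tensor_swap (comult x) = comult x"


section \<open>Mopiscotions\<close>

text \<open>
  A permutation of \<open>[k]\<close> is a function \<open>\<sigma>\<close> with \<open>\<sigma> permutes {1..k}\<close>; thus it is the identity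
  outside \<open>{1..k}\<close>. The entry \<open>\<alpha>\<^sub>i\<close> of a (weak) composition is \<open>\<alpha> ! (i - 1)\<close>.
\<close>

definition weak_mopiscotions :: "(nat list \<times> (nat \<Rightarrow> nat)) set" where
  "weak_mopiscotions = {(\<alpha>, \<sigma>). \<sigma> permutes {1..length \<alpha>}}"

definition mopiscotions :: "(nat list \<times> (nat \<Rightarrow> nat)) set" where
  "mopiscotions = {(\<alpha>, \<sigma>). (\<forall>a\<in>set \<alpha>. 0 < a) \<and> \<sigma> permutes {1..length \<alpha>}}"

typedef mopiscotion = mopiscotions
  by (rule exI[of _ "([], id)"]) (simp add: mopiscotions_def permutes_id)

definition standardization :: "nat list \<Rightarrow> nat \<Rightarrow> nat" where
  "standardization w = (THE \<sigma>. \<sigma> permutes {1..length w} \<and>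
     (\<forall>a\<in>{1..length w}. \<forall>b\<in>{1..length w}. a < b \<longrightarrow>
        (\<sigma> a < \<sigma> b \<longleftrightarrow> w ! (a - 1) \<le> w ! (b - 1))))"

definition red :: "nat list \<Rightarrow> (nat \<Rightarrow> nat) \<Rightarrow> nat list \<times> (nat \<Rightarrow> nat)" where
  "red \<alpha> \<sigma> =
     (let js = filter (\<lambda>i. \<alpha> ! (i - 1) \<noteq> 0) [1..<length \<alpha> + 1]
      in (map (\<lambda>j. \<alpha> ! (j - 1)) js, standardization (map \<sigma> js)))"

text \<open>
  In the next two definitions \<open>k\<close> and \<open>l\<close> are the sizes of \<open>\<sigma>\<close> and \<open>\<tau>\<close>. A number
  \<open>m \<in> {1..k * l}\<close> is written as \<open>m = l * (i - 1) + j\<close> with \<open>i - 1 = (m - 1) div l\<close> and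
  \<open>j - 1 = (m - 1) mod l\<close>. \<open>perm_bracket k l \<tau> \<sigma>\<close> is \<open>\<tau>[\<sigma>]\<close>.
\<close>

definition perm_dsum :: "nat \<Rightarrow> (nat \<Rightarrow> nat) \<Rightarrow> (nat \<Rightarrow> nat) \<Rightarrow> nat \<Rightarrow> nat" where
  "perm_dsum k \<sigma> \<tau> = (\<lambda>m. if m \<le> k then \<sigma> m else k + \<tau> (m - k))"

definition perm_bracket :: "nat \<Rightarrow> nat \<Rightarrow> (nat \<Rightarrow> nat) \<Rightarrow> (nat \<Rightarrow> nat) \<Rightarrow> nat \<Rightarrow> nat" where
  "perm_bracket k l \<tau> \<sigma> = (\<lambda>m.
     if m \<in> {1..k * l}
     then k * (\<tau> ((m - 1) mod l + 1) - 1) + \<sigma> ((m - 1) div l + 1)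
     else m)"


section \<open>PNSym\<close>

type_synonym 'k pnsym = "mopiscotion \<Rightarrow>\<^sub>0 'k"

text \<open>Intended for weak mopiscotions \<open>(\<alpha>, \<sigma>)\<close> only.\<close>

definition F :: "nat list \<Rightarrow> (nat \<Rightarrow> nat) \<Rightarrow> 'k::{comm_ring,comm_monoid_mult} pnsym" where
  "F \<alpha> \<sigma> = basis (Abs_mopiscotion (red \<alpha> \<sigma>))"

definition pnsym_comp :: "nat \<Rightarrow> 'k::{comm_ring,comm_monoid_mult} pnsym set" where
  "pnsym_comp n = kspan {F \<alpha> \<sigma> |\<alpha> \<sigma>. (\<alpha>, \<sigma>) \<in> mopiscotions \<and> sum_list \<alpha> = n}"

definition ext_mult :: "'k::{comm_ring,comm_monoid_mult} pnsym \<Rightarrow> 'k pnsym \<Rightarrow> 'k pnsym" where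
  "ext_mult = bilinear_ext (\<lambda>p q.
     (case (Rep_mopiscotion p, Rep_mopiscotion q) of ((\<alpha>, \<sigma>), (\<beta>, \<tau>)) \<Rightarrow>
       F (\<alpha> @ \<beta>) (perm_dsum (length \<alpha>) \<sigma> \<tau>)))"

text \<open>
  Matrices are given as lists of rows, so that \<open>concat\<close> lists the entries in lexicographic
  order of their positions.
\<close>

definition matrices :: "nat list \<Rightarrow> nat list \<Rightarrow> nat list list set" where
  "matrices \<alpha> \<beta> = {\<gamma>. length \<gamma> = length \<alpha> \<and> (\<forall>r\<in>set \<gamma>. length r = length \<beta>) \<and>
     (\<forall>i<length \<alpha>. (\<Sum>j<length \<beta>. \<gamma> ! i ! j) = \<alpha> ! i) \<and>
     (\<forall>j<length \<beta>. (\<Sum>i<length \<alpha>. \<gamma> ! i ! j) = \<beta> ! j)}"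

definition int_mult :: "'k::{comm_ring,comm_monoid_mult} pnsym \<Rightarrow> 'k pnsym \<Rightarrow> 'k pnsym" where
  "int_mult = bilinear_ext (\<lambda>p q.
     (case (Rep_mopiscotion p, Rep_mopiscotion q) of ((\<alpha>, \<sigma>), (\<beta>, \<tau>)) \<Rightarrow>
       (\<Sum>\<gamma>\<in>matrices \<alpha> \<beta>. F (concat \<gamma>) (perm_bracket (length \<alpha>) (length \<beta>) \<tau> \<sigma>))))"

definition pnsym_comult ::
  "'k::{comm_ring,comm_monoid_mult} pnsym \<Rightarrow> (mopiscotion \<times> mopiscotion \<Rightarrow>\<^sub>0 'k)" where
  "pnsym_comult = linear_ext (\<lambda>p.
     (case Rep_mopiscotion p of (\<alpha>, \<sigma>) \<Rightarrow>
       (\<Sum>(\<beta>, \<gamma>)\<in>{(\<beta>, \<gamma>). length \<beta> = length \<alpha> \<and> length \<gamma> = length \<alpha> \<and> map2 (+) \<beta> \<gamma> = \<alpha>}.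
          tensor (F \<beta> \<sigma>) (F \<gamma> \<sigma>))))"

end

theory Submission
  imports Defs "HOL-Library.Multiset" "HOL-Library.Product_Lexorder"
begin

text \<open>
  A mopiscotion is the same as a finite multiset \<open>A\<close> of positions from a linear order together with
  a map \<open>\<kappa>\<close> from positions to keys in another linear order, injective on the support of \<open>A\<close>, up to
  isomorphism: the multiplicities are the parts of the composition, and the order of the keys is the
  permutation. Positions of multiplicity \<open>0\<close> disappear, so reduction of weak mopiscotions becomes
  invisible. In these terms, the comultiplication sums over all \<open>(B, C)\<close> with \<open>B + C = A\<close>, and the
  internal product of \<open>(A, \<kappa>)\<close> and \<open>(B, \<mu>)\<close> sums over all multisets of pairs of positions with
  marginals \<open>A\<close> and \<open>B\<close>, positions \<open>(i, j)\<close> being ordered lexicographically and having the keys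
  \<open>(\<mu> j, \<kappa> i)\<close>. Each axiom then amounts to a re-indexing of sums of multisets.
\<close>

section \<open>Linear maps between free modules\<close>

text \<open>The obstacle is \<open>red\<close>: comultiplication and internal multiplication create
  zero entries, hence a standardization, so on pairs (\<alpha>, \<sigma>) each axiom would require
  that reduction commute with the operation applied next. Since positions and keys may come from
  arbitrary linear orders and only their relative order counts (\<open>mop_image\<close>), the
  result of one operation can be fed to the next one unreduced. The freedom in the type of keys pays
  most for \<tau>[\<sigma>]: its values are the lexicographic ranks of the pairs (\<tau> j, \<sigma>
  i), so an iterated internal product simply has nested pairs as keys, and no arithmetic with k * l
  enters the proof of associativity. The external product needs less: it takes basis elements to
  basis elements, and unreduced presentations matter only for its compatibility with the
  comultiplication. The antipode is not read off from a formula on compositions; it exists because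
  the grading is connected, as a geometric series for convolution. One counit, the coefficient of
  the empty mopiscotion, serves both products.\<close>

lemma kmodule_scale: "kmodule scale"
  by unfold_locales
    (auto intro!: poly_mapping_eqI simp: lookup_scale lookup_add distrib_left distrib_right mult.assoc)

lemma linear_map_scale: "linear_map scale scale (scale c)"
  by (auto simp: linear_map_def lookup_scale lookup_add distrib_left mult.left_commute
      intro!: poly_mapping_eqI)

lemma linear_map_zero_fun: "linear_map scale scale (\<lambda>x. 0)"
  by (auto simp: linear_map_def lookup_scale intro!: poly_mapping_eqI)

lemma linear_map_id: "linear_map s s (\<lambda>x. x)" "linear_map s s id"
  by (auto simp: linear_map_def)

lemma linear_map_add:
  assumes "linear_map s scale f" "linear_map s scale g"
  shows "linear_map s scale (\<lambda>x. f x + g x)"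
  using assms by (auto simp: linear_map_def lookup_scale lookup_add distrib_left
      intro!: poly_mapping_eqI)

lemma linear_map_fun_sum:
  assumes "\<And>i. i \<in> I \<Longrightarrow> linear_map scale scale (f i)"
  shows "linear_map scale scale (\<lambda>x. \<Sum>i\<in>I. f i x)"
  using assms
  by (induction I rule: infinite_finite_induct) (simp_all add: linear_map_zero_fun linear_map_add)

lemma linear_map_linear_ext: "linear_map scale scale (linear_ext f)"
  unfolding linear_ext_def by (rule kmodule_linear_extension[OF kmodule_scale])

text \<open>In the zero ring \<open>keys (basis b)\<close> is empty, so this is not a mere computation.\<close>

lemma linear_ext_basis [simp]:
  fixes f :: "'b \<Rightarrow> ('c \<Rightarrow>\<^sub>0 'k::{comm_ring,comm_monoid_mult})"
  shows "linear_ext f (basis b) = f b"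
proof (cases "(1::'k) = 0")
  case True
  have "x = 0" for x :: "'c \<Rightarrow>\<^sub>0 'k"
    by (rule poly_mapping_eqI) (metis True lookup_zero mult_1 mult_zero_left)
  then show ?thesis by metis
next
  case False
  then show ?thesis
    by (auto simp: linear_ext_def lookup_scale intro!: poly_mapping_eqI)
qed

lemma linear_map_eqI:
  assumes "linear_map scale s f" "linear_map scale s g" "\<And>b. f (basis b) = g (basis b)"
  shows "f x = g x"
  unfolding linear_map_expand[OF assms(1), of x] linear_map_expand[OF assms(2), of x]
  by (simp only: assms(3))

lemma linear_ext_sum: "linear_ext f (\<Sum>i\<in>I. h i) = (\<Sum>i\<in>I. linear_ext f (h i))"
  by (rule linear_map_sum[OF linear_map_linear_ext])

lemma bilinear_ext_linear_left: "linear_map scale scale (\<lambda>x. bilinear_ext f x y)"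
  unfolding bilinear_ext_def by (rule linear_map_linear_ext)

text \<open>While y varies, the outer sum runs over the fixed support of x with fixed coefficients,
  so the map is a fixed linear combination of the linear maps
  \<open>linear_ext (f a)\<close>.\<close>

lemma bilinear_ext_linear_right: "linear_map scale scale (\<lambda>y. bilinear_ext f x y)"
  unfolding bilinear_ext_def linear_ext_def[of "\<lambda>a. linear_ext (f a) _"]
  by (intro linear_map_fun_sum linear_map_compose[OF linear_map_linear_ext linear_map_scale])

lemma bilinear_map_bilinear_ext: "bilinear_map scale scale scale (bilinear_ext f)"
  unfolding bilinear_map_def
  by (simp add: bilinear_ext_linear_left bilinear_ext_linear_right)

lemma bilinear_ext_basis [simp]: "bilinear_ext f (basis a) (basis b) = f a b"
  by (simp add: bilinear_ext_def)

lemma bilinear_ext_sum_left: "bilinear_ext f (\<Sum>i\<in>I. h i) y = (\<Sum>i\<in>I. bilinear_ext f (h i) y)"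
  by (rule linear_map_sum[OF bilinear_ext_linear_left])

lemma bilinear_ext_sum_right: "bilinear_ext f x (\<Sum>i\<in>I. h i) = (\<Sum>i\<in>I. bilinear_ext f x (h i))"
  by (rule linear_map_sum[OF bilinear_ext_linear_right])

lemma tensor_sum_left: "tensor (\<Sum>i\<in>I. h i) y = (\<Sum>i\<in>I. tensor (h i) y)"
  unfolding tensor_def by (rule bilinear_ext_sum_left)

lemma tensor_sum_right: "tensor x (\<Sum>i\<in>I. h i) = (\<Sum>i\<in>I. tensor x (h i))"
  unfolding tensor_def by (rule bilinear_ext_sum_right)

lemma linear_map_tensor_map: "linear_map scale scale (tensor_map f g)"
  unfolding tensor_map_def[abs_def] by (rule linear_map_linear_ext)

lemma linear_map_tensor_assoc: "linear_map scale scale tensor_assoc"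
  unfolding tensor_assoc_def[abs_def] by (rule linear_map_linear_ext)

lemma linear_map_tensor_swap: "linear_map scale scale tensor_swap"
  unfolding tensor_swap_def[abs_def] by (rule linear_map_linear_ext)

lemma linear_map_apply_left: "linear_map scale scale (apply_left e)"
  unfolding apply_left_def[abs_def] by (rule linear_map_linear_ext)

lemma linear_map_apply_right: "linear_map scale scale (apply_right e)"
  unfolding apply_right_def[abs_def] by (rule linear_map_linear_ext)

lemma linear_map_mult_map: "linear_map scale scale (mult_map m)"
  unfolding mult_map_def[abs_def] by (rule linear_map_linear_ext)

lemma tensor_map_basis: "tensor_map f g (basis (a, b)) = tensor (f (basis a)) (g (basis b))"
  by (simp add: tensor_map_def)

lemma tensor_assoc_basis: "tensor_assoc (basis ((a, b), c)) = basis (a, (b, c))"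
  by (simp add: tensor_assoc_def)

lemma tensor_swap_basis: "tensor_swap (basis (a, b)) = basis (b, a)"
  by (simp add: tensor_swap_def)

lemma apply_left_basis: "apply_left e (basis (a, b)) = scale (e (basis a)) (basis b)"
  by (simp add: apply_left_def)

lemma apply_right_basis: "apply_right e (basis (a, b)) = scale (e (basis b)) (basis a)"
  by (simp add: apply_right_def)

lemma tensor_mult_basis:
  "tensor_mult m (basis (a, b)) (basis (c, d)) =
    tensor (m (basis a) (basis c)) (m (basis b) (basis d))"
  by (simp add: tensor_mult_def)

lemma tensor_mult_sum_left: "tensor_mult m (\<Sum>i\<in>I. h i) y = (\<Sum>i\<in>I. tensor_mult m (h i) y)"
  unfolding tensor_mult_def by (rule bilinear_ext_sum_left)

lemma tensor_mult_sum_right: "tensor_mult m x (\<Sum>i\<in>I. h i) = (\<Sum>i\<in>I. tensor_mult m x (h i))"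
  unfolding tensor_mult_def by (rule bilinear_ext_sum_right)

lemma linear_map_bilinear_left:
  assumes "bilinear_map scale scale scale m" "linear_map s scale f"
  shows "linear_map s scale (\<lambda>x. m (f x) y)"
  using assms by (auto simp: bilinear_map_def linear_map_def)

lemma linear_map_bilinear_right:
  assumes "bilinear_map scale scale scale m" "linear_map s scale f"
  shows "linear_map s scale (\<lambda>x. m y (f x))"
  using assms by (auto simp: bilinear_map_def linear_map_def)

lemma bilinear_map_eqI:
  assumes "\<And>y. linear_map scale s (\<lambda>x. f x y)" "\<And>x. linear_map scale s (\<lambda>y. f x y)"
    and "\<And>y. linear_map scale s (\<lambda>x. g x y)" "\<And>x. linear_map scale s (\<lambda>y. g x y)"
    and "\<And>a b. f (basis a) (basis b) = g (basis a) (basis b)"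
  shows "f x y = g x y"
  by (rule linear_map_eqI[OF assms(1,3)], rule linear_map_eqI[OF assms(2,4)], rule assms(5))

text \<open>\<open>mult_map\<close> is defined through pairs of basis elements. Convolutions apply
  it to tensors of arbitrary elements, such as values of the antipode, and bilinearity closes the
  gap.\<close>

lemma mult_map_tensor:
  assumes m: "bilinear_map scale scale scale m"
  shows "mult_map m (tensor x y) = m x y"
proof (rule bilinear_map_eqI[of scale "\<lambda>x y. mult_map m (tensor x y)" m])
  show "linear_map scale scale (\<lambda>x. m x y)" "linear_map scale scale (\<lambda>y. m x y)" for x y
    using m by (simp_all add: bilinear_map_def)
  show "linear_map scale scale (\<lambda>x. mult_map m (tensor x y))"
    "linear_map scale scale (\<lambda>y. mult_map m (tensor x y))" for x y
    using bilinear_map_tensor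
    by (auto simp: bilinear_map_def intro: linear_map_compose[OF _ linear_map_mult_map])
qed (simp add: tensor_basis mult_map_def)

lemma bilinear_map_assocI:
  assumes m: "bilinear_map scale scale scale m"
    and basis: "\<And>a b c. m (m (basis a) (basis b)) (basis c) = m (basis a) (m (basis b) (basis c))"
  shows "m (m x y) z = m x (m y z)"
proof (rule linear_map_eqI[of scale "\<lambda>z. m (m x y) z" "\<lambda>z. m x (m y z)"])
  note lin = linear_map_bilinear_left[OF m] linear_map_bilinear_right[OF m] linear_map_id(1)
  show "linear_map scale scale (\<lambda>z. m (m x y) z)" "linear_map scale scale (\<lambda>z. m x (m y z))"
    by (intro lin)+
  fix c
  show "m (m x y) (basis c) = m x (m y (basis c))"
    by (rule bilinear_map_eqI[of scale "\<lambda>x y. m (m x y) (basis c)" "\<lambda>x y. m x (m y (basis c))"])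
      (intro lin basis)+
qed

lemma bilinear_map_tensor_mult: "bilinear_map scale scale scale (tensor_mult m)"
  unfolding tensor_mult_def[abs_def] by (rule bilinear_map_bilinear_ext)

lemma scale_0 [simp]: "scale 0 x = 0" and scale_1 [simp]: "scale 1 x = x"
  by (rule poly_mapping_eqI, simp add: lookup_scale)+

lemma linear_map_scale_fun:
  "linear_map scale (*) f \<Longrightarrow> linear_map scale scale (\<lambda>x. scale (f x) v)"
  by (auto simp: linear_map_def lookup_scale lookup_add distrib_right mult.assoc
      intro!: poly_mapping_eqI)

lemma submodule_sum:
  "submodule U \<Longrightarrow> (\<And>i. i \<in> I \<Longrightarrow> f i \<in> U) \<Longrightarrow> (\<Sum>i\<in>I. f i) \<in> U"
  by (induction I rule: infinite_finite_induct) (simp_all add: submodule_def)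

lemma submodule_scale: "submodule U \<Longrightarrow> x \<in> U \<Longrightarrow> scale c x \<in> U"
  by (simp add: submodule_def)

lemma submodule_linear_ext:
  "submodule U \<Longrightarrow> (\<And>b. b \<in> Poly_Mapping.keys x \<Longrightarrow> f b \<in> U) \<Longrightarrow> linear_ext f x \<in> U"
  unfolding linear_ext_def by (intro submodule_sum submodule_scale)

lemma submodule_kspan: "submodule (kspan X)"
  unfolding kspan_def by (rule hull_in) (auto simp: submodule_def)

lemma kspan_superset: "x \<in> X \<Longrightarrow> x \<in> kspan X"
  unfolding kspan_def by (rule hull_inc)

section \<open>Mopiscotions as multisets of positions with keys\<close>

definition rank :: "('i \<Rightarrow> 'o::linorder) \<Rightarrow> 'i set \<Rightarrow> 'i \<Rightarrow> nat" where
  "rank \<kappa> S x = card {y \<in> S. \<kappa> y \<le> \<kappa> x}"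

text \<open>The sets of positions with key at most a given one form a chain, and a strictly larger
  key adds at least its own position. So counting them standardizes the keys to 1, 2, ... without
  changing their order.\<close>

lemma rank_le_iff:
  assumes "finite S" "x \<in> S" "y \<in> S"
  shows "rank \<kappa> S x \<le> rank \<kappa> S y \<longleftrightarrow> \<kappa> x \<le> \<kappa> y"
proof
  assume "\<kappa> x \<le> \<kappa> y"
  then show "rank \<kappa> S x \<le> rank \<kappa> S y"
    unfolding rank_def by (intro card_mono) (use assms in auto)
next
  assume *: "rank \<kappa> S x \<le> rank \<kappa> S y"
  show "\<kappa> x \<le> \<kappa> y"
  proof (rule ccontr)
    assume "\<not> \<kappa> x \<le> \<kappa> y"
    then have "rank \<kappa> S y < rank \<kappa> S x"
      unfolding rank_def by (intro psubset_card_mono) (use assms in auto)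
    with * show False by simp
  qed
qed

lemma rank_image:
  assumes "inj_on \<phi> S" "x \<in> S" "\<And>x y. x \<in> S \<Longrightarrow> y \<in> S \<Longrightarrow> \<kappa>' (\<phi> x) \<le> \<kappa>' (\<phi> y) \<longleftrightarrow> \<kappa> x \<le> \<kappa> y"
  shows "rank \<kappa>' (\<phi> ` S) (\<phi> x) = rank \<kappa> S x"
proof -
  have "{y \<in> \<phi> ` S. \<kappa>' y \<le> \<kappa>' (\<phi> x)} = \<phi> ` {y \<in> S. \<kappa> y \<le> \<kappa> x}"
    using assms by auto
  then show ?thesis
    unfolding rank_def using assms(1) by (simp add: card_image inj_on_subset)
qed

lemma rank_bounds:
  assumes "finite S" "x \<in> S"
  shows "rank \<kappa> S x \<in> {1..card S}"
proof -
  have "card {x} \<le> rank \<kappa> S x" "rank \<kappa> S x \<le> card S"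
    unfolding rank_def by (intro card_mono; use assms in auto)+
  then show ?thesis by simp
qed

text \<open>The positions with value at most \<sigma> i are carried bijectively onto {1..\<sigma>
  i}. A permutation is thus its own rank function, hence determined by the order of its
  values.\<close>

lemma rank_permutes:
  assumes "\<sigma> permutes {1..k}" "i \<in> {1..k::nat}"
  shows "rank \<sigma> {1..k} i = \<sigma> i"
proof -
  have "\<sigma> ` {y \<in> {1..k}. \<sigma> y \<le> \<sigma> i} = {1..\<sigma> i}"
  proof (intro set_eqI iffI)
    fix m assume m: "m \<in> {1..\<sigma> i}"
    have "\<sigma> i \<in> {1..k}" using permutes_in_image[OF assms(1), of i] assms(2) by blast
    with m have "m \<in> \<sigma> ` {1..k}" using permutes_image[OF assms(1)] by simp
    with m show "m \<in> \<sigma> ` {y \<in> {1..k}. \<sigma> y \<le> \<sigma> i}" by auto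
  next
    fix m assume "m \<in> \<sigma> ` {y \<in> {1..k}. \<sigma> y \<le> \<sigma> i}"
    then obtain y where y: "y \<in> {1..k}" "\<sigma> y \<le> \<sigma> i" "m = \<sigma> y" by blast
    then have "\<sigma> y \<in> {1..k}" using permutes_in_image[OF assms(1), of y] by blast
    with y show "m \<in> {1..\<sigma> i}" by simp
  qed
  then have "card {y \<in> {1..k}. \<sigma> y \<le> \<sigma> i} = card {1..\<sigma> i}"
    using card_image[OF permutes_inj_on[OF assms(1)], of "{y \<in> {1..k}. \<sigma> y \<le> \<sigma> i}"] by simp
  then show ?thesis by (simp add: rank_def)
qed

text \<open>Counted from 1, to match the points of a permutation of {1..k}; the underlying list is
  counted from 0.\<close>

definition elem :: "'i::linorder set \<Rightarrow> nat \<Rightarrow> 'i" where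
  "elem S i = sorted_list_of_set S ! (i - 1)"

lemma elem_strict_mono: "finite S \<Longrightarrow> strict_mono_on {1..card S} (elem S)"
  unfolding elem_def
  by (intro strict_mono_onI sorted_wrt_nth_less[of "(<)", OF finite_set_strict_sorted]) auto

lemma elem_image:
  assumes "finite S" shows "elem S ` {1..card S} = S"
proof (intro set_eqI iffI)
  fix x assume "x \<in> elem S ` {1..card S}"
  then obtain i where "i \<in> {1..card S}" "x = sorted_list_of_set S ! (i - 1)"
    by (auto simp: elem_def)
  then have "x \<in> set (sorted_list_of_set S)" using nth_mem[of "i - 1" "sorted_list_of_set S"] by auto
  then show "x \<in> S" using assms by simp
next
  fix x assume "x \<in> S"
  then obtain i where "i < card S" "x = sorted_list_of_set S ! i"
    using assms by (metis in_set_conv_nth length_sorted_list_of_set set_sorted_list_of_set)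
  then show "x \<in> elem S ` {1..card S}"
    by (intro image_eqI[of _ _ "Suc i"]) (simp_all add: elem_def)
qed

lemma elem_in: "finite S \<Longrightarrow> i \<in> {1..card S} \<Longrightarrow> elem S i \<in> S"
  using elem_image by blast

lemma sorted_list_of_set_image:
  assumes "finite S" "strict_mono_on S \<phi>"
  shows "sorted_list_of_set (\<phi> ` S) = map \<phi> (sorted_list_of_set S)"
proof (rule sym, rule sorted_distinct_set_unique)
  have "sorted_wrt (<) (map \<phi> (sorted_list_of_set S))"
    unfolding sorted_wrt_map
    by (rule sorted_wrt_mono_rel[of _ "(<)"])
      (use assms in \<open>auto simp: strict_mono_on_def\<close>)
  then show "sorted (map \<phi> (sorted_list_of_set S))" "distinct (map \<phi> (sorted_list_of_set S))"
    by (simp_all add: strict_sorted_iff)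
qed (use assms in auto)

lemma elem_image_strict_mono:
  assumes "finite S" "strict_mono_on S \<phi>" "i \<in> {1..card S}"
  shows "elem (\<phi> ` S) i = \<phi> (elem S i)"
  unfolding elem_def sorted_list_of_set_image[OF assms(1,2)]
  using assms(3) by (intro nth_map) auto

lemma sorted_list_of_set_interval: "sorted_list_of_set {1..k} = [1..<Suc k]"
  using sorted_list_of_set_range[of 1 "Suc k"] by (simp only: atLeastLessThanSuc_atLeastAtMost)

lemma elem_interval: "i \<in> {1..k} \<Longrightarrow> elem {1..k} i = (i::nat)"
  unfolding elem_def sorted_list_of_set_interval by (simp del: upt_Suc)

section \<open>The mopiscotion of a multiset with keys\<close>

definition mop_perm :: "'i::linorder multiset \<Rightarrow> ('i \<Rightarrow> 'o::linorder) \<Rightarrow> nat \<Rightarrow> nat" where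
  "mop_perm A \<kappa> i =
    (if i \<in> {1..card (set_mset A)} then rank \<kappa> (set_mset A) (elem (set_mset A) i) else i)"

text \<open>If \<kappa> has a repeated key on the support, \<open>mop_perm\<close> is no permutation
  and \<open>Abs_mopiscotion\<close> is applied outside its domain. This is why the lemmas that look
  inside a mopiscotion assume \<open>inj_on\<close>.\<close>

definition mop :: "'i::linorder multiset \<Rightarrow> ('i \<Rightarrow> 'o::linorder) \<Rightarrow> mopiscotion" where
  "mop A \<kappa> = Abs_mopiscotion (map (count A) (sorted_list_of_set (set_mset A)), mop_perm A \<kappa>)"

lemma mop_perm_le_iff:
  assumes "i \<in> {1..card (set_mset A)}" "j \<in> {1..card (set_mset A)}"
  shows "mop_perm A \<kappa> i \<le> mop_perm A \<kappa> j \<longleftrightarrow>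
    \<kappa> (elem (set_mset A) i) \<le> \<kappa> (elem (set_mset A) j)"
  unfolding mop_perm_def if_P[OF assms(1)] if_P[OF assms(2)]
  by (intro rank_le_iff elem_in assms finite_set_mset)

lemma mop_perm_permutes:
  assumes "inj_on \<kappa> (set_mset A)"
  shows "mop_perm A \<kappa> permutes {1..card (set_mset A)}"
proof (rule inj_imp_permutes)
  show "inj_on (mop_perm A \<kappa>) {1..card (set_mset A)}"
  proof (rule inj_onI)
    fix i j assume ij: "i \<in> {1..card (set_mset A)}" "j \<in> {1..card (set_mset A)}"
      "mop_perm A \<kappa> i = mop_perm A \<kappa> j"
    then have "\<kappa> (elem (set_mset A) i) = \<kappa> (elem (set_mset A) j)"
      using mop_perm_le_iff[of i A j \<kappa>] mop_perm_le_iff[of j A i \<kappa>] by simp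
    with assms ij have "elem (set_mset A) i = elem (set_mset A) j"
      by (auto dest!: inj_onD simp: elem_in)
    then show "i = j"
      using ij(1,2) strict_mono_on_imp_inj_on[OF elem_strict_mono[of "set_mset A"]]
      by (auto dest: inj_onD)
  qed
  show "mop_perm A \<kappa> i \<in> {1..card (set_mset A)}" if "i \<in> {1..card (set_mset A)}" for i
    unfolding mop_perm_def if_P[OF that] using that by (intro rank_bounds elem_in) auto
  show "mop_perm A \<kappa> i = i" if "i \<notin> {1..card (set_mset A)}" for i
    unfolding mop_perm_def if_not_P[OF that] ..
qed simp

lemma Rep_mop:
  assumes "inj_on \<kappa> (set_mset A)"
  shows "Rep_mopiscotion (mop A \<kappa>) =
    (map (count A) (sorted_list_of_set (set_mset A)), mop_perm A \<kappa>)"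
  unfolding mop_def using mop_perm_permutes[OF assms]
  by (intro Abs_mopiscotion_inverse) (auto simp: mopiscotions_def)

text \<open>Enumeration of the support, multiplicities and ranks are all preserved by an isomorphism
  of presentations. Monotonicity is asked for on the support alone and \<phi> may change the type of
  positions, so this covers the deletion of zero entries, the flattening of a matrix and the
  rebracketing of triples alike.\<close>

lemma mop_image:
  fixes \<phi> :: "'i::linorder \<Rightarrow> 'j::linorder"
  assumes "strict_mono_on (set_mset A) \<phi>"
    and "\<And>x y. x \<in># A \<Longrightarrow> y \<in># A \<Longrightarrow> \<kappa>' (\<phi> x) \<le> \<kappa>' (\<phi> y) \<longleftrightarrow> \<kappa> x \<le> \<kappa> y"
  shows "mop (image_mset \<phi> A) \<kappa>' = mop A \<kappa>"
proof -
  have inj: "inj_on \<phi> (set_mset A)" by (rule strict_mono_on_imp_inj_on[OF assms(1)])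
  have count: "count (image_mset \<phi> A) (\<phi> x) = count A x" if "x \<in># A" for x
  proof -
    have "\<phi> -` {\<phi> x} \<inter> set_mset A = {x}" using inj that by (auto dest: inj_onD)
    then show ?thesis by (simp add: count_image_mset)
  qed
  have "mop_perm (image_mset \<phi> A) \<kappa>' = mop_perm A \<kappa>"
    using inj assms
    by (auto simp: mop_perm_def fun_eq_iff card_image elem_image_strict_mono elem_in rank_image)
  moreover have "map (count (image_mset \<phi> A)) (sorted_list_of_set (\<phi> ` set_mset A)) =
      map (count A) (sorted_list_of_set (set_mset A))"
    unfolding sorted_list_of_set_image[OF finite_set_mset assms(1)] by (simp add: count)
  ultimately show ?thesis
    unfolding mop_def by simp
qed

lemma image_mset_sum_set: "image_mset f (\<Sum>i\<in>I. g i) = (\<Sum>i\<in>I. image_mset f (g i))"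
  by (induction I rule: infinite_finite_induct) simp_all

section \<open>Weak compositions as multisets of indices, and reduction\<close>

definition cells :: "nat list \<Rightarrow> nat multiset" where
  "cells \<alpha> = (\<Sum>i\<in>{1..length \<alpha>}. replicate_mset (\<alpha> ! (i - 1)) i)"

lemma count_cells: "count (cells \<alpha>) i = (if i \<in> {1..length \<alpha>} then \<alpha> ! (i - 1) else 0)"
proof -
  have "count (cells \<alpha>) i = (\<Sum>j\<in>{1..length \<alpha>}. if j = i then \<alpha> ! (j - 1) else 0)"
    unfolding cells_def count_sum by (intro sum.cong refl) simp
  then show ?thesis by simp
qed

lemma set_cells: "set_mset (cells \<alpha>) = {i \<in> {1..length \<alpha>}. \<alpha> ! (i - 1) \<noteq> 0}"
  by (auto simp: set_mset_def count_cells split: if_splits)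

lemma set_cells_subset: "set_mset (cells \<alpha>) \<subseteq> {1..length \<alpha>}"
  by (auto simp: set_cells)

lemma set_cells_pos:
  assumes "\<forall>a\<in>set \<alpha>. 0 < a" shows "set_mset (cells \<alpha>) = {1..length \<alpha>}"
  using assms by (force simp: set_cells)

lemma size_cells: "size (cells \<alpha>) = sum_list \<alpha>"
proof -
  have "sum_list \<alpha> = (\<Sum>i<length \<alpha>. \<alpha> ! i)" by (simp add: sum_list_sum_nth atLeast0LessThan)
  also have "\<dots> = (\<Sum>i\<in>{1..length \<alpha>}. \<alpha> ! (i - 1))"
    by (rule sum.reindex_bij_witness[of _ "\<lambda>i. i - 1" Suc]) auto
  finally show ?thesis by (simp add: cells_def)
qed

lemma map_count_cells: "map (count (cells \<alpha>)) [1..<Suc (length \<alpha>)] = \<alpha>"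
  by (rule nth_equalityI) (simp_all add: count_cells del: upt_Suc)

lemma mop_cells:
  assumes "(\<alpha>, \<sigma>) \<in> mopiscotions"
  shows "mop (cells \<alpha>) \<sigma> = Abs_mopiscotion (\<alpha>, \<sigma>)"
proof -
  have pos: "\<forall>a\<in>set \<alpha>. 0 < a" and perm: "\<sigma> permutes {1..length \<alpha>}"
    using assms by (auto simp: mopiscotions_def)
  have "mop_perm (cells \<alpha>) \<sigma> i = \<sigma> i" for i
    unfolding mop_perm_def set_cells_pos[OF pos]
    by (simp add: elem_interval rank_permutes[OF perm] permutes_not_in[OF perm] del: One_nat_def)
  then have "mop_perm (cells \<alpha>) \<sigma> = \<sigma>" by (rule ext)
  then show ?thesis
    unfolding mop_def set_cells_pos[OF pos] sorted_list_of_set_interval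
    by (simp only: map_count_cells)
qed

lemma mop_Rep: "Rep_mopiscotion p = (\<alpha>, \<sigma>) \<Longrightarrow> mop (cells \<alpha>) \<sigma> = p"
  by (metis Rep_mopiscotion Rep_mopiscotion_inverse mop_cells)

lemma mop_exhaust:
  obtains A :: "nat multiset" and \<kappa> :: "nat \<Rightarrow> nat" where "p = mop A \<kappa>" "inj_on \<kappa> (set_mset A)"
proof -
  obtain \<alpha> \<sigma> where *: "Rep_mopiscotion p = (\<alpha>, \<sigma>)" by (cases "Rep_mopiscotion p")
  then have "\<sigma> permutes {1..length \<alpha>}" using Rep_mopiscotion[of p] by (auto simp: mopiscotions_def)
  then show ?thesis using that[of "cells \<alpha>" \<sigma>] mop_Rep[OF *] permutes_inj_on by blast
qed

text \<open>The operations are defined on the stored pair (\<alpha>, \<sigma>), whereas arguments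
  about them start from an arbitrary presentation. The increasing enumeration \<phi> of the support
  of A carries the former to the latter.\<close>

lemma mop_canonical:
  assumes inj: "inj_on \<kappa> (set_mset A)" and rep: "Rep_mopiscotion (mop A \<kappa>) = (\<alpha>, \<sigma>)"
  obtains \<phi> where "A = image_mset \<phi> (cells \<alpha>)" "strict_mono_on {1..length \<alpha>} \<phi>"
    "\<And>i j. i \<in> {1..length \<alpha>} \<Longrightarrow> j \<in> {1..length \<alpha>} \<Longrightarrow> \<kappa> (\<phi> i) \<le> \<kappa> (\<phi> j) \<longleftrightarrow> \<sigma> i \<le> \<sigma> j"
proof
  let ?\<phi> = "elem (set_mset A)"
  have \<alpha>: "\<alpha> = map (count A) (sorted_list_of_set (set_mset A))" and \<sigma>: "\<sigma> = mop_perm A \<kappa>"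
    using rep Rep_mop[OF inj] by simp_all
  then have len: "length \<alpha> = card (set_mset A)" by simp
  show mono: "strict_mono_on {1..length \<alpha>} ?\<phi>" unfolding len by (rule elem_strict_mono) simp
  show "\<kappa> (?\<phi> i) \<le> \<kappa> (?\<phi> j) \<longleftrightarrow> \<sigma> i \<le> \<sigma> j" if "i \<in> {1..length \<alpha>}" "j \<in> {1..length \<alpha>}" for i j
    using that unfolding len \<sigma> by (simp add: mop_perm_le_iff)
  \<comment> \<open>The i-th entry of \<alpha> is the multiplicity of the i-th smallest element, so
    the enumeration rebuilds A element by element.\<close>
  have "image_mset ?\<phi> (cells \<alpha>) = (\<Sum>i\<in>{1..length \<alpha>}. replicate_mset (count A (?\<phi> i)) (?\<phi> i))"
    unfolding cells_def
    by (subst image_mset_sum_set) (auto intro!: sum.cong simp: \<alpha> elem_def)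
  also have "\<dots> = (\<Sum>x\<in>?\<phi> ` {1..length \<alpha>}. replicate_mset (count A x) x)"
    by (subst sum.reindex[OF strict_mono_on_imp_inj_on[OF mono]]) simp
  also have "\<dots> = A" unfolding len elem_image[OF finite_set_mset]
    by (auto intro!: multiset_eqI simp: count_sum not_in_iff)
  finally show "A = image_mset ?\<phi> (cells \<alpha>)" by simp
qed

text \<open>This discharges the definite description: two permutations that order all pairs alike
  have equal ranks, and by \<open>rank_permutes\<close> they coincide.\<close>

lemma standardization_eq:
  assumes perm: "\<sigma> permutes {1..length w}"
    and ord: "\<And>a b. a \<in> {1..length w} \<Longrightarrow> b \<in> {1..length w} \<Longrightarrow> a < b \<Longrightarrow>
      \<sigma> a < \<sigma> b \<longleftrightarrow> w ! (a - 1) \<le> w ! (b - 1)"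
  shows "standardization w = \<sigma>"
  unfolding standardization_def
proof (rule the_equality)
  fix \<tau> assume \<tau>: "\<tau> permutes {1..length w} \<and>
     (\<forall>a\<in>{1..length w}. \<forall>b\<in>{1..length w}. a < b \<longrightarrow>
        (\<tau> a < \<tau> b \<longleftrightarrow> w ! (a - 1) \<le> w ! (b - 1)))"
  then have perm': "\<tau> permutes {1..length w}" by blast
  have *: "\<tau> a < \<tau> b \<longleftrightarrow> \<sigma> a < \<sigma> b" if "a \<in> {1..length w}" "b \<in> {1..length w}" "a < b" for a b
    using \<tau> ord that by blast
  have inj: "\<tau> a = \<tau> b \<longleftrightarrow> a = b" "\<sigma> a = \<sigma> b \<longleftrightarrow> a = b" for a b
    using permutes_inj[OF perm'] permutes_inj[OF perm] by (auto dest: injD)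
  \<comment> \<open>The specification speaks only about a < b; injectivity of both permutations
    settles the remaining pairs.\<close>
  have le: "\<tau> a \<le> \<tau> b \<longleftrightarrow> \<sigma> a \<le> \<sigma> b" if "a \<in> {1..length w}" "b \<in> {1..length w}" for a b
    using *[OF that] *[OF that(2,1)] inj[of a b]
    by (metis linorder_less_linear order_le_less order_less_imp_not_less)
  show "\<tau> = \<sigma>"
  proof
    fix i show "\<tau> i = \<sigma> i"
    proof (cases "i \<in> {1..length w}")
      case True
      have "\<tau> i = rank \<tau> {1..length w} i" using rank_permutes[OF perm' True] by simp
      also have "\<dots> = rank \<sigma> {1..length w} i" unfolding rank_def
        by (rule arg_cong[of _ _ card]) (use le True in auto)
      also have "\<dots> = \<sigma> i" using rank_permutes[OF perm True] .
      finally show ?thesis .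
    next
      case False
      then show ?thesis using permutes_not_in[OF perm] permutes_not_in[OF perm'] by simp
    qed
  qed
qed (use assms in blast)

text \<open>Entries of \<alpha> may be 0 here: the indices kept by \<open>red\<close> are the
  support of \<open>cells \<alpha>\<close>, and the standardized permutation is the rank function on
  it. This is the only place where \<open>red\<close> is unfolded.\<close>

lemma F_eq:
  assumes "\<sigma> permutes {1..length \<alpha>}"
  shows "F \<alpha> \<sigma> = basis (mop (cells \<alpha>) \<sigma>)"
proof -
  let ?S = "set_mset (cells \<alpha>)"
  define js where "js = filter (\<lambda>i. \<alpha> ! (i - 1) \<noteq> 0) [1..<length \<alpha> + 1]"
  have js: "js = sorted_list_of_set ?S"
    by (rule sorted_distinct_set_unique)
      (auto simp: js_def set_cells sorted_wrt_filter simp del: upt_Suc)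
  have len: "length js = card ?S" by (simp add: js)
  have inj: "inj_on \<sigma> ?S" using assms permutes_inj_on by blast
  have nth: "map \<sigma> js ! (i - 1) = \<sigma> (elem ?S i)" if "i \<in> {1..card ?S}" for i
    using that len by (auto simp: elem_def js)
  have "standardization (map \<sigma> js) = mop_perm (cells \<alpha>) \<sigma>"
  proof (rule standardization_eq)
    show "mop_perm (cells \<alpha>) \<sigma> permutes {1..length (map \<sigma> js)}"
      unfolding length_map len by (rule mop_perm_permutes[OF inj])
    fix a b assume ab: "a \<in> {1..length (map \<sigma> js)}" "b \<in> {1..length (map \<sigma> js)}" "a < b"
    then have ab': "a \<in> {1..card ?S}" "b \<in> {1..card ?S}" by (simp_all add: len)
    \<comment> \<open>The standardization compares values by \<open><\<close> but entries by
      \<open>\<le>\<close>. For a < b the entries are distinct, so the two agree.\<close>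
    have "elem ?S a < elem ?S b"
      using elem_strict_mono[of ?S] ab' ab(3) by (simp add: strict_mono_on_def)
    then have "\<sigma> (elem ?S a) \<noteq> \<sigma> (elem ?S b)"
      using inj_eq[OF permutes_inj[OF assms]] by simp
    then show "mop_perm (cells \<alpha>) \<sigma> a < mop_perm (cells \<alpha>) \<sigma> b \<longleftrightarrow>
        map \<sigma> js ! (a - 1) \<le> map \<sigma> js ! (b - 1)"
      unfolding nth[OF ab'(1)] nth[OF ab'(2)] linorder_not_le[symmetric, of "mop_perm _ _ a"]
        mop_perm_le_iff[OF ab'(2,1)] by linarith
  qed
  moreover have "map (\<lambda>j. \<alpha> ! (j - 1)) js = map (count (cells \<alpha>)) js"
    by (auto simp: js set_cells count_cells)
  ultimately show ?thesis
    unfolding F_def red_def js_def[symmetric] Let_def mop_def by (simp only: js)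
qed

section \<open>Splittings and couplings of multisets\<close>

definition splits :: "'a multiset \<Rightarrow> ('a multiset \<times> 'a multiset) set" where
  "splits A = {(B, C). B + C = A}"

text \<open>Contingency tables with margins A and B, a table being the multiset of its
  cells.\<close>

definition couplings :: "'a multiset \<Rightarrow> 'b multiset \<Rightarrow> ('a \<times> 'b) multiset set" where
  "couplings A B = {C. image_mset fst C = A \<and> image_mset snd C = B}"

lemma finite_splits: "finite (splits A)"
proof (rule finite_subset)
  show "splits A \<subseteq> (\<lambda>B. (B, A - B)) ` {B. B \<subseteq># A}"
    by (auto simp: splits_def)
  have "{B. B \<subseteq># A} \<subseteq> (\<Union>n\<in>{..size A}. multisets_of_size (set_mset A) n)"
    by (auto simp: multisets_of_size_def size_mset_mono dest: mset_subset_eqD)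
  then show "finite ((\<lambda>B. (B, A - B)) ` {B. B \<subseteq># A})"
    by (intro finite_imageI) (auto dest!: finite_subset intro!: finite_multisets_of_size)
qed

lemma finite_couplings: "finite (couplings A B)"
proof (rule finite_subset)
  show "couplings A B \<subseteq> multisets_of_size (set_mset A \<times> set_mset B) (size A)"
    by (force simp: couplings_def multisets_of_size_def)
qed (auto intro!: finite_multisets_of_size)

lemma splits_subset: "(B, C) \<in> splits A \<Longrightarrow> set_mset B \<subseteq> set_mset A \<and> set_mset C \<subseteq> set_mset A"
  by (auto simp: splits_def)

lemma couplings_subset: "C \<in> couplings A B \<Longrightarrow> set_mset C \<subseteq> set_mset A \<times> set_mset B"
  by (force simp: couplings_def)

text \<open>Both sides run over the ordered decompositions of A into three summands. This is
  coassociativity, and it also gives associativity of convolution.\<close>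

lemma sum_splits_assoc:
  "(\<Sum>(B, C)\<in>splits A. \<Sum>(B1, B2)\<in>splits B. f B1 B2 C) =
   (\<Sum>(B, C)\<in>splits A. \<Sum>(C1, C2)\<in>splits C. f B C1 C2)"
  unfolding split_beta
  by (simp add: sum.Sigma finite_splits,
      rule sum.reindex_bij_witness[of _
        "\<lambda>((B, C), (C1, C2)). ((B + C1, C2), (B, C1))"
        "\<lambda>((B, C), (B1, B2)). ((B1, B2 + C), (B2, C))"])
    (auto simp: splits_def add_ac)

lemma sum_splits_swap: "(\<Sum>(B, C)\<in>splits A. f B C) = (\<Sum>(B, C)\<in>splits A. f C B)"
  by (rule sum.reindex_bij_witness[of _ prod.swap prod.swap]) (auto simp: splits_def add_ac)

lemma image_mset_inv_into:
  assumes "inj_on \<phi> S" "set_mset B \<subseteq> S"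
  shows "image_mset (inv_into S \<phi>) (image_mset \<phi> B) = B"
proof -
  have "image_mset (inv_into S \<phi> \<circ> \<phi>) B = image_mset id B"
    by (rule image_mset_cong) (use assms in auto)
  then show ?thesis by (simp add: multiset.map_comp)
qed

lemma image_mset_f_inv_into:
  assumes "set_mset B \<subseteq> \<phi> ` S"
  shows "image_mset \<phi> (image_mset (inv_into S \<phi>) B) = B"
proof -
  have "image_mset (\<phi> \<circ> inv_into S \<phi>) B = image_mset id B"
    by (rule image_mset_cong) (use assms in \<open>auto simp: f_inv_into_f\<close>)
  then show ?thesis by (simp add: multiset.map_comp)
qed

text \<open>Both parts of a splitting of the image have their support in the image of A, where
  \<phi> can be inverted, so every splitting lifts uniquely.\<close>

lemma sum_splits_image:
  assumes inj: "inj_on \<phi> (set_mset A)"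
  shows "(\<Sum>(B, C)\<in>splits (image_mset \<phi> A). f B C) =
    (\<Sum>(B, C)\<in>splits A. f (image_mset \<phi> B) (image_mset \<phi> C))"
proof (rule sum.reindex_bij_witness[of _
      "map_prod (image_mset \<phi>) (image_mset \<phi>)"
      "map_prod (image_mset (inv_into (set_mset A) \<phi>)) (image_mset (inv_into (set_mset A) \<phi>))"])
  fix p assume "p \<in> splits (image_mset \<phi> A)"
  then obtain B C where p: "p = (B, C)" "B + C = image_mset \<phi> A" by (auto simp: splits_def)
  then have "set_mset B \<subseteq> \<phi> ` set_mset A" "set_mset C \<subseteq> \<phi> ` set_mset A"
    by (metis set_image_mset set_mset_union sup_ge1, metis set_image_mset set_mset_union sup_ge2 p(2))
  note inv = image_mset_f_inv_into[OF this(1)] image_mset_f_inv_into[OF this(2)]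
  show "map_prod (image_mset \<phi>) (image_mset \<phi>) (map_prod (image_mset (inv_into (set_mset A) \<phi>))
      (image_mset (inv_into (set_mset A) \<phi>)) p) = p"
    unfolding p(1) by (simp only: map_prod_simp inv)
  show "map_prod (image_mset (inv_into (set_mset A) \<phi>)) (image_mset (inv_into (set_mset A) \<phi>)) p
      \<in> splits A"
    using image_mset_inv_into[OF inj order_refl]
    by (simp add: p(1) splits_def flip: image_mset_union) (simp only: p(2))
  show "(case map_prod (image_mset (inv_into (set_mset A) \<phi>)) (image_mset (inv_into (set_mset A) \<phi>)) p
      of (B, C) \<Rightarrow> f (image_mset \<phi> B) (image_mset \<phi> C)) = (case p of (B, C) \<Rightarrow> f B C)"
    unfolding p(1) by (simp only: map_prod_simp prod.case inv)
next
  fix p assume "p \<in> splits A"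
  then obtain B C where p: "p = (B, C)" "B + C = A" by (auto simp: splits_def)
  then have "set_mset B \<subseteq> set_mset A" "set_mset C \<subseteq> set_mset A" by auto
  note inv = image_mset_inv_into[OF inj this(1)] image_mset_inv_into[OF inj this(2)]
  show "map_prod (image_mset (inv_into (set_mset A) \<phi>)) (image_mset (inv_into (set_mset A) \<phi>))
      (map_prod (image_mset \<phi>) (image_mset \<phi>) p) = p"
    unfolding p(1) map_prod_simp inv ..
  show "map_prod (image_mset \<phi>) (image_mset \<phi>) p \<in> splits (image_mset \<phi> A)"
    using p by (auto simp: splits_def)
qed

text \<open>Filtering by membership in A separates any part of A + B into its two pieces, so a
  splitting of the union is an independent choice of a splitting of A and one of B.\<close>

lemma sum_splits_disjoint:
  assumes "set_mset A \<inter> set_mset B = {}"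
  shows "(\<Sum>(C, D)\<in>splits (A + B). f C D) =
    (\<Sum>(A1, A2)\<in>splits A. \<Sum>(B1, B2)\<in>splits B. f (A1 + B1) (A2 + B2))"
proof -
  let ?P = "filter_mset (\<lambda>x. x \<in># A)" and ?N = "filter_mset (\<lambda>x. x \<notin># A)"
  have P: "?P A' = A'" "?N A' = {#}" if "set_mset A' \<subseteq> set_mset A" for A'
    using that by (auto simp: filter_mset_eq_conv intro!: filter_mset_cong)
  have N: "?P B' = {#}" "?N B' = B'" if "set_mset B' \<subseteq> set_mset B" for B'
    using that assms by (auto simp: filter_mset_eq_conv)
  have "(\<Sum>(C, D)\<in>splits (A + B). f C D) =
      (\<Sum>((A1, A2), (B1, B2))\<in>splits A \<times> splits B. f (A1 + B1) (A2 + B2))"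
  proof (rule sum.reindex_bij_witness[of _ "\<lambda>((A1, A2), (B1, B2)). (A1 + B1, A2 + B2)"
        "\<lambda>(C, D). ((?P C, ?P D), (?N C, ?N D))"])
    fix p assume "p \<in> splits (A + B)"
    then obtain C D where p: "p = (C, D)" "C + D = A + B" by (auto simp: splits_def)
    have "?P C + ?P D = ?P (A + B)" "?N C + ?N D = ?N (A + B)"
      by (simp_all only: p(2) flip: filter_union_mset)
    then have "?P C + ?P D = A" "?N C + ?N D = B"
      by (simp_all only: filter_union_mset P[OF order_refl] N[OF order_refl] add_0_left add_0_right)
    then show "(case p of (C, D) \<Rightarrow> ((?P C, ?P D), (?N C, ?N D))) \<in> splits A \<times> splits B"
      by (simp add: p splits_def)
  next
    fix q assume "q \<in> splits A \<times> splits B"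
    then obtain A1 A2 B1 B2 where q: "q = ((A1, A2), (B1, B2))" "(A1, A2) \<in> splits A" "(B1, B2) \<in> splits B"
      by auto
    then show "(\<lambda>(C, D). ((?P C, ?P D), (?N C, ?N D)))
        ((\<lambda>((A1, A2), (B1, B2)). (A1 + B1, A2 + B2)) q) = q"
      using splits_subset[OF q(2)] splits_subset[OF q(3)] by (simp add: P N)
  qed (auto simp: splits_def multiset_partition[symmetric] add_ac)
  also have "\<dots> = (\<Sum>(A1, A2)\<in>splits A. \<Sum>(B1, B2)\<in>splits B. f (A1 + B1) (A2 + B2))"
    by (simp add: split_beta sum.cartesian_product)
  finally show ?thesis .
qed

text \<open>As for splittings: the marginals confine the support of a coupling to a product on which
  \<open>map_prod \<phi> \<psi>\<close> can be inverted.\<close>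

lemma sum_couplings_image:
  assumes \<phi>: "inj_on \<phi> (set_mset A)" and \<psi>: "inj_on \<psi> (set_mset B)"
  shows "(\<Sum>C\<in>couplings (image_mset \<phi> A) (image_mset \<psi> B). f C) =
    (\<Sum>C\<in>couplings A B. f (image_mset (map_prod \<phi> \<psi>) C))"
proof (rule sum.reindex_bij_witness[of _ "image_mset (map_prod \<phi> \<psi>)"
      "image_mset (map_prod (inv_into (set_mset A) \<phi>) (inv_into (set_mset B) \<psi>))"])
  have marginals: "image_mset fst (image_mset (map_prod g h) C) = image_mset g (image_mset fst C)"
    "image_mset snd (image_mset (map_prod g h) C) = image_mset h (image_mset snd C)"
    for g h and C :: "('x \<times> 'y) multiset"
    by (simp_all add: multiset.map_comp comp_def)
  {
    fix C assume C: "C \<in> couplings (image_mset \<phi> A) (image_mset \<psi> B)"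
    have "image_mset (map_prod \<phi> \<psi> \<circ> map_prod (inv_into (set_mset A) \<phi>) (inv_into (set_mset B) \<psi>)) C =
        image_mset id C"
      by (rule image_mset_cong)
        (use couplings_subset[OF C] in \<open>auto simp: f_inv_into_f\<close>)
    then show eq: "image_mset (map_prod \<phi> \<psi>)
        (image_mset (map_prod (inv_into (set_mset A) \<phi>) (inv_into (set_mset B) \<psi>)) C) = C"
      by (simp add: multiset.map_comp)
    show "f (image_mset (map_prod \<phi> \<psi>)
        (image_mset (map_prod (inv_into (set_mset A) \<phi>) (inv_into (set_mset B) \<psi>)) C)) = f C"
      by (simp only: eq)
    show "image_mset (map_prod (inv_into (set_mset A) \<phi>) (inv_into (set_mset B) \<psi>)) C \<in> couplings A B"
      using C unfolding couplings_def mem_Collect_eq marginals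
      by (simp only: image_mset_inv_into[OF \<phi> order_refl] image_mset_inv_into[OF \<psi> order_refl] simp_thms)
  }
  {
    fix C assume C: "C \<in> couplings A B"
    have "image_mset (map_prod (inv_into (set_mset A) \<phi>) (inv_into (set_mset B) \<psi>) \<circ> map_prod \<phi> \<psi>) C =
        image_mset id C"
      by (rule image_mset_cong)
        (use couplings_subset[OF C] \<phi> \<psi> in \<open>auto simp: inv_into_f_f\<close>)
    then show "image_mset (map_prod (inv_into (set_mset A) \<phi>) (inv_into (set_mset B) \<psi>))
        (image_mset (map_prod \<phi> \<psi>) C) = C"
      by (simp add: multiset.map_comp)
    show "image_mset (map_prod \<phi> \<psi>) C \<in> couplings (image_mset \<phi> A) (image_mset \<psi> B)"
      using C unfolding couplings_def mem_Collect_eq marginals by (simp only: simp_thms)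
  }
qed

section \<open>Comultiplication\<close>

text \<open>The length has to be supplied because zero entries leave no trace in the
  multiset.\<close>

definition uncells :: "nat \<Rightarrow> nat multiset \<Rightarrow> nat list" where
  "uncells k A = map (count A) [1..<Suc k]"

lemma length_uncells [simp]: "length (uncells k A) = k"
  by (simp add: uncells_def del: upt_Suc)

lemma uncells_nth: "i < k \<Longrightarrow> uncells k A ! i = count A (Suc i)"
  by (simp add: uncells_def del: upt_Suc)

lemma cells_uncells: "set_mset A \<subseteq> {1..k} \<Longrightarrow> cells (uncells k A) = A"
  by (rule multiset_eqI) (auto simp: count_cells uncells_nth not_in_iff)

lemma uncells_cells: "uncells (length \<alpha>) (cells \<alpha>) = \<alpha>"
  unfolding uncells_def by (rule map_count_cells)

lemma cells_inject: "length \<alpha> = length \<beta> \<Longrightarrow> cells \<alpha> = cells \<beta> \<Longrightarrow> \<alpha> = \<beta>"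
  by (metis uncells_cells)

lemma cells_map2:
  "length \<alpha> = length \<beta> \<Longrightarrow> cells (map2 (+) \<alpha> \<beta>) = cells \<alpha> + cells \<beta>"
  by (rule multiset_eqI) (auto simp: count_cells)

lemma Rep_permutes: "Rep_mopiscotion p = (\<alpha>, \<sigma>) \<Longrightarrow> \<sigma> permutes {1..length \<alpha>}"
  using Rep_mopiscotion[of p] by (simp add: mopiscotions_def)

text \<open>For the stored pair, the pairs of weak compositions with entrywise sum \<alpha> are the
  splittings of \<open>cells \<alpha>\<close>, and \<open>F_eq\<close> absorbs the zeros. Both
  halves keep the permutation \<sigma>, so one enumeration \<phi> transports every term to the
  presentation (A, \<kappa>).\<close>

lemma pnsym_comult_mop:
  fixes \<kappa> :: "'i::linorder \<Rightarrow> 'o::linorder"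
  assumes inj: "inj_on \<kappa> (set_mset A)"
  shows "pnsym_comult (basis (mop A \<kappa>)) =
    (\<Sum>(B, C)\<in>splits A. basis (mop B \<kappa>, mop C \<kappa>) :: _ \<Rightarrow>\<^sub>0 'k::{comm_ring,comm_monoid_mult})"
proof -
  obtain \<alpha> \<sigma> where rep: "Rep_mopiscotion (mop A \<kappa>) = (\<alpha>, \<sigma>)"
    by (cases "Rep_mopiscotion (mop A \<kappa>)")
  obtain \<phi> where \<phi>: "A = image_mset \<phi> (cells \<alpha>)" "strict_mono_on {1..length \<alpha>} \<phi>"
    "\<And>i j. i \<in> {1..length \<alpha>} \<Longrightarrow> j \<in> {1..length \<alpha>} \<Longrightarrow> \<kappa> (\<phi> i) \<le> \<kappa> (\<phi> j) \<longleftrightarrow> \<sigma> i \<le> \<sigma> j"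
    using mop_canonical[OF inj rep] by blast
  have perm: "\<sigma> permutes {1..length \<alpha>}" by (rule Rep_permutes[OF rep])
  have mop_eq: "mop (image_mset \<phi> B) \<kappa> = mop B \<sigma>" if "set_mset B \<subseteq> set_mset (cells \<alpha>)" for B
  proof (rule mop_image)
    have B: "set_mset B \<subseteq> {1..length \<alpha>}" using that set_cells_subset by blast
    show "strict_mono_on (set_mset B) \<phi>" by (rule monotone_on_subset[OF \<phi>(2) B])
    show "\<kappa> (\<phi> x) \<le> \<kappa> (\<phi> y) \<longleftrightarrow> \<sigma> x \<le> \<sigma> y" if "x \<in># B" "y \<in># B" for x y
      using B that by (intro \<phi>(3)) auto
  qed
  have "pnsym_comult (basis (mop A \<kappa>)) =
      (\<Sum>(\<beta>, \<gamma>)\<in>{(\<beta>, \<gamma>). length \<beta> = length \<alpha> \<and> length \<gamma> = length \<alpha> \<and> map2 (+) \<beta> \<gamma> = \<alpha>}.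
        tensor (F \<beta> \<sigma>) (F \<gamma> \<sigma>) :: _ \<Rightarrow>\<^sub>0 'k)"
    by (simp add: pnsym_comult_def rep)
  also have "\<dots> = (\<Sum>(B, C)\<in>splits (cells \<alpha>). basis (mop B \<sigma>, mop C \<sigma>))"
  proof (rule sum.reindex_bij_witness[of _ "\<lambda>(B, C). (uncells (length \<alpha>) B, uncells (length \<alpha>) C)"
        "\<lambda>(\<beta>, \<gamma>). (cells \<beta>, cells \<gamma>)"])
    fix p assume "p \<in> splits (cells \<alpha>)"
    then obtain B C where p: "p = (B, C)" "(B, C) \<in> splits (cells \<alpha>)" by (cases p) auto
    have "set_mset B \<subseteq> {1..length \<alpha>}" "set_mset C \<subseteq> {1..length \<alpha>}"
      using splits_subset[OF p(2)] set_cells_subset[of \<alpha>] by blast+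
    note BC = cells_uncells[OF this(1)] cells_uncells[OF this(2)]
    show "(case (case p of (B, C) \<Rightarrow> (uncells (length \<alpha>) B, uncells (length \<alpha>) C)) of
        (\<beta>, \<gamma>) \<Rightarrow> (cells \<beta>, cells \<gamma>)) = p"
      by (simp add: p BC)
    have "map2 (+) (uncells (length \<alpha>) B) (uncells (length \<alpha>) C) = \<alpha>"
      by (rule cells_inject) (use p(2) in \<open>simp_all add: cells_map2 BC splits_def\<close>)
    then show "(case p of (B, C) \<Rightarrow> (uncells (length \<alpha>) B, uncells (length \<alpha>) C)) \<in>
        {(\<beta>, \<gamma>). length \<beta> = length \<alpha> \<and> length \<gamma> = length \<alpha> \<and> map2 (+) \<beta> \<gamma> = \<alpha>}"
      by (simp add: p)
  next
    fix p assume p: "p \<in> {(\<beta>, \<gamma>). length \<beta> = length \<alpha> \<and> length \<gamma> = length \<alpha> \<and> map2 (+) \<beta> \<gamma> = \<alpha>}"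
    then obtain \<beta> \<gamma> where p': "p = (\<beta>, \<gamma>)" "length \<beta> = length \<alpha>" "length \<gamma> = length \<alpha>"
      "map2 (+) \<beta> \<gamma> = \<alpha>" by blast
    show "(case (case p of (\<beta>, \<gamma>) \<Rightarrow> (cells \<beta>, cells \<gamma>)) of
        (B, C) \<Rightarrow> (uncells (length \<alpha>) B, uncells (length \<alpha>) C)) = p"
      using uncells_cells[of \<beta>] uncells_cells[of \<gamma>] p'(2,3) by (simp add: p'(1))
    show "(case p of (\<beta>, \<gamma>) \<Rightarrow> (cells \<beta>, cells \<gamma>)) \<in> splits (cells \<alpha>)"
      using cells_map2[of \<beta> \<gamma>] p'(2-4) by (simp add: p'(1) splits_def)
    show "(case (case p of (\<beta>, \<gamma>) \<Rightarrow> (cells \<beta>, cells \<gamma>)) of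
        (B, C) \<Rightarrow> basis (mop B \<sigma>, mop C \<sigma>)) = (case p of (\<beta>, \<gamma>) \<Rightarrow> tensor (F \<beta> \<sigma>) (F \<gamma> \<sigma>))"
      using perm p'(2,3) by (simp add: p'(1) F_eq tensor_basis)
  qed
  also have "\<dots> = (\<Sum>(B, C)\<in>splits (cells \<alpha>). basis (mop (image_mset \<phi> B) \<kappa>, mop (image_mset \<phi> C) \<kappa>))"
    by (intro sum.cong refl) (use splits_subset in \<open>force simp: mop_eq\<close>)
  also have "\<dots> = (\<Sum>(B, C)\<in>splits A. basis (mop B \<kappa>, mop C \<kappa>))"
    unfolding \<phi>(1) using strict_mono_on_imp_inj_on[OF \<phi>(2)] set_cells_subset[of \<alpha>]
    by (intro sum_splits_image[symmetric]) (auto intro: inj_on_subset)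
  finally show ?thesis .
qed

section \<open>External multiplication\<close>

definition deg :: "mopiscotion \<Rightarrow> nat" where
  "deg p = sum_list (fst (Rep_mopiscotion p))"

lemma deg_mop: "inj_on \<kappa> (set_mset A) \<Longrightarrow> deg (mop A \<kappa>) = size A"
  by (cases "Rep_mopiscotion (mop A \<kappa>)", rule mop_canonical, assumption+)
    (simp add: deg_def size_cells)

definition mop_one :: mopiscotion where
  "mop_one = mop ({#} :: nat multiset) id"

text \<open>On the empty support every map is monotone, even \<open>undefined\<close>; hence the
  unity does not depend on the types of positions and keys.\<close>

lemma mop_empty: "mop ({#} :: 'i::linorder multiset) (\<kappa> :: 'i \<Rightarrow> 'o::linorder) = mop_one"
  using mop_image[of "{#}" undefined \<kappa> id] by (simp add: mop_one_def strict_mono_on_def)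

text \<open>The degree is the size of the multiset, and only the empty one has size 0. Connectedness
  and the multiplicativity of the counit for the external product both rest on this.\<close>

lemma deg_eq_0_iff: "deg p = 0 \<longleftrightarrow> p = mop_one"
proof -
  obtain A :: "nat multiset" and \<kappa> :: "nat \<Rightarrow> nat" where p: "p = mop A \<kappa>" "inj_on \<kappa> (set_mset A)"
    by (rule mop_exhaust)
  show ?thesis
    using deg_mop[OF p(2)] deg_mop[of id "{#} :: nat multiset"] unfolding p(1)
    by (auto simp: mop_empty)
qed

lemma mop_eq_one_iff: "inj_on \<kappa> (set_mset A) \<Longrightarrow> mop A \<kappa> = mop_one \<longleftrightarrow> A = {#}"
  by (simp flip: deg_eq_0_iff add: deg_mop)

lemma Rep_mop_one: "Rep_mopiscotion mop_one = ([], id)"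
  by (auto simp: mop_one_def Rep_mop mop_perm_def fun_eq_iff)

section \<open>Direct sums of permutations and the monoid of mopiscotions\<close>

lemma perm_dsum_permutes:
  assumes "\<sigma> permutes {1..k}" "\<tau> permutes {1..l}"
  shows "perm_dsum k \<sigma> \<tau> permutes {1..k + l}"
proof (rule inj_imp_permutes)
  have \<sigma>: "\<sigma> i \<in> {1..k} \<longleftrightarrow> i \<in> {1..k}" for i by (rule permutes_in_image[OF assms(1)])
  have \<tau>: "\<tau> i \<in> {1..l} \<longleftrightarrow> i \<in> {1..l}" for i by (rule permutes_in_image[OF assms(2)])
  show "perm_dsum k \<sigma> \<tau> i \<in> {1..k + l}" if "i \<in> {1..k + l}" for i
    using that \<sigma>[of i] \<tau>[of "i - k"] by (cases "i \<le> k") (auto simp: perm_dsum_def)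
  show "inj_on (perm_dsum k \<sigma> \<tau>) {1..k + l}"
  proof (rule inj_onI)
    fix i j assume ij: "i \<in> {1..k + l}" "j \<in> {1..k + l}" "perm_dsum k \<sigma> \<tau> i = perm_dsum k \<sigma> \<tau> j"
    then show "i = j"
      using inj_eq[OF permutes_inj[OF assms(1)], of i j] inj_eq[OF permutes_inj[OF assms(2)], of "i - k" "j - k"]
        \<sigma>[of i] \<sigma>[of j] \<tau>[of "i - k"] \<tau>[of "j - k"]
      by (cases "i \<le> k"; cases "j \<le> k") (auto simp: perm_dsum_def)
  qed
  show "perm_dsum k \<sigma> \<tau> i = i" if "i \<notin> {1..k + l}" for i
  proof (cases "i \<le> k")
    case True
    then show ?thesis using that permutes_not_in[OF assms(1), of i] by (auto simp: perm_dsum_def)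
  next
    case False
    then have "i - k \<notin> {1..l}" using that by auto
    then show ?thesis using False permutes_not_in[OF assms(2)] by (simp add: perm_dsum_def)
  qed
qed simp

text \<open>Two compositions concatenate to a composition, so no reduction occurs and basis elements
  multiply to basis elements: with the external product, PNSym is the monoid algebra of this
  operation.\<close>

definition mop_mult :: "mopiscotion \<Rightarrow> mopiscotion \<Rightarrow> mopiscotion" where
  "mop_mult p q = (case (Rep_mopiscotion p, Rep_mopiscotion q) of ((\<alpha>, \<sigma>), (\<beta>, \<tau>)) \<Rightarrow>
    Abs_mopiscotion (\<alpha> @ \<beta>, perm_dsum (length \<alpha>) \<sigma> \<tau>))"

lemma append_mopiscotion:
  assumes "Rep_mopiscotion p = (\<alpha>, \<sigma>)" "Rep_mopiscotion q = (\<beta>, \<tau>)"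
  shows "(\<alpha> @ \<beta>, perm_dsum (length \<alpha>) \<sigma> \<tau>) \<in> mopiscotions"
  using Rep_mopiscotion[of p] Rep_mopiscotion[of q] assms
    perm_dsum_permutes[OF Rep_permutes[OF assms(1)] Rep_permutes[OF assms(2)]]
  by (auto simp: mopiscotions_def)

lemma Rep_mop_mult:
  assumes "Rep_mopiscotion p = (\<alpha>, \<sigma>)" "Rep_mopiscotion q = (\<beta>, \<tau>)"
  shows "Rep_mopiscotion (mop_mult p q) = (\<alpha> @ \<beta>, perm_dsum (length \<alpha>) \<sigma> \<tau>)"
  using append_mopiscotion[OF assms] by (simp add: mop_mult_def assms Abs_mopiscotion_inverse)

lemma ext_mult_basis: "ext_mult (basis p) (basis q) = basis (mop_mult p q)"
proof -
  obtain \<alpha> \<sigma> \<beta> \<tau> where rep: "Rep_mopiscotion p = (\<alpha>, \<sigma>)" "Rep_mopiscotion q = (\<beta>, \<tau>)"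
    by (meson surj_pair)
  note mem = append_mopiscotion[OF rep]
  then show ?thesis
    by (simp add: ext_mult_def rep mop_mult_def F_eq[of _ "\<alpha> @ \<beta>"] mopiscotions_def mop_cells[OF mem])
qed

lemma mop_mult_assoc: "mop_mult (mop_mult p q) r = mop_mult p (mop_mult q r)"
proof -
  obtain \<alpha> \<sigma> \<beta> \<tau> \<gamma> \<rho> where rep: "Rep_mopiscotion p = (\<alpha>, \<sigma>)" "Rep_mopiscotion q = (\<beta>, \<tau>)"
    "Rep_mopiscotion r = (\<gamma>, \<rho>)"
    by (meson surj_pair)
  have "perm_dsum (k + l) (perm_dsum k \<sigma> \<tau>) \<rho> = perm_dsum k \<sigma> (perm_dsum l \<tau> \<rho>)" for k l
    by (auto simp: perm_dsum_def fun_eq_iff)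
  then show ?thesis
    by (simp add: Rep_mop_mult[OF Rep_mop_mult] Rep_mop_mult[OF _ Rep_mop_mult] rep
        flip: Rep_mopiscotion_inject)
qed

lemma mop_mult_one: "mop_mult mop_one p = p" "mop_mult p mop_one = p"
proof -
  obtain \<alpha> \<sigma> where rep: "Rep_mopiscotion p = (\<alpha>, \<sigma>)" by (meson surj_pair)
  note perm = Rep_permutes[OF rep]
  have "perm_dsum 0 id \<sigma> = \<sigma>" "perm_dsum (length \<alpha>) \<sigma> id = \<sigma>"
    using permutes_not_in[OF perm] by (auto simp: perm_dsum_def fun_eq_iff)
  then show "mop_mult mop_one p = p" "mop_mult p mop_one = p"
    by (simp_all add: Rep_mop_mult[OF Rep_mop_one rep] Rep_mop_mult[OF rep Rep_mop_one] rep
        flip: Rep_mopiscotion_inject)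
qed

lemma deg_mop_mult: "deg (mop_mult p q) = deg p + deg q"
proof -
  obtain \<alpha> \<sigma> \<beta> \<tau> where rep: "Rep_mopiscotion p = (\<alpha>, \<sigma>)" "Rep_mopiscotion q = (\<beta>, \<tau>)"
    by (meson surj_pair)
  then show ?thesis by (simp add: deg_def Rep_mop_mult[OF rep])
qed

lemma cells_append: "cells (\<alpha> @ \<beta>) = cells \<alpha> + image_mset (\<lambda>i. length \<alpha> + i) (cells \<beta>)"
proof -
  have "cells (\<alpha> @ \<beta>) = (\<Sum>i\<in>{1..length \<alpha>} \<union> {length \<alpha> + 1..length \<alpha> + length \<beta>}.
      replicate_mset ((\<alpha> @ \<beta>) ! (i - 1)) i)"
    unfolding cells_def by (intro sum.cong) auto
  also have "\<dots> = (\<Sum>i\<in>{1..length \<alpha>}. replicate_mset ((\<alpha> @ \<beta>) ! (i - 1)) i) +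
      (\<Sum>i\<in>{length \<alpha> + 1..length \<alpha> + length \<beta>}. replicate_mset ((\<alpha> @ \<beta>) ! (i - 1)) i)"
    by (intro sum.union_disjoint) auto
  also have "(\<Sum>i\<in>{1..length \<alpha>}. replicate_mset ((\<alpha> @ \<beta>) ! (i - 1)) i) = cells \<alpha>"
    unfolding cells_def by (intro sum.cong) (auto simp: nth_append)
  also have "(\<Sum>i\<in>{length \<alpha> + 1..length \<alpha> + length \<beta>}. replicate_mset ((\<alpha> @ \<beta>) ! (i - 1)) i) =
      (\<Sum>i\<in>{1..length \<beta>}. replicate_mset (\<beta> ! (i - 1)) (length \<alpha> + i))"
    by (rule sum.reindex_bij_witness[of _ "\<lambda>i. length \<alpha> + i" "\<lambda>i. i - length \<alpha>"])
      (auto simp: nth_append)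
  also have "\<dots> = image_mset (\<lambda>i. length \<alpha> + i) (cells \<beta>)"
    by (simp add: cells_def image_mset_sum_set)
  finally show ?thesis .
qed

text \<open>The halves of a comultiplied product are unreduced: A and B need not fill {1..k} and
  {1..l}, and the shift is k rather than the number of positions in use. Reducing the factors before
  or after forming the direct sum must give the same result.\<close>

lemma mop_mult_mop:
  assumes perm: "\<sigma> permutes {1..k}" "\<tau> permutes {1..l}"
    and sub: "set_mset A \<subseteq> {1..k}" "set_mset B \<subseteq> {1..l}"
  shows "mop_mult (mop A \<sigma>) (mop B \<tau>) = mop (A + image_mset (\<lambda>i. k + i) B) (perm_dsum k \<sigma> \<tau>)"
proof -
  have inj: "inj_on \<sigma> (set_mset A)" "inj_on \<tau> (set_mset B)"
    using perm permutes_inj_on by blast+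
  obtain \<alpha> \<sigma>' \<beta> \<tau>' where rep: "Rep_mopiscotion (mop A \<sigma>) = (\<alpha>, \<sigma>')"
    "Rep_mopiscotion (mop B \<tau>) = (\<beta>, \<tau>')"
    by (meson surj_pair)
  obtain \<phi> where \<phi>: "A = image_mset \<phi> (cells \<alpha>)" "strict_mono_on {1..length \<alpha>} \<phi>"
    "\<And>i j. i \<in> {1..length \<alpha>} \<Longrightarrow> j \<in> {1..length \<alpha>} \<Longrightarrow> \<sigma> (\<phi> i) \<le> \<sigma> (\<phi> j) \<longleftrightarrow> \<sigma>' i \<le> \<sigma>' j"
    using mop_canonical[OF inj(1) rep(1)] by blast
  obtain \<psi> where \<psi>: "B = image_mset \<psi> (cells \<beta>)" "strict_mono_on {1..length \<beta>} \<psi>"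
    "\<And>i j. i \<in> {1..length \<beta>} \<Longrightarrow> j \<in> {1..length \<beta>} \<Longrightarrow> \<tau> (\<psi> i) \<le> \<tau> (\<psi> j) \<longleftrightarrow> \<tau>' i \<le> \<tau>' j"
    using mop_canonical[OF inj(2) rep(2)] by blast
  note mem = append_mopiscotion[OF rep]
  then have "\<forall>a\<in>set \<alpha>. 0 < a" "\<forall>b\<in>set \<beta>. 0 < b" by (auto simp: mopiscotions_def)
  note pos = set_cells_pos[OF this(1)] set_cells_pos[OF this(2)]
  have \<phi>_in: "\<phi> i \<in> {1..k}" if "i \<in> {1..length \<alpha>}" for i
  proof -
    have "\<phi> i \<in># A" unfolding \<phi>(1) using that by (simp only: set_image_mset pos imageI)
    then show ?thesis using sub(1) by blast
  qed
  have \<psi>_in: "\<psi> i \<in> {1..l}" if "i \<in> {1..length \<beta>}" for i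
  proof -
    have "\<psi> i \<in># B" unfolding \<psi>(1) using that by (simp only: set_image_mset pos imageI)
    then show ?thesis using sub(2) by blast
  qed
  \<comment> \<open>Glues the enumerations of the two supports. The second block begins after
    \<open>length \<alpha>\<close> in the reduced concatenation, but after k in the unreduced
    one.\<close>
  define \<chi> where "\<chi> m = (if m \<le> length \<alpha> then \<phi> m else k + \<psi> (m - length \<alpha>))" for m
  have "mop_mult (mop A \<sigma>) (mop B \<tau>) = mop (cells (\<alpha> @ \<beta>)) (perm_dsum (length \<alpha>) \<sigma>' \<tau>')"
    by (simp add: mop_mult_def rep mop_cells[OF mem])
  also have "\<dots> = mop (image_mset \<chi> (cells (\<alpha> @ \<beta>))) (perm_dsum k \<sigma> \<tau>)"
  proof (rule mop_image[symmetric])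
    have cells: "set_mset (cells (\<alpha> @ \<beta>)) \<subseteq> {1..length \<alpha> + length \<beta>}"
      using set_cells_subset[of "\<alpha> @ \<beta>"] by simp
    show "strict_mono_on (set_mset (cells (\<alpha> @ \<beta>))) \<chi>"
    proof (rule strict_mono_onI)
      fix i j assume "i \<in># cells (\<alpha> @ \<beta>)" "j \<in># cells (\<alpha> @ \<beta>)" "i < j"
      then have ij: "i \<in> {1..length \<alpha> + length \<beta>}" "j \<in> {1..length \<alpha> + length \<beta>}" "i < j"
        using cells by blast+
      consider "j \<le> length \<alpha>" | "i \<le> length \<alpha>" "\<not> j \<le> length \<alpha>" | "\<not> i \<le> length \<alpha>" by linarith
      then show "\<chi> i < \<chi> j"
      proof cases
        case 1
        then show ?thesis using ij strict_mono_onD[OF \<phi>(2), of i j] by (simp add: \<chi>_def)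
      next
        case 2
        then have "i \<in> {1..length \<alpha>}" "j - length \<alpha> \<in> {1..length \<beta>}" using ij by auto
        then have "\<phi> i \<in> {1..k}" "\<psi> (j - length \<alpha>) \<in> {1..l}" by (simp_all only: \<phi>_in \<psi>_in)
        with 2 show ?thesis by (simp add: \<chi>_def)
      next
        case 3
        then have "i - length \<alpha> \<in> {1..length \<beta>}" "j - length \<alpha> \<in> {1..length \<beta>}"
          "i - length \<alpha> < j - length \<alpha>" using ij by auto
        from strict_mono_onD[OF \<psi>(2) this] show ?thesis using 3 ij(3) by (simp add: \<chi>_def)
      qed
    qed
    have \<sigma>: "\<sigma> i \<in> {1..k} \<longleftrightarrow> i \<in> {1..k}" "\<sigma>' j \<in> {1..length \<alpha>} \<longleftrightarrow> j \<in> {1..length \<alpha>}" for i j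
      by (rule permutes_in_image[OF perm(1)], rule permutes_in_image[OF Rep_permutes[OF rep(1)]])
    have \<tau>: "\<tau> i \<in> {1..l} \<longleftrightarrow> i \<in> {1..l}" "\<tau>' j \<in> {1..length \<beta>} \<longleftrightarrow> j \<in> {1..length \<beta>}" for i j
      by (rule permutes_in_image[OF perm(2)], rule permutes_in_image[OF Rep_permutes[OF rep(2)]])
    fix i j assume "i \<in># cells (\<alpha> @ \<beta>)" "j \<in># cells (\<alpha> @ \<beta>)"
    then have ij: "i \<in> {1..length \<alpha> + length \<beta>}" "j \<in> {1..length \<alpha> + length \<beta>}"
      using cells by blast+
    \<comment> \<open>Keys from the first block stay within the bound of that block and keys from
      the second exceed it, before and after reduction. So comparisons across the blocks agree, and
      those inside a block are the property of \<phi> or \<psi>.\<close>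
    have l: "perm_dsum k \<sigma> \<tau> (\<chi> i) = \<sigma> (\<phi> i) \<and> perm_dsum (length \<alpha>) \<sigma>' \<tau>' i = \<sigma>' i \<and>
        \<sigma> (\<phi> i) \<le> k \<and> \<sigma>' i \<le> length \<alpha>"
      if "i \<in> {1..length \<alpha> + length \<beta>}" "i \<le> length \<alpha>" for i
      using that \<phi>_in[of i] \<sigma>(1)[of "\<phi> i"] \<sigma>(2)[of i] by (simp add: \<chi>_def perm_dsum_def)
    have r: "perm_dsum k \<sigma> \<tau> (\<chi> i) = k + \<tau> (\<psi> (i - length \<alpha>)) \<and>
        perm_dsum (length \<alpha>) \<sigma>' \<tau>' i = length \<alpha> + \<tau>' (i - length \<alpha>) \<and>
        \<tau> (\<psi> (i - length \<alpha>)) > 0 \<and> \<tau>' (i - length \<alpha>) > 0"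
      if "i \<in> {1..length \<alpha> + length \<beta>}" "\<not> i \<le> length \<alpha>" for i
      using that \<psi>_in[of "i - length \<alpha>"] \<tau>(1)[of "\<psi> (i - length \<alpha>)"] \<tau>(2)[of "i - length \<alpha>"]
      by (auto simp: \<chi>_def perm_dsum_def)
    show "perm_dsum k \<sigma> \<tau> (\<chi> i) \<le> perm_dsum k \<sigma> \<tau> (\<chi> j) \<longleftrightarrow>
        perm_dsum (length \<alpha>) \<sigma>' \<tau>' i \<le> perm_dsum (length \<alpha>) \<sigma>' \<tau>' j"
    proof (cases "i \<le> length \<alpha>"; cases "j \<le> length \<alpha>")
      assume "i \<le> length \<alpha>" "j \<le> length \<alpha>"
      then show ?thesis using l[of i] l[of j] \<phi>(3)[of i j] ij by simp
    next
      assume "i \<le> length \<alpha>" "\<not> j \<le> length \<alpha>"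
      then show ?thesis using l[of i] r[of j] ij by linarith
    next
      assume "\<not> i \<le> length \<alpha>" "j \<le> length \<alpha>"
      then show ?thesis using r[of i] l[of j] ij by linarith
    next
      assume *: "\<not> i \<le> length \<alpha>" "\<not> j \<le> length \<alpha>"
      then have "i - length \<alpha> \<in> {1..length \<beta>}" "j - length \<alpha> \<in> {1..length \<beta>}" using ij by auto
      from \<psi>(3)[OF this] show ?thesis using r[OF ij(1) *(1)] r[OF ij(2) *(2)] by simp
    qed
  qed
  also have "image_mset \<chi> (cells (\<alpha> @ \<beta>)) = A + image_mset (\<lambda>i. k + i) B"
  proof -
    have "image_mset \<chi> (cells \<alpha>) = image_mset \<phi> (cells \<alpha>)"
      by (rule image_mset_cong) (auto simp: pos \<chi>_def)
    moreover have "image_mset (\<chi> \<circ> (\<lambda>i. length \<alpha> + i)) (cells \<beta>) = image_mset ((\<lambda>i. k + i) \<circ> \<psi>) (cells \<beta>)"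
      by (rule image_mset_cong) (auto simp: pos \<chi>_def)
    ultimately show ?thesis
      by (simp add: cells_append multiset.map_comp \<phi>(1)[symmetric]) (simp add: \<psi>(1) multiset.map_comp)
  qed
  finally show ?thesis .
qed

text \<open>The positions of a product form two disjoint blocks, so its splittings are pairs of
  splittings of the factors. \<open>mop_mult_mop\<close> recognises each half as a product of
  halves.\<close>

lemma comult_ext_mult_basis:
  "pnsym_comult (ext_mult (basis p) (basis q)) =
    tensor_mult ext_mult (pnsym_comult (basis p)) (pnsym_comult (basis q :: 'k::{comm_ring,comm_monoid_mult} pnsym))"
proof -
  obtain \<alpha> \<sigma> \<beta> \<tau> where rep: "Rep_mopiscotion p = (\<alpha>, \<sigma>)" "Rep_mopiscotion q = (\<beta>, \<tau>)"
    by (meson surj_pair)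
  note perm = Rep_permutes[OF rep(1)] Rep_permutes[OF rep(2)]
  let ?A = "cells \<alpha>" and ?B = "cells \<beta>" and ?s = "image_mset (\<lambda>i. length \<alpha> + i)"
  let ?\<rho> = "perm_dsum (length \<alpha>) \<sigma> \<tau>"
  have p: "p = mop ?A \<sigma>" and q: "q = mop ?B \<tau>" using mop_Rep rep by simp_all
  have inj: "inj_on \<sigma> (set_mset ?A)" "inj_on \<tau> (set_mset ?B)"
    "inj_on ?\<rho> (set_mset (?A + ?s ?B))"
    using perm perm_dsum_permutes[OF perm] permutes_inj_on by blast+
  have sub: "set_mset ?A \<subseteq> {1..length \<alpha>}" "set_mset ?B \<subseteq> {1..length \<beta>}"
    by (rule set_cells_subset)+
  have mult: "mop (A' + ?s B') ?\<rho> = mop_mult (mop A' \<sigma>) (mop B' \<tau>)"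
    if "set_mset A' \<subseteq> set_mset ?A" "set_mset B' \<subseteq> set_mset ?B" for A' B'
    by (rule mop_mult_mop[OF perm, symmetric]) (use that sub in blast)+
  have disj: "set_mset ?A \<inter> set_mset (?s ?B) = {}"
    using sub by fastforce
  have "pnsym_comult (ext_mult (basis p) (basis q)) = (pnsym_comult (basis (mop (?A + ?s ?B) ?\<rho>)) :: _ \<Rightarrow>\<^sub>0 'k)"
    by (simp add: ext_mult_basis p q mult)
  also have "\<dots> = (\<Sum>(C, D)\<in>splits (?A + ?s ?B). basis (mop C ?\<rho>, mop D ?\<rho>))"
    by (rule pnsym_comult_mop[OF inj(3)])
  also have "\<dots> = (\<Sum>(A1, A2)\<in>splits ?A. \<Sum>(B1, B2)\<in>splits ?B.
      basis (mop (A1 + ?s B1) ?\<rho>, mop (A2 + ?s B2) ?\<rho>))"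
    unfolding sum_splits_disjoint[OF disj] by (subst sum_splits_image) (simp_all add: inj_on_def)
  also have "\<dots> = (\<Sum>(A1, A2)\<in>splits ?A. \<Sum>(B1, B2)\<in>splits ?B.
      basis (mop_mult (mop A1 \<sigma>) (mop B1 \<tau>), mop_mult (mop A2 \<sigma>) (mop B2 \<tau>)))"
    by (intro sum.cong refl) (auto dest!: splits_subset simp: mult intro!: sum.cong)
  also have "\<dots> = tensor_mult ext_mult (pnsym_comult (basis p)) (pnsym_comult (basis q))"
    unfolding p q pnsym_comult_mop[OF inj(1)] pnsym_comult_mop[OF inj(2)]
    by (simp add: tensor_mult_sum_left tensor_mult_sum_right split_beta tensor_mult_basis
        ext_mult_basis tensor_basis) (rule sum.swap)
  finally show ?thesis .
qed

section \<open>Internal multiplication\<close>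

definition cell_index :: "nat \<Rightarrow> nat \<times> nat \<Rightarrow> nat" where
  "cell_index l = (\<lambda>(i, j). l * (i - 1) + j)"

definition cell_at :: "nat \<Rightarrow> nat \<Rightarrow> nat \<times> nat" where
  "cell_at l m = ((m - 1) div l + 1, (m - 1) mod l + 1)"

lemma cell_at_index: "i \<in> {1..k} \<Longrightarrow> j \<in> {1..l} \<Longrightarrow> cell_at l (cell_index l (i, j)) = (i, j)"
proof -
  assume ij: "i \<in> {1..k}" "j \<in> {1..l}"
  then have eq: "cell_index l (i, j) - 1 = l * (i - 1) + (j - 1)" "j - 1 < l"
    by (auto simp: cell_index_def)
  from this(2) have div_mod: "(l * (i - 1) + (j - 1)) div l = i - 1" "(l * (i - 1) + (j - 1)) mod l = j - 1"
    by simp_all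
  show ?thesis unfolding cell_at_def eq(1) div_mod using ij by simp
qed

lemma cell_index_at: "m \<in> {1..k * l} \<Longrightarrow> cell_index l (cell_at l m) = m"
  by (simp add: cell_at_def cell_index_def)

lemma cell_index_in:
  assumes "i \<in> {1..k}" "j \<in> {1..l}" shows "cell_index l (i, j) \<in> {1..k * l}"
proof -
  have "l * (i - 1) + j \<le> l * (i - 1) + l" using assms by simp
  also have "\<dots> = i * l" using assms by (cases i) (simp_all add: algebra_simps)
  also have "\<dots> \<le> k * l" using assms by simp
  finally show ?thesis using assms by (simp add: cell_index_def)
qed

lemma cell_at_in: "m \<in> {1..k * l} \<Longrightarrow> cell_at l m \<in> {1..k} \<times> {1..l}"
proof -
  assume m: "m \<in> {1..k * l}"
  then have "0 < l" by (cases l) auto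
  moreover have "(m - 1) div l < k" using m by (intro less_mult_imp_div_less) auto
  ultimately show ?thesis by (auto simp: cell_at_def Suc_le_eq)
qed

text \<open>A change of row moves the index by at least l, whereas columns in {1..l} differ by less
  than l. Rows must start at 1: truncated subtraction would give row 0 the indices of row 1.\<close>

lemma cell_index_less:
  assumes "j \<in> {1..l}" "j' \<in> {1..l}" "i \<ge> 1" "(i, j) < (i', j')"
  shows "cell_index l (i, j) < cell_index l (i', j')"
proof (cases "i < i'")
  case True
  then obtain d where "i' = Suc (i + d)" using less_imp_Suc_add by blast
  then have "i' - 1 = (i - 1) + Suc d" using assms(3) by simp
  then have "l * (i' - 1) = l * (i - 1) + l + l * d" by (simp add: algebra_simps)
  then show ?thesis using assms(1,2) by (simp add: cell_index_def)
next
  case False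
  then show ?thesis using assms(4) by (auto simp: cell_index_def)
qed

lemma cell_index_le_iff:
  assumes "j \<in> {1..l}" "j' \<in> {1..l}" "i \<ge> 1" "i' \<ge> 1"
  shows "cell_index l (i, j) \<le> cell_index l (i', j') \<longleftrightarrow> (i, j) \<le> (i', j')"
proof -
  consider "(i, j) < (i', j')" | "(i, j) = (i', j')" | "(i', j') < (i, j)"
    using linorder_less_linear by blast
  then show ?thesis
  proof cases
    case 1
    then show ?thesis using cell_index_less[OF assms(1,2,3) 1] by (simp add: less_imp_le del: less_prod_simp less_eq_prod_simp)
  next
    case 3
    then show ?thesis using cell_index_less[OF assms(2,1,4) 3]
      by (simp add: linorder_not_le[symmetric] del: less_prod_simp less_eq_prod_simp)
  qed simp
qed

text \<open>\<tau>[\<sigma>] turns the row-major number of a cell into the number of the permuted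
  cell counted column by column. Hence its values are ordered by \<tau> j and then by \<sigma> i,
  which explains the reversed order of the components in \<open>lex_key\<close>.\<close>

lemma perm_bracket_cell_index:
  assumes "i \<in> {1..k}" "j \<in> {1..l}"
  shows "perm_bracket k l \<tau> \<sigma> (cell_index l (i, j)) = cell_index k (\<tau> j, \<sigma> i)"
  using cell_at_index[OF assms] cell_index_in[OF assms]
  by (simp add: perm_bracket_def cell_at_def) (simp add: cell_index_def)

lemma perm_bracket_permutes:
  assumes "\<sigma> permutes {1..k}" "\<tau> permutes {1..l}"
  shows "perm_bracket k l \<tau> \<sigma> permutes {1..k * l}"
proof (rule inj_imp_permutes)
  have \<sigma>: "\<sigma> i \<in> {1..k} \<longleftrightarrow> i \<in> {1..k}" for i by (rule permutes_in_image[OF assms(1)])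
  have \<tau>: "\<tau> i \<in> {1..l} \<longleftrightarrow> i \<in> {1..l}" for i by (rule permutes_in_image[OF assms(2)])
  have cell: "\<exists>i j. i \<in> {1..k} \<and> j \<in> {1..l} \<and> m = cell_index l (i, j)" if "m \<in> {1..k * l}" for m
    using cell_at_in[OF that] cell_index_at[OF that] by (cases "cell_at l m") (metis mem_Sigma_iff)
  show "perm_bracket k l \<tau> \<sigma> m \<in> {1..k * l}" if m: "m \<in> {1..k * l}" for m
  proof -
    obtain i j where ij: "i \<in> {1..k}" "j \<in> {1..l}" "m = cell_index l (i, j)" using cell[OF m] by blast
    have "cell_index k (\<tau> j, \<sigma> i) \<in> {1..l * k}" by (rule cell_index_in) (use ij \<sigma> \<tau> in blast)+
    then show ?thesis using ij perm_bracket_cell_index[OF ij(1,2)] by (simp add: mult.commute)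
  qed
  show "inj_on (perm_bracket k l \<tau> \<sigma>) {1..k * l}"
  proof (rule inj_onI)
    fix m n assume mn: "m \<in> {1..k * l}" "n \<in> {1..k * l}" "perm_bracket k l \<tau> \<sigma> m = perm_bracket k l \<tau> \<sigma> n"
    obtain i j where ij: "i \<in> {1..k}" "j \<in> {1..l}" "m = cell_index l (i, j)" using cell[OF mn(1)] by blast
    obtain i' j' where ij': "i' \<in> {1..k}" "j' \<in> {1..l}" "n = cell_index l (i', j')" using cell[OF mn(2)] by blast
    have "cell_index k (\<tau> j, \<sigma> i) = cell_index k (\<tau> j', \<sigma> i')"
      using mn(3) perm_bracket_cell_index[OF ij(1,2)] perm_bracket_cell_index[OF ij'(1,2)] ij(3) ij'(3)
      by metis
    then have "(\<tau> j, \<sigma> i) = (\<tau> j', \<sigma> i')"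
      using cell_at_index[of "\<tau> j" l "\<sigma> i" k] cell_at_index[of "\<tau> j'" l "\<sigma> i'" k] \<sigma> \<tau> ij ij' by metis
    then show "m = n"
      using inj_eq[OF permutes_inj[OF assms(1)]] inj_eq[OF permutes_inj[OF assms(2)]] ij(3) ij'(3) by simp
  qed
  show "perm_bracket k l \<tau> \<sigma> m = m" if "m \<notin> {1..k * l}" for m
    unfolding perm_bracket_def if_not_P[OF that] ..
qed simp

section \<open>Nonnegative integer matrices as multisets of cells\<close>

definition matrix_cells :: "nat \<Rightarrow> nat \<Rightarrow> nat list list \<Rightarrow> (nat \<times> nat) multiset" where
  "matrix_cells k l \<gamma> = (\<Sum>p\<in>{1..k} \<times> {1..l}. replicate_mset (\<gamma> ! (fst p - 1) ! (snd p - 1)) p)"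

lemma count_matrix_cells:
  "count (matrix_cells k l \<gamma>) p =
    (if p \<in> {1..k} \<times> {1..l} then \<gamma> ! (fst p - 1) ! (snd p - 1) else 0)"
proof -
  have "count (matrix_cells k l \<gamma>) p =
      (\<Sum>q\<in>{1..k} \<times> {1..l}. if q = p then \<gamma> ! (fst q - 1) ! (snd q - 1) else 0)"
    unfolding matrix_cells_def count_sum by (intro sum.cong refl) simp
  also have "\<dots> = (if p \<in> {1..k} \<times> {1..l} then \<gamma> ! (fst p - 1) ! (snd p - 1) else 0)"
    by (rule sum.delta) simp
  finally show ?thesis .
qed

lemma set_matrix_cells: "set_mset (matrix_cells k l \<gamma>) \<subseteq> {1..k} \<times> {1..l}"
proof
  fix p assume "p \<in># matrix_cells k l \<gamma>"
  then have "count (matrix_cells k l \<gamma>) p \<noteq> 0" by simp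
  then show "p \<in> {1..k} \<times> {1..l}" unfolding count_matrix_cells by (metis (full_types))
qed

lemma sum_replicate_mset: "(\<Sum>i\<in>I. replicate_mset (f i) x) = replicate_mset (\<Sum>i\<in>I. f i) x"
  by (induction I rule: infinite_finite_induct) (simp_all add: multiset_eq_iff)

lemma sum_shift: "(\<Sum>j\<in>{1..l}. f (j - 1)) = (\<Sum>j<l::nat. f j)"
  by (rule sum.reindex_bij_witness[of _ Suc "\<lambda>j. j - 1"]) auto

lemma matrix_cells_fst:
  "image_mset fst (matrix_cells k l \<gamma>) = cells (map (\<lambda>i. \<Sum>j<l. \<gamma> ! i ! j) [0..<k])"
proof -
  have "image_mset fst (matrix_cells k l \<gamma>) =
      (\<Sum>i\<in>{1..k}. \<Sum>j\<in>{1..l}. replicate_mset (\<gamma> ! (i - 1) ! (j - 1)) i)"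
    unfolding matrix_cells_def image_mset_sum_set sum.cartesian_product by (intro sum.cong refl) auto
  also have "\<dots> = (\<Sum>i\<in>{1..k}. replicate_mset (\<Sum>j<l. \<gamma> ! (i - 1) ! j) i)"
    unfolding sum_replicate_mset sum_shift ..
  also have "\<dots> = cells (map (\<lambda>i. \<Sum>j<l. \<gamma> ! i ! j) [0..<k])"
    unfolding cells_def by (intro sum.cong) auto
  finally show ?thesis .
qed

lemma matrix_cells_snd:
  "image_mset snd (matrix_cells k l \<gamma>) = cells (map (\<lambda>j. \<Sum>i<k. \<gamma> ! i ! j) [0..<l])"
proof -
  have "image_mset snd (matrix_cells k l \<gamma>) =
      (\<Sum>i\<in>{1..k}. \<Sum>j\<in>{1..l}. replicate_mset (\<gamma> ! (i - 1) ! (j - 1)) j)"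
    unfolding matrix_cells_def image_mset_sum_set sum.cartesian_product by (intro sum.cong refl) auto
  also have "\<dots> = (\<Sum>j\<in>{1..l}. \<Sum>i\<in>{1..k}. replicate_mset (\<gamma> ! (i - 1) ! (j - 1)) j)"
    by (rule sum.swap)
  also have "\<dots> = (\<Sum>j\<in>{1..l}. replicate_mset (\<Sum>i<k. \<gamma> ! i ! (j - 1)) j)"
    unfolding sum_replicate_mset sum_shift[of "\<lambda>i. \<gamma> ! i ! _"] ..
  also have "\<dots> = cells (map (\<lambda>j. \<Sum>i<k. \<gamma> ! i ! j) [0..<l])"
    unfolding cells_def by (intro sum.cong) auto
  finally show ?thesis .
qed

text \<open>The row sums form the first marginal and the column sums the second. The lengths are
  known, so equal marginals mean equal lists of sums (\<open>cells_inject\<close>).\<close>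

lemma matrices_iff_couplings:
  assumes "length \<gamma> = length \<alpha>" "\<forall>r\<in>set \<gamma>. length r = length \<beta>"
  shows "\<gamma> \<in> matrices \<alpha> \<beta> \<longleftrightarrow>
    matrix_cells (length \<alpha>) (length \<beta>) \<gamma> \<in> couplings (cells \<alpha>) (cells \<beta>)"
proof -
  have eq: "cells (map f [0..<length xs]) = cells xs \<longleftrightarrow> (\<forall>i<length xs. f i = xs ! i)" for f xs
  proof
    assume "cells (map f [0..<length xs]) = cells xs"
    then have "map f [0..<length xs] = xs" by (intro cells_inject) simp_all
    then show "\<forall>i<length xs. f i = xs ! i"
      by (metis add_0 diff_zero length_upt nth_map nth_upt)
  next
    assume "\<forall>i<length xs. f i = xs ! i"
    then have "map f [0..<length xs] = xs" by (intro nth_equalityI) simp_all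
    then show "cells (map f [0..<length xs]) = cells xs" by simp
  qed
  show ?thesis
    unfolding matrices_def couplings_def mem_Collect_eq matrix_cells_fst matrix_cells_snd eq
    using assms by simp
qed

lemma concat_nth:
  assumes "\<forall>r\<in>set \<gamma>. length r = l" "i < length \<gamma>" "j < l"
  shows "concat \<gamma> ! (l * i + j) = \<gamma> ! i ! j"
  using assms
proof (induction \<gamma> arbitrary: i)
  case (Cons r \<gamma>)
  then have l: "length r = l" by simp
  show ?case
  proof (cases i)
    case 0
    then show ?thesis using Cons.prems(3) l by (simp add: nth_append)
  next
    case (Suc i')
    then have "concat \<gamma> ! (l * i' + j) = \<gamma> ! i' ! j"
      using Cons.prems by (intro Cons.IH) simp_all
    then show ?thesis using Suc l by (simp add: nth_append)
  qed
qed simp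

lemma length_concat_rows: "\<forall>r\<in>set \<gamma>. length r = l \<Longrightarrow> length (concat \<gamma>) = length \<gamma> * l"
  by (induction \<gamma>) simp_all

lemma cells_concat:
  assumes "length \<gamma> = k" "\<forall>r\<in>set \<gamma>. length r = l"
  shows "cells (concat \<gamma>) = image_mset (cell_index l) (matrix_cells k l \<gamma>)"
proof -
  have "cells (concat \<gamma>) = (\<Sum>m\<in>{1..k * l}. replicate_mset (concat \<gamma> ! (m - 1)) m)"
    unfolding cells_def using length_concat_rows[OF assms(2)] assms(1) by simp
  also have "\<dots> = (\<Sum>p\<in>{1..k} \<times> {1..l}. replicate_mset (\<gamma> ! (fst p - 1) ! (snd p - 1)) (cell_index l p))"
  proof (rule sum.reindex_bij_witness[of _ "cell_index l" "cell_at l"])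
    fix m assume m: "m \<in> {1..k * l}"
    show "cell_index l (cell_at l m) = m" by (rule cell_index_at[OF m])
    show in_range: "cell_at l m \<in> {1..k} \<times> {1..l}" by (rule cell_at_in[OF m])
    have "concat \<gamma> ! (l * ((m - 1) div l) + (m - 1) mod l) = \<gamma> ! ((m - 1) div l) ! ((m - 1) mod l)"
      by (rule concat_nth[OF assms(2)]) (use in_range assms(1) in \<open>auto simp: cell_at_def\<close>)
    then show "replicate_mset (\<gamma> ! (fst (cell_at l m) - 1) ! (snd (cell_at l m) - 1))
        (cell_index l (cell_at l m)) = replicate_mset (concat \<gamma> ! (m - 1)) m"
      unfolding cell_index_at[OF m] by (simp add: cell_at_def)
  next
    fix p assume "p \<in> {1..k} \<times> {1..l}"
    then obtain i j where p: "p = (i, j)" "i \<in> {1..k}" "j \<in> {1..l}" by blast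
    show "cell_at l (cell_index l p) = p" unfolding p(1) by (rule cell_at_index[OF p(2,3)])
    show "cell_index l p \<in> {1..k * l}" unfolding p(1) by (rule cell_index_in[OF p(2,3)])
  qed
  also have "\<dots> = image_mset (cell_index l) (matrix_cells k l \<gamma>)"
    by (simp add: matrix_cells_def image_mset_sum_set)
  finally show ?thesis .
qed

abbreviation lex_key :: "('j \<Rightarrow> 'b) \<Rightarrow> ('i \<Rightarrow> 'a) \<Rightarrow> 'i \<times> 'j \<Rightarrow> 'b \<times> 'a" where
  "lex_key \<mu> \<kappa> \<equiv> (\<lambda>(i, j). (\<mu> j, \<kappa> i))"

lemma inj_on_lex_key:
  assumes "inj_on \<kappa> (set_mset A)" "inj_on \<mu> (set_mset B)" "C \<in> couplings A B"
  shows "inj_on (lex_key \<mu> \<kappa>) (set_mset C)"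
proof (rule inj_on_subset[OF _ couplings_subset[OF assms(3)]])
  show "inj_on (lex_key \<mu> \<kappa>) (set_mset A \<times> set_mset B)"
    using assms(1,2) by (auto simp: inj_on_def)
qed

text \<open>Row-major numbering is monotone for the lexicographic order, on the positions (i, j)
  and, with k in place of l, on the keys (\<tau> j, \<sigma> i). So \<open>mop_image\<close> undoes
  the flattening.\<close>

lemma F_concat:
  assumes \<sigma>: "\<sigma> permutes {1..k}" and \<tau>: "\<tau> permutes {1..l}"
    and \<gamma>: "length \<gamma> = k" "\<forall>r\<in>set \<gamma>. length r = l"
  shows "F (concat \<gamma>) (perm_bracket k l \<tau> \<sigma>) = basis (mop (matrix_cells k l \<gamma>) (lex_key \<tau> \<sigma>))"
proof -
  have len: "length (concat \<gamma>) = k * l" using length_concat_rows[OF \<gamma>(2)] \<gamma>(1) by simp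
  have "F (concat \<gamma>) (perm_bracket k l \<tau> \<sigma>) = basis (mop (cells (concat \<gamma>)) (perm_bracket k l \<tau> \<sigma>))"
    by (rule F_eq) (simp only: len perm_bracket_permutes[OF \<sigma> \<tau>])
  also have "mop (cells (concat \<gamma>)) (perm_bracket k l \<tau> \<sigma>) = mop (matrix_cells k l \<gamma>) (lex_key \<tau> \<sigma>)"
    unfolding cells_concat[OF \<gamma>]
  proof (rule mop_image)
    show "strict_mono_on (set_mset (matrix_cells k l \<gamma>)) (cell_index l)"
    proof (rule strict_mono_onI)
      fix p q assume "p \<in># matrix_cells k l \<gamma>" "q \<in># matrix_cells k l \<gamma>" "p < q"
      then show "cell_index l p < cell_index l q"
        using set_matrix_cells[of k l \<gamma>] by (cases p; cases q) (auto intro!: cell_index_less)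
    qed
    fix p q assume "p \<in># matrix_cells k l \<gamma>" "q \<in># matrix_cells k l \<gamma>"
    then obtain i j i' j' where p: "p = (i, j)" "i \<in> {1..k}" "j \<in> {1..l}"
      and q: "q = (i', j')" "i' \<in> {1..k}" "j' \<in> {1..l}"
      using set_matrix_cells[of k l \<gamma>] by blast
    have "\<sigma> i \<in> {1..k}" "\<sigma> i' \<in> {1..k}" "\<tau> j \<in> {1..l}" "\<tau> j' \<in> {1..l}"
      using permutes_in_image[OF \<sigma>] permutes_in_image[OF \<tau>] p q by blast+
    then show "perm_bracket k l \<tau> \<sigma> (cell_index l p) \<le> perm_bracket k l \<tau> \<sigma> (cell_index l q) \<longleftrightarrow>
        lex_key \<tau> \<sigma> p \<le> lex_key \<tau> \<sigma> q"
      unfolding p(1) q(1) perm_bracket_cell_index[OF p(2,3)] perm_bracket_cell_index[OF q(2,3)] prod.case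
      by (intro cell_index_le_iff) auto
  qed
  finally show ?thesis .
qed

text \<open>For the stored pairs, matrices are couplings of the cells, via \<open>F_concat\<close>.
  The enumerations \<phi> and \<psi> of the supports then combine to
  \<open>map_prod \<phi> \<psi>\<close>, which respects the lexicographic orders of positions and of
  keys.\<close>

lemma int_mult_mop:
  fixes \<kappa> :: "'i::linorder \<Rightarrow> 'a::linorder" and \<mu> :: "'j::linorder \<Rightarrow> 'b::linorder"
  assumes inj: "inj_on \<kappa> (set_mset A)" "inj_on \<mu> (set_mset B)"
  shows "int_mult (basis (mop A \<kappa>)) (basis (mop B \<mu>)) =
    (\<Sum>C\<in>couplings A B. basis (mop C (lex_key \<mu> \<kappa>)) :: 'k::{comm_ring,comm_monoid_mult} pnsym)"
proof -
  obtain \<alpha> \<sigma> \<beta> \<tau> where rep: "Rep_mopiscotion (mop A \<kappa>) = (\<alpha>, \<sigma>)"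
    "Rep_mopiscotion (mop B \<mu>) = (\<beta>, \<tau>)"
    by (meson surj_pair)
  obtain \<phi> where \<phi>: "A = image_mset \<phi> (cells \<alpha>)" "strict_mono_on {1..length \<alpha>} \<phi>"
    "\<And>i j. i \<in> {1..length \<alpha>} \<Longrightarrow> j \<in> {1..length \<alpha>} \<Longrightarrow> \<kappa> (\<phi> i) \<le> \<kappa> (\<phi> j) \<longleftrightarrow> \<sigma> i \<le> \<sigma> j"
    using mop_canonical[OF inj(1) rep(1)] by blast
  obtain \<psi> where \<psi>: "B = image_mset \<psi> (cells \<beta>)" "strict_mono_on {1..length \<beta>} \<psi>"
    "\<And>i j. i \<in> {1..length \<beta>} \<Longrightarrow> j \<in> {1..length \<beta>} \<Longrightarrow> \<mu> (\<psi> i) \<le> \<mu> (\<psi> j) \<longleftrightarrow> \<tau> i \<le> \<tau> j"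
    using mop_canonical[OF inj(2) rep(2)] by blast
  let ?k = "length \<alpha>" and ?l = "length \<beta>"
  let ?unc = "\<lambda>C. map (\<lambda>i. map (\<lambda>j. count C (Suc i, Suc j)) [0..<?l]) [0..<?k]"
  have perm: "\<sigma> permutes {1..?k}" "\<tau> permutes {1..?l}" by (rule Rep_permutes[OF rep(1)], rule Rep_permutes[OF rep(2)])
  have mop_eq: "mop (image_mset (map_prod \<phi> \<psi>) C) (lex_key \<mu> \<kappa>) = mop C (lex_key \<tau> \<sigma>)"
    if "C \<in> couplings (cells \<alpha>) (cells \<beta>)" for C
  proof (rule mop_image)
    have C: "set_mset C \<subseteq> {1..?k} \<times> {1..?l}"
      using couplings_subset[OF that] set_cells_subset[of \<alpha>] set_cells_subset[of \<beta>] by blast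
    show "strict_mono_on (set_mset C) (map_prod \<phi> \<psi>)"
    proof (rule strict_mono_onI)
      fix p q assume "p \<in># C" "q \<in># C" and less: "p < q"
      then have "fst p \<in> {1..?k}" "fst q \<in> {1..?k}" "snd p \<in> {1..?l}" "snd q \<in> {1..?l}" using C by auto
      from strict_mono_onD[OF \<phi>(2) this(1,2)] strict_mono_onD[OF \<psi>(2) this(3,4)] less
      show "map_prod \<phi> \<psi> p < map_prod \<phi> \<psi> q"
        unfolding less_prod_def' by auto
    qed
    fix p q assume "p \<in># C" "q \<in># C"
    then have "fst p \<in> {1..?k}" "fst q \<in> {1..?k}" "snd p \<in> {1..?l}" "snd q \<in> {1..?l}" using C by auto
    \<comment> \<open>Lexicographic comparison also asks whether first components differ, so each
      equivalence is needed in both directions.\<close>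
    note \<phi>(3)[OF this(1,2)] \<phi>(3)[OF this(2,1)] \<psi>(3)[OF this(3,4)] \<psi>(3)[OF this(4,3)]
    then show "lex_key \<mu> \<kappa> (map_prod \<phi> \<psi> p) \<le> lex_key \<mu> \<kappa> (map_prod \<phi> \<psi> q) \<longleftrightarrow>
        lex_key \<tau> \<sigma> p \<le> lex_key \<tau> \<sigma> q"
      by (cases p; cases q) (auto simp: less_le_not_le)
  qed
  have "int_mult (basis (mop A \<kappa>)) (basis (mop B \<mu>)) =
      (\<Sum>\<gamma>\<in>matrices \<alpha> \<beta>. F (concat \<gamma>) (perm_bracket ?k ?l \<tau> \<sigma>) :: 'k pnsym)"
    by (simp add: int_mult_def rep)
  also have "\<dots> = (\<Sum>C\<in>couplings (cells \<alpha>) (cells \<beta>). basis (mop C (lex_key \<tau> \<sigma>)))"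
  proof (rule sum.reindex_bij_witness[of _ ?unc "matrix_cells ?k ?l"])
    fix \<gamma> assume \<gamma>: "\<gamma> \<in> matrices \<alpha> \<beta>"
    then have len: "length \<gamma> = ?k" "\<forall>r\<in>set \<gamma>. length r = ?l" by (simp_all add: matrices_def)
    show "matrix_cells ?k ?l \<gamma> \<in> couplings (cells \<alpha>) (cells \<beta>)"
      using \<gamma> matrices_iff_couplings[OF len] by blast
    show "?unc (matrix_cells ?k ?l \<gamma>) = \<gamma>"
      using len by (auto intro!: nth_equalityI simp: count_matrix_cells)
    show "basis (mop (matrix_cells ?k ?l \<gamma>) (lex_key \<tau> \<sigma>)) =
        (F (concat \<gamma>) (perm_bracket ?k ?l \<tau> \<sigma>) :: 'k pnsym)"
      by (rule F_concat[OF perm len, symmetric])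
  next
    fix C assume C: "C \<in> couplings (cells \<alpha>) (cells \<beta>)"
    then have sub: "set_mset C \<subseteq> {1..?k} \<times> {1..?l}"
      using couplings_subset[OF C] set_cells_subset[of \<alpha>] set_cells_subset[of \<beta>] by blast
    show eq: "matrix_cells ?k ?l (?unc C) = C"
    proof (rule multiset_eqI)
      fix p show "count (matrix_cells ?k ?l (?unc C)) p = count C p"
      proof (cases "p \<in> {1..?k} \<times> {1..?l}")
        case True
        then show ?thesis by (cases p) (auto simp: count_matrix_cells)
      next
        case False
        then have "p \<notin># C" using sub by blast
        then show ?thesis unfolding count_matrix_cells if_not_P[OF False] by (simp add: not_in_iff)
      qed
    qed
    show "?unc C \<in> matrices \<alpha> \<beta>"
      using C by (subst matrices_iff_couplings) (simp_all add: eq)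
  qed
  also have "\<dots> = (\<Sum>C\<in>couplings (cells \<alpha>) (cells \<beta>). basis (mop (image_mset (map_prod \<phi> \<psi>) C) (lex_key \<mu> \<kappa>)))"
    by (intro sum.cong refl) (simp add: mop_eq)
  also have "\<dots> = (\<Sum>C\<in>couplings A B. basis (mop C (lex_key \<mu> \<kappa>)))"
    unfolding \<phi>(1) \<psi>(1)
    using strict_mono_on_imp_inj_on[OF \<phi>(2)] strict_mono_on_imp_inj_on[OF \<psi>(2)]
      set_cells_subset[of \<alpha>] set_cells_subset[of \<beta>]
    by (intro sum_couplings_image[symmetric]) (auto intro: inj_on_subset)
  finally show ?thesis .
qed

text \<open>Both sides sum over the multisets of triples with marginals A, B and C. Rebracketing
  ((i, j), h) to (i, (j, h)) keeps the lexicographic order of positions, and the keys (\<nu> h,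
  (\<mu> j, \<kappa> i)) and ((\<nu> h, \<mu> j), \<kappa> i) are ordered alike.\<close>

lemma int_mult_assoc_basis:
  "int_mult (int_mult (basis p) (basis q)) (basis r) =
    (int_mult (basis p) (int_mult (basis q) (basis r)) :: 'k::{comm_ring,comm_monoid_mult} pnsym)"
proof -
  obtain A \<kappa> where p: "p = mop (A :: nat multiset) (\<kappa> :: nat \<Rightarrow> nat)" "inj_on \<kappa> (set_mset A)"
    by (rule mop_exhaust)
  obtain B \<mu> where q: "q = mop (B :: nat multiset) (\<mu> :: nat \<Rightarrow> nat)" "inj_on \<mu> (set_mset B)"
    by (rule mop_exhaust)
  obtain C \<nu> where r: "r = mop (C :: nat multiset) (\<nu> :: nat \<Rightarrow> nat)" "inj_on \<nu> (set_mset C)"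
    by (rule mop_exhaust)
  let ?assoc = "image_mset (\<lambda>((i, j), h). (i, (j, h)))" and ?assoc' = "image_mset (\<lambda>(i, (j, h)). ((i, j), h))"
  have "int_mult (int_mult (basis p) (basis q)) (basis r) =
      (\<Sum>D\<in>couplings A B. int_mult (basis (mop D (lex_key \<mu> \<kappa>))) (basis (mop C \<nu>)) :: 'k pnsym)"
    unfolding p(1) q(1) r(1) int_mult_mop[OF p(2) q(2)]
    by (simp add: int_mult_def bilinear_ext_sum_left)
  also have "\<dots> = (\<Sum>D\<in>couplings A B. \<Sum>E\<in>couplings D C. basis (mop E (lex_key \<nu> (lex_key \<mu> \<kappa>))))"
    by (intro sum.cong refl int_mult_mop inj_on_lex_key[OF p(2) q(2)] r(2))
  also have "\<dots> = (\<Sum>(D, E)\<in>(SIGMA D:couplings A B. couplings D C). basis (mop E (lex_key \<nu> (lex_key \<mu> \<kappa>))))"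
    by (rule sum.Sigma) (simp_all add: finite_couplings)
  also have "\<dots> = (\<Sum>(D, E)\<in>(SIGMA D:couplings B C. couplings A D). basis (mop E (lex_key (lex_key \<nu> \<mu>) \<kappa>)))"
  \<comment> \<open>The intermediate coupling D is a marginal of E in both double sums, so it is
    recomputed from the rebracketed E.\<close>
  proof (rule sum.reindex_bij_witness[of _ "\<lambda>(D, E). (image_mset fst (?assoc' E), ?assoc' E)"
        "\<lambda>(D, E). (image_mset snd (?assoc E), ?assoc E)"])
    fix x assume "x \<in> (SIGMA D:couplings A B. couplings D C)"
    then obtain D E where x: "x = (D, E)" "D \<in> couplings A B" "E \<in> couplings D C" by blast
    show "(\<lambda>(D, E). (image_mset fst (?assoc' E), ?assoc' E))
        ((\<lambda>(D, E). (image_mset snd (?assoc E), ?assoc E)) x) = x"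
      using x(3) by (simp add: x(1) couplings_def multiset.map_comp comp_def split_beta)
    show "(\<lambda>(D, E). (image_mset snd (?assoc E), ?assoc E)) x \<in> (SIGMA D:couplings B C. couplings A D)"
      using x(2,3) by (auto simp: x(1) couplings_def multiset.map_comp comp_def split_beta)
    have "mop (?assoc E) (lex_key (lex_key \<nu> \<mu>) \<kappa>) = mop E (lex_key \<nu> (lex_key \<mu> \<kappa>))"
      by (rule mop_image) (auto simp: strict_mono_on_def less_imp_le)
    then show "(case (\<lambda>(D, E). (image_mset snd (?assoc E), ?assoc E)) x of
        (D, E) \<Rightarrow> basis (mop E (lex_key (lex_key \<nu> \<mu>) \<kappa>))) =
        (case x of (D, E) \<Rightarrow> basis (mop E (lex_key \<nu> (lex_key \<mu> \<kappa>))))"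
      by (simp add: x(1))
  next
    fix x assume "x \<in> (SIGMA D:couplings B C. couplings A D)"
    then obtain D E where x: "x = (D, E)" "D \<in> couplings B C" "E \<in> couplings A D" by blast
    show "(\<lambda>(D, E). (image_mset snd (?assoc E), ?assoc E))
        ((\<lambda>(D, E). (image_mset fst (?assoc' E), ?assoc' E)) x) = x"
      using x(3) by (simp add: x(1) couplings_def multiset.map_comp comp_def split_beta)
    show "(\<lambda>(D, E). (image_mset fst (?assoc' E), ?assoc' E)) x \<in> (SIGMA D:couplings A B. couplings D C)"
      using x(2,3) by (auto simp: x(1) couplings_def multiset.map_comp comp_def split_beta)
  qed
  also have "\<dots> = (\<Sum>D\<in>couplings B C. \<Sum>E\<in>couplings A D. basis (mop E (lex_key (lex_key \<nu> \<mu>) \<kappa>)))"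
    by (rule sum.Sigma[symmetric]) (simp_all add: finite_couplings)
  also have "\<dots> = (\<Sum>D\<in>couplings B C. int_mult (basis (mop A \<kappa>)) (basis (mop D (lex_key \<nu> \<mu>))))"
    by (intro sum.cong refl int_mult_mop[symmetric] inj_on_lex_key[OF q(2) r(2)] p(2))
  also have "\<dots> = int_mult (basis p) (int_mult (basis q) (basis r))"
    unfolding p(1) q(1) r(1) int_mult_mop[OF q(2) r(2)]
    by (simp add: int_mult_def bilinear_ext_sum_right)
  finally show ?thesis .
qed

text \<open>Marginals are additive: splitting a coupling splits both of its margins, and couplings
  of the parts add up to a coupling of the wholes. All parts inherit the same keys.\<close>

lemma comult_int_mult_basis:
  "pnsym_comult (int_mult (basis p) (basis q)) =
    tensor_mult int_mult (pnsym_comult (basis p)) (pnsym_comult (basis q :: 'k::{comm_ring,comm_monoid_mult} pnsym))"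
proof -
  obtain A \<kappa> where p: "p = mop (A :: nat multiset) (\<kappa> :: nat \<Rightarrow> nat)" "inj_on \<kappa> (set_mset A)"
    by (rule mop_exhaust)
  obtain B \<mu> where q: "q = mop (B :: nat multiset) (\<mu> :: nat \<Rightarrow> nat)" "inj_on \<mu> (set_mset B)"
    by (rule mop_exhaust)
  let ?b = "\<lambda>C D. basis (mop C (lex_key \<mu> \<kappa>), mop D (lex_key \<mu> \<kappa>)) :: _ \<Rightarrow>\<^sub>0 'k"
  have sub: "inj_on \<kappa> (set_mset A1)" "inj_on \<kappa> (set_mset A2)" if "(A1, A2) \<in> splits A" for A1 A2
    using splits_subset[OF that] p(2) inj_on_subset by blast+
  have sub': "inj_on \<mu> (set_mset B1)" "inj_on \<mu> (set_mset B2)" if "(B1, B2) \<in> splits B" for B1 B2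
    using splits_subset[OF that] q(2) inj_on_subset by blast+
  have "pnsym_comult (int_mult (basis p) (basis q)) =
      (\<Sum>C\<in>couplings A B. pnsym_comult (basis (mop C (lex_key \<mu> \<kappa>))) :: _ \<Rightarrow>\<^sub>0 'k)"
    unfolding p(1) q(1) int_mult_mop[OF p(2) q(2)] by (simp add: pnsym_comult_def linear_ext_sum)
  also have "\<dots> = (\<Sum>C\<in>couplings A B. \<Sum>(C1, C2)\<in>splits C. ?b C1 C2)"
    by (intro sum.cong refl pnsym_comult_mop inj_on_lex_key[OF p(2) q(2)])
  also have "\<dots> = (\<Sum>(C, C1, C2)\<in>(SIGMA C:couplings A B. splits C). ?b C1 C2)"
    by (subst sum.Sigma) (simp_all add: finite_couplings finite_splits split_beta)
  also have "\<dots> = (\<Sum>(ST, (C1, C2))\<in>(SIGMA ST:splits A \<times> splits B.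
      couplings (fst (fst ST)) (fst (snd ST)) \<times> couplings (snd (fst ST)) (snd (snd ST))). ?b C1 C2)"
    \<comment> \<open>The pair (C1, C2) carries all the data: its sum is the coupling, and its four
      marginals are the splittings of A and B.\<close>
    by (rule sum.reindex_bij_witness[of _ "\<lambda>(ST, (C1, C2)). (C1 + C2, C1, C2)"
        "\<lambda>(C, C1, C2). (((image_mset fst C1, image_mset fst C2), (image_mset snd C1, image_mset snd C2)), (C1, C2))"])
      (auto simp: splits_def couplings_def)
  also have "\<dots> = (\<Sum>ST\<in>splits A \<times> splits B. \<Sum>(C1, C2)\<in>
      couplings (fst (fst ST)) (fst (snd ST)) \<times> couplings (snd (fst ST)) (snd (snd ST)). ?b C1 C2)"
    by (rule sum.Sigma[symmetric]) (simp_all add: finite_splits finite_couplings)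
  also have "\<dots> = (\<Sum>S\<in>splits A. \<Sum>T\<in>splits B. \<Sum>C1\<in>couplings (fst S) (fst T).
      \<Sum>C2\<in>couplings (snd S) (snd T). ?b C1 C2)"
    by (simp add: sum.cartesian_product split_beta)
  also have "\<dots> = (\<Sum>S\<in>splits A. \<Sum>T\<in>splits B.
      tensor (int_mult (basis (mop (fst S) \<kappa>)) (basis (mop (fst T) \<mu>)))
        (int_mult (basis (mop (snd S) \<kappa>)) (basis (mop (snd T) \<mu>))))"
  proof (intro sum.cong refl)
    fix S T assume "S \<in> splits A" "T \<in> splits B"
    then have ST: "(fst S, snd S) \<in> splits A" "(fst T, snd T) \<in> splits B" by simp_all
    show "(\<Sum>C1\<in>couplings (fst S) (fst T). \<Sum>C2\<in>couplings (snd S) (snd T). ?b C1 C2) =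
        tensor (int_mult (basis (mop (fst S) \<kappa>)) (basis (mop (fst T) \<mu>)))
          (int_mult (basis (mop (snd S) \<kappa>)) (basis (mop (snd T) \<mu>)))"
      by (simp add: int_mult_mop sub[OF ST(1)] sub'[OF ST(2)] tensor_sum_left tensor_sum_right tensor_basis)
        (rule sum.swap)?
  qed
  also have "\<dots> = tensor_mult int_mult (pnsym_comult (basis p)) (pnsym_comult (basis q))"
    unfolding p(1) q(1) pnsym_comult_mop[OF p(2)] pnsym_comult_mop[OF q(2)]
    by (simp add: tensor_mult_sum_left tensor_mult_sum_right split_beta tensor_mult_basis) (rule sum.swap)
  finally show ?thesis .
qed

section \<open>The bialgebra structures\<close>

text \<open>Projection to degree 0. A counit is determined by the comultiplication, so the internal
  product must share it.\<close>

definition pnsym_counit :: "'k::{comm_ring,comm_monoid_mult} pnsym \<Rightarrow> 'k" where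
  "pnsym_counit x = Poly_Mapping.lookup x mop_one"

abbreviation pnsym_one :: "'k::{comm_ring,comm_monoid_mult} pnsym" where
  "pnsym_one \<equiv> basis mop_one"

lemma linear_map_counit: "linear_map scale (*) pnsym_counit"
  by (simp add: linear_map_def pnsym_counit_def lookup_add lookup_scale)

lemma linear_map_comult: "linear_map scale scale pnsym_comult"
  unfolding pnsym_comult_def by (rule linear_map_linear_ext)

lemma bilinear_map_ext_mult: "bilinear_map scale scale scale ext_mult"
  unfolding ext_mult_def by (rule bilinear_map_bilinear_ext)

lemma bilinear_map_int_mult: "bilinear_map scale scale scale int_mult"
  unfolding int_mult_def by (rule bilinear_map_bilinear_ext)

lemma counit_basis: "pnsym_counit (basis p) = (if p = mop_one then 1 else 0)"
  by (simp add: pnsym_counit_def lookup_single when_def)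

lemma counit_mop:
  "inj_on \<kappa> (set_mset A) \<Longrightarrow> pnsym_counit (basis (mop A \<kappa>)) = (if A = {#} then 1 else 0)"
  by (simp add: counit_basis mop_eq_one_iff)

lemma splits_inj:
  assumes "inj_on \<kappa> (set_mset A)" "(B, C) \<in> splits A"
  shows "inj_on \<kappa> (set_mset B)" "inj_on \<kappa> (set_mset C)"
  using splits_subset[OF assms(2)] assms(1) inj_on_subset by blast+

lemma sum_splits_empty_left: "(\<Sum>(B, C)\<in>splits A. if B = {#} then h C else 0) = h A"
proof -
  have "(\<Sum>(B, C)\<in>splits A. if B = {#} then h C else 0) =
      (\<Sum>p\<in>splits A. if p = ({#}, A) then h A else 0)"
  proof (intro sum.cong refl)
    fix p assume "p \<in> splits A"
    then show "(case p of (B, C) \<Rightarrow> if B = {#} then h C else 0) = (if p = ({#}, A) then h A else 0)"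
      by (cases p; cases "fst p = {#}") (auto simp: splits_def)
  qed
  then show ?thesis by (simp add: finite_splits) (simp add: splits_def)
qed

lemma sum_splits_empty_right: "(\<Sum>(B, C)\<in>splits A. if C = {#} then h B else 0) = h A"
  using sum_splits_empty_left[of h A] by (subst sum_splits_swap)

text \<open>On the basis, coassociativity is \<open>sum_splits_assoc\<close>, and in each counit law
  only the splitting with the relevant part empty survives.\<close>

lemma coalgebra_pnsym: "coalgebra pnsym_comult (pnsym_counit :: 'k::{comm_ring,comm_monoid_mult} pnsym \<Rightarrow> 'k)"
proof
  fix x :: "'k pnsym"
  show "tensor_assoc (tensor_map pnsym_comult id (pnsym_comult x)) =
      tensor_map id pnsym_comult (pnsym_comult x)"
  proof (rule linear_map_eqI[of scale "\<lambda>x. tensor_assoc (tensor_map pnsym_comult id (pnsym_comult x))"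
        "\<lambda>x. tensor_map id pnsym_comult (pnsym_comult x)"])
    show "linear_map scale scale (\<lambda>x :: 'k pnsym. tensor_assoc (tensor_map pnsym_comult id (pnsym_comult x)))"
      by (rule linear_map_compose[OF linear_map_compose[OF linear_map_comult linear_map_tensor_map]
            linear_map_tensor_assoc])
    show "linear_map scale scale (\<lambda>x :: 'k pnsym. tensor_map id pnsym_comult (pnsym_comult x))"
      by (rule linear_map_compose[OF linear_map_comult linear_map_tensor_map])
    fix p
    obtain A :: "nat multiset" and \<kappa> :: "nat \<Rightarrow> nat" where p: "p = mop A \<kappa>" "inj_on \<kappa> (set_mset A)"
      by (rule mop_exhaust)
    note sums = linear_map_sum[OF linear_map_tensor_map] linear_map_sum[OF linear_map_tensor_assoc]
    have "tensor_assoc (tensor_map pnsym_comult id (pnsym_comult (basis p))) =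
        (\<Sum>(B, C)\<in>splits A. \<Sum>(B1, B2)\<in>splits B. basis (mop B1 \<kappa>, mop B2 \<kappa>, mop C \<kappa>) :: _ \<Rightarrow>\<^sub>0 'k)"
      unfolding p(1) pnsym_comult_mop[OF p(2)] sums
      by (intro sum.cong refl)
        (auto simp: tensor_map_basis pnsym_comult_mop splits_inj[OF p(2)] tensor_sum_left
          tensor_basis sums tensor_assoc_basis split_beta)
    also have "\<dots> = (\<Sum>(B, C)\<in>splits A. \<Sum>(C1, C2)\<in>splits C. basis (mop B \<kappa>, mop C1 \<kappa>, mop C2 \<kappa>))"
      by (rule sum_splits_assoc)
    also have "\<dots> = tensor_map id pnsym_comult (pnsym_comult (basis p))"
      unfolding p(1) pnsym_comult_mop[OF p(2)] sums
      by (intro sum.cong refl)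
        (auto simp: tensor_map_basis pnsym_comult_mop splits_inj[OF p(2)] tensor_sum_right
          tensor_basis split_beta)
    finally show "tensor_assoc (tensor_map pnsym_comult id (pnsym_comult (basis p))) =
        (tensor_map id pnsym_comult (pnsym_comult (basis p)) :: _ \<Rightarrow>\<^sub>0 'k)" .
  qed
  show "apply_left pnsym_counit (pnsym_comult x) = x"
  proof (rule linear_map_eqI[of scale "\<lambda>x. apply_left pnsym_counit (pnsym_comult x)" "\<lambda>x. x"])
    show "linear_map scale scale (\<lambda>x :: 'k pnsym. apply_left pnsym_counit (pnsym_comult x))"
      by (rule linear_map_compose[OF linear_map_comult linear_map_apply_left])
    fix p
    obtain A :: "nat multiset" and \<kappa> :: "nat \<Rightarrow> nat" where p: "p = mop A \<kappa>" "inj_on \<kappa> (set_mset A)"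
      by (rule mop_exhaust)
    have "apply_left pnsym_counit (pnsym_comult (basis p)) =
        (\<Sum>(B, C)\<in>splits A. if B = {#} then basis (mop C \<kappa>) else 0 :: 'k pnsym)"
      unfolding p(1) pnsym_comult_mop[OF p(2)] linear_map_sum[OF linear_map_apply_left]
      by (intro sum.cong refl) (auto simp: apply_left_basis counit_mop splits_inj[OF p(2)])
    then show "apply_left pnsym_counit (pnsym_comult (basis p)) = (basis p :: 'k pnsym)"
      by (simp add: sum_splits_empty_left p(1))
  qed (rule linear_map_id)
  show "apply_right pnsym_counit (pnsym_comult x) = x"
  proof (rule linear_map_eqI[of scale "\<lambda>x. apply_right pnsym_counit (pnsym_comult x)" "\<lambda>x. x"])
    show "linear_map scale scale (\<lambda>x :: 'k pnsym. apply_right pnsym_counit (pnsym_comult x))"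
      by (rule linear_map_compose[OF linear_map_comult linear_map_apply_right])
    fix p
    obtain A :: "nat multiset" and \<kappa> :: "nat \<Rightarrow> nat" where p: "p = mop A \<kappa>" "inj_on \<kappa> (set_mset A)"
      by (rule mop_exhaust)
    have "apply_right pnsym_counit (pnsym_comult (basis p)) =
        (\<Sum>(B, C)\<in>splits A. if C = {#} then basis (mop B \<kappa>) else 0 :: 'k pnsym)"
      unfolding p(1) pnsym_comult_mop[OF p(2)] linear_map_sum[OF linear_map_apply_right]
      by (intro sum.cong refl) (auto simp: apply_right_basis counit_mop splits_inj[OF p(2)])
    then show "apply_right pnsym_counit (pnsym_comult (basis p)) = (basis p :: 'k pnsym)"
      by (simp add: sum_splits_empty_right p(1))
  qed (rule linear_map_id)
qed (rule linear_map_comult linear_map_counit)+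

text \<open>The axioms linking product and coproduct are multilinear, so basis elements suffice. The
  product is left arbitrary so that both multiplications can use this.\<close>

lemma nonunital_bialgebraI:
  fixes m :: "'k::{comm_ring,comm_monoid_mult} pnsym \<Rightarrow> 'k pnsym \<Rightarrow> 'k pnsym"
  assumes m: "bilinear_map scale scale scale m"
    and assoc: "\<And>p q r. m (m (basis p) (basis q)) (basis r) = m (basis p) (m (basis q) (basis r))"
    and comult: "\<And>p q. pnsym_comult (m (basis p) (basis q)) =
      tensor_mult m (pnsym_comult (basis p)) (pnsym_comult (basis q))"
    and counit: "\<And>p q. pnsym_counit (m (basis p) (basis q)) =
      pnsym_counit (basis p) * pnsym_counit (basis q)"
  shows "nonunital_bialgebra m pnsym_comult pnsym_counit"
proof -
  interpret coalgebra pnsym_comult "pnsym_counit :: 'k pnsym \<Rightarrow> 'k" by (rule coalgebra_pnsym)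
  note lin = linear_map_bilinear_left[OF m] linear_map_bilinear_right[OF m] linear_map_id(1)
  note tlin = linear_map_bilinear_left[OF bilinear_map_tensor_mult]
    linear_map_bilinear_right[OF bilinear_map_tensor_mult] comult_linear
  show ?thesis
  proof
    fix x y z :: "'k pnsym"
    show "m (m x y) z = m x (m y z)" by (rule bilinear_map_assocI[OF m assoc])
    show "pnsym_comult (m x y) = tensor_mult m (pnsym_comult x) (pnsym_comult y)"
      by (rule bilinear_map_eqI[of scale "\<lambda>x y. pnsym_comult (m x y)"
            "\<lambda>x y. tensor_mult m (pnsym_comult x) (pnsym_comult y)"])
        (intro linear_map_compose[OF _ comult_linear] lin tlin comult)+
    show "pnsym_counit (m x y) = pnsym_counit x * pnsym_counit y"
    proof (rule bilinear_map_eqI[of "(*)" "\<lambda>x y. pnsym_counit (m x y)"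
            "\<lambda>x y. pnsym_counit x * pnsym_counit y"])
      show "linear_map scale (*) (\<lambda>x. pnsym_counit x * pnsym_counit y)"
        "linear_map scale (*) (\<lambda>y. pnsym_counit x * pnsym_counit y)" for x y :: "'k pnsym"
        using counit_linear by (simp_all add: linear_map_def distrib_left distrib_right mult_ac)
    qed (intro linear_map_compose[OF _ counit_linear] lin counit)+
  qed (rule m)
qed

text \<open>The empty multiset has empty marginals, so it is a coupling of A and B exactly if both
  are empty.\<close>

lemma counit_int_mult_basis:
  "pnsym_counit (int_mult (basis p) (basis q)) =
    pnsym_counit (basis p) * pnsym_counit (basis q :: 'k::{comm_ring,comm_monoid_mult} pnsym)"
proof -
  obtain A \<kappa> where p: "p = mop (A :: nat multiset) (\<kappa> :: nat \<Rightarrow> nat)" "inj_on \<kappa> (set_mset A)"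
    by (rule mop_exhaust)
  obtain B \<mu> where q: "q = mop (B :: nat multiset) (\<mu> :: nat \<Rightarrow> nat)" "inj_on \<mu> (set_mset B)"
    by (rule mop_exhaust)
  have "pnsym_counit (int_mult (basis p) (basis q)) =
      (\<Sum>C\<in>couplings A B. pnsym_counit (basis (mop C (lex_key \<mu> \<kappa>))) :: 'k)"
    unfolding p(1) q(1) int_mult_mop[OF p(2) q(2)] by (rule linear_map_sum[OF linear_map_counit])
  also have "\<dots> = (\<Sum>C\<in>couplings A B. if C = {#} then 1 else 0)"
    by (intro sum.cong refl counit_mop inj_on_lex_key[OF p(2) q(2)])
  also have "\<dots> = (if {#} \<in> couplings A B then 1 else 0)"
    by (simp add: finite_couplings)
  also have "\<dots> = pnsym_counit (basis p) * pnsym_counit (basis q)"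
    by (auto simp: p q counit_mop couplings_def)
  finally show ?thesis .
qed

lemma nonunital_bialgebra_int_mult:
  "nonunital_bialgebra int_mult pnsym_comult (pnsym_counit :: 'k::{comm_ring,comm_monoid_mult} pnsym \<Rightarrow> 'k)"
  by (intro nonunital_bialgebraI bilinear_map_int_mult int_mult_assoc_basis comult_int_mult_basis
      counit_int_mult_basis)

text \<open>Degrees add, and only the unity has degree 0, so a product is the unity exactly if both
  factors are.\<close>

lemma counit_ext_mult_basis:
  "pnsym_counit (ext_mult (basis p) (basis q)) = pnsym_counit (basis p) * pnsym_counit (basis q)"
proof -
  have "mop_mult p q = mop_one \<longleftrightarrow> p = mop_one \<and> q = mop_one"
    by (simp flip: deg_eq_0_iff add: deg_mop_mult)
  then show ?thesis by (simp add: ext_mult_basis counit_basis)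
qed

lemma bialgebra_ext_mult:
  "bialgebra ext_mult pnsym_one pnsym_comult (pnsym_counit :: 'k::{comm_ring,comm_monoid_mult} pnsym \<Rightarrow> 'k)"
proof -
  have "ext_mult (ext_mult (basis p) (basis q)) (basis r) =
      (ext_mult (basis p) (ext_mult (basis q) (basis r)) :: 'k pnsym)" for p q r
    by (simp add: ext_mult_basis mop_mult_assoc)
  then interpret nonunital_bialgebra ext_mult pnsym_comult "pnsym_counit :: 'k pnsym \<Rightarrow> 'k"
    by (intro nonunital_bialgebraI bilinear_map_ext_mult comult_ext_mult_basis counit_ext_mult_basis)
  note lin = linear_map_bilinear_left[OF mult_bilinear] linear_map_bilinear_right[OF mult_bilinear]
    linear_map_id(1)
  show ?thesis
  proof
    fix x :: "'k pnsym"
    show "ext_mult pnsym_one x = x"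
      by (rule linear_map_eqI[of scale "\<lambda>x. ext_mult pnsym_one x" "\<lambda>x. x"])
        (intro lin, intro lin, simp add: ext_mult_basis mop_mult_one)
    show "ext_mult x pnsym_one = x"
      by (rule linear_map_eqI[of scale "\<lambda>x. ext_mult x pnsym_one" "\<lambda>x. x"])
        (intro lin, intro lin, simp add: ext_mult_basis mop_mult_one)
    have "splits {#} = {({#}, {#} :: nat multiset)}" by (auto simp: splits_def)
    then show "pnsym_comult pnsym_one = tensor pnsym_one (pnsym_one :: 'k pnsym)"
      by (simp add: mop_one_def pnsym_comult_mop tensor_basis)
    show "pnsym_counit pnsym_one = (1 :: 'k)" by (simp add: counit_basis)
  qed
qed

section \<open>The grading\<close>

lemma pnsym_comp_eq:
  "pnsym_comp n = kspan (basis ` {p. deg p = n} :: 'k::{comm_ring,comm_monoid_mult} pnsym set)"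
proof -
  have F: "F \<alpha> \<sigma> = (basis p :: 'k pnsym)" if "Rep_mopiscotion p = (\<alpha>, \<sigma>)" for p \<alpha> \<sigma>
    using F_eq[OF Rep_permutes[OF that]] mop_Rep[OF that] by simp
  have "{F \<alpha> \<sigma> |\<alpha> \<sigma>. (\<alpha>, \<sigma>) \<in> mopiscotions \<and> sum_list \<alpha> = n} = (basis ` {p. deg p = n} :: 'k pnsym set)"
  proof (intro set_eqI iffI)
    fix x :: "'k pnsym" assume "x \<in> {F \<alpha> \<sigma> |\<alpha> \<sigma>. (\<alpha>, \<sigma>) \<in> mopiscotions \<and> sum_list \<alpha> = n}"
    then obtain \<alpha> \<sigma> where x: "x = F \<alpha> \<sigma>" "(\<alpha>, \<sigma>) \<in> mopiscotions" "sum_list \<alpha> = n" by blast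
    from Abs_mopiscotion_inverse[OF x(2)]
    show "x \<in> basis ` {p. deg p = n}"
      by (intro image_eqI[of _ _ "Abs_mopiscotion (\<alpha>, \<sigma>)"]) (simp_all add: x(1,3) F deg_def)
  next
    fix x :: "'k pnsym" assume "x \<in> basis ` {p. deg p = n}"
    then obtain p where x: "x = basis p" "deg p = n" by blast
    obtain \<alpha> \<sigma> where rep: "Rep_mopiscotion p = (\<alpha>, \<sigma>)" by (meson surj_pair)
    have "x = F \<alpha> \<sigma>" using x(1) F[OF rep] by simp
    moreover have "(\<alpha>, \<sigma>) \<in> mopiscotions" using Rep_mopiscotion[of p] rep by simp
    moreover have "sum_list \<alpha> = n" using x(2) rep by (simp add: deg_def)
    ultimately show "x \<in> {F \<alpha> \<sigma> |\<alpha> \<sigma>. (\<alpha>, \<sigma>) \<in> mopiscotions \<and> sum_list \<alpha> = n}" by blast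
  qed
  then show ?thesis by (simp only: pnsym_comp_def)
qed

lemma submodule_homogeneous:
  "submodule {x :: 'b \<Rightarrow>\<^sub>0 'k::{comm_ring,comm_monoid_mult}. \<forall>p\<in>Poly_Mapping.keys x. d p = n}"
proof -
  have "Poly_Mapping.keys (x + y) \<subseteq> Poly_Mapping.keys x \<union> Poly_Mapping.keys y" for x y :: "'b \<Rightarrow>\<^sub>0 'k"
    by (rule keys_add)
  moreover have "Poly_Mapping.keys (scale c x) \<subseteq> Poly_Mapping.keys x" for c and x :: "'b \<Rightarrow>\<^sub>0 'k"
    by (auto simp: in_keys_iff lookup_scale)
  ultimately show ?thesis unfolding submodule_def by fastforce
qed

text \<open>Replaces the span by a condition on the support, from which the gradedness of the other
  maps can be read off.\<close>

lemma mem_pnsym_comp_iff: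
  fixes x :: "'k::{comm_ring,comm_monoid_mult} pnsym"
  shows "x \<in> pnsym_comp n \<longleftrightarrow> (\<forall>p\<in>Poly_Mapping.keys x. deg p = n)"
proof
  assume x: "x \<in> pnsym_comp n"
  have "basis ` {p. deg p = n} \<subseteq> {x :: 'k pnsym. \<forall>p\<in>Poly_Mapping.keys x. deg p = n}"
    by (simp add: image_subset_iff)
  then have "pnsym_comp n \<subseteq> {x :: 'k pnsym. \<forall>p\<in>Poly_Mapping.keys x. deg p = n}"
    unfolding pnsym_comp_eq kspan_def using submodule_homogeneous by (rule hull_minimal)
  then have "x \<in> {x. \<forall>p\<in>Poly_Mapping.keys x. deg p = n}"
    using x by (rule subsetD)
  then show "\<forall>p\<in>Poly_Mapping.keys x. deg p = n"
    unfolding mem_Collect_eq .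
next
  assume *: "\<forall>p\<in>Poly_Mapping.keys x. deg p = n"
  have "(\<Sum>p\<in>Poly_Mapping.keys x. scale (Poly_Mapping.lookup x p) (basis p)) \<in>
      kspan (basis ` {p. deg p = n})"
  proof (rule submodule_sum[OF submodule_kspan])
    fix p assume "p \<in> Poly_Mapping.keys x"
    with * have "basis p \<in> kspan (basis ` {p. deg p = n} :: 'k pnsym set)"
      by (auto intro!: kspan_superset)
    then show "scale (Poly_Mapping.lookup x p) (basis p) \<in> kspan (basis ` {p. deg p = n})"
      by (rule submodule_scale[OF submodule_kspan])
  qed
  then show "x \<in> pnsym_comp n"
    unfolding pnsym_comp_eq
    \<comment> \<open>The predicate is given explicitly so that the element itself is expanded, but
      not its occurrences inside the expansion.\<close>
    by (rule ssubst[OF basis_expansion, where P = "\<lambda>y. y \<in> kspan (basis ` {p. deg p = n})"])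
qed

lemma submodule_pnsym_comp: "submodule (pnsym_comp n)"
  unfolding pnsym_comp_def by (rule submodule_kspan)

lemma basis_in_pnsym_comp: "basis p \<in> pnsym_comp (deg p)"
  by (auto simp: mem_pnsym_comp_iff split: if_splits)

lemma ext_mult_graded:
  assumes "x \<in> pnsym_comp i" "y \<in> pnsym_comp j" shows "ext_mult x y \<in> pnsym_comp (i + j)"
proof -
  have f: "(case (Rep_mopiscotion p, Rep_mopiscotion q) of ((\<alpha>, \<sigma>), (\<beta>, \<tau>)) \<Rightarrow>
       F (\<alpha> @ \<beta>) (perm_dsum (length \<alpha>) \<sigma> \<tau>)) = (basis (mop_mult p q) :: 'a pnsym)" for p q
    using ext_mult_basis[of p q, where 'a = 'a] unfolding ext_mult_def bilinear_ext_basis .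
  show ?thesis
    unfolding ext_mult_def bilinear_ext_def f
  proof (intro submodule_linear_ext submodule_pnsym_comp)
    fix p q assume "p \<in> Poly_Mapping.keys x" "q \<in> Poly_Mapping.keys y"
    then have "deg (mop_mult p q) = i + j"
      using assms by (simp add: mem_pnsym_comp_iff deg_mop_mult)
    then show "basis (mop_mult p q) \<in> pnsym_comp (i + j)"
      using basis_in_pnsym_comp[of "mop_mult p q"] by simp
  qed
qed

text \<open>The component of x in degree n can only be the restriction of x to basis elements of
  degree n.\<close>

lemma graded_module_pnsym:
  "graded_module (pnsym_comp :: nat \<Rightarrow> 'k::{comm_ring,comm_monoid_mult} pnsym set)"
proof
  show "submodule (pnsym_comp n :: 'k pnsym set)" for n by (rule submodule_pnsym_comp)
  fix x :: "'k pnsym"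
  \<comment> \<open>Any decomposition has its coefficients forced: a basis element p can occur only
    in the component of degree \<open>deg p\<close>. This is the uniqueness half.\<close>
  have component: "Poly_Mapping.lookup (Poly_Mapping.lookup c n) p = (if deg p = n then Poly_Mapping.lookup x p else 0)"
    if c: "\<forall>n. Poly_Mapping.lookup c n \<in> pnsym_comp n"
      "x = (\<Sum>n\<in>Poly_Mapping.keys c. Poly_Mapping.lookup c n)" for c :: "nat \<Rightarrow>\<^sub>0 'k pnsym" and n p
  proof -
    have 0: "Poly_Mapping.lookup (Poly_Mapping.lookup c n) p = 0" if "deg p \<noteq> n" for n p
    proof (rule ccontr)
      assume "Poly_Mapping.lookup (Poly_Mapping.lookup c n) p \<noteq> 0"
      then have "p \<in> Poly_Mapping.keys (Poly_Mapping.lookup c n)" by (simp add: in_keys_iff)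
      then show False using c(1) that by (simp add: mem_pnsym_comp_iff)
    qed
    have "Poly_Mapping.lookup x p = (\<Sum>n\<in>Poly_Mapping.keys c. Poly_Mapping.lookup (Poly_Mapping.lookup c n) p)"
      by (subst c(2)) (rule lookup_sum)
    also have "\<dots> = (\<Sum>n\<in>Poly_Mapping.keys c. if n = deg p then Poly_Mapping.lookup (Poly_Mapping.lookup c n) p else 0)"
      by (intro sum.cong refl) (use 0 in auto)
    also have "\<dots> = Poly_Mapping.lookup (Poly_Mapping.lookup c (deg p)) p"
      by (simp add: in_keys_iff)
    finally show ?thesis using 0[of p n] by auto
  qed
  show "\<exists>!c. (\<forall>n. Poly_Mapping.lookup c n \<in> pnsym_comp n) \<and>
      x = (\<Sum>n\<in>Poly_Mapping.keys c. Poly_Mapping.lookup c n)"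
  proof (rule ex_ex1I)
    \<comment> \<open>Groups the terms of x by degree; as a finite sum of singles, it has finite
      support in n automatically.\<close>
    define c where "c = (\<Sum>p\<in>Poly_Mapping.keys x. Poly_Mapping.single (deg p) (Poly_Mapping.single p (Poly_Mapping.lookup x p)))"
    have c: "Poly_Mapping.lookup (Poly_Mapping.lookup c n) p = (if deg p = n then Poly_Mapping.lookup x p else 0)" for n p
    proof -
      have "Poly_Mapping.lookup (Poly_Mapping.lookup c n) p =
          (\<Sum>q\<in>Poly_Mapping.keys x. if q = p then (if deg p = n then Poly_Mapping.lookup x p else 0) else 0)"
        unfolding c_def lookup_sum by (intro sum.cong refl) (auto simp: lookup_single when_def)
      then show ?thesis by (simp add: in_keys_iff)
    qed
    have "Poly_Mapping.lookup (\<Sum>n\<in>Poly_Mapping.keys c. Poly_Mapping.lookup c n) p = Poly_Mapping.lookup x p" for p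
    proof -
      have "Poly_Mapping.lookup (\<Sum>n\<in>Poly_Mapping.keys c. Poly_Mapping.lookup c n) p =
          (\<Sum>n\<in>Poly_Mapping.keys c. if n = deg p then Poly_Mapping.lookup x p else 0)"
        unfolding lookup_sum c by (intro sum.cong refl) auto
      moreover have "Poly_Mapping.lookup x p = 0" if "deg p \<notin> Poly_Mapping.keys c"
        using c[of "deg p" p] that by (simp add: in_keys_iff)
      ultimately show ?thesis by auto
    qed
    then have "x = (\<Sum>n\<in>Poly_Mapping.keys c. Poly_Mapping.lookup c n)"
      by (intro poly_mapping_eqI) simp
    moreover have "Poly_Mapping.lookup c n \<in> pnsym_comp n" for n
      by (auto simp: mem_pnsym_comp_iff in_keys_iff c split: if_splits)
    ultimately show "\<exists>c. (\<forall>n. Poly_Mapping.lookup c n \<in> pnsym_comp n) \<and>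
        x = (\<Sum>n\<in>Poly_Mapping.keys c. Poly_Mapping.lookup c n)"
      by blast
  next
    fix c c' :: "nat \<Rightarrow>\<^sub>0 'k pnsym"
    assume "(\<forall>n. Poly_Mapping.lookup c n \<in> pnsym_comp n) \<and>
        x = (\<Sum>n\<in>Poly_Mapping.keys c. Poly_Mapping.lookup c n)"
      "(\<forall>n. Poly_Mapping.lookup c' n \<in> pnsym_comp n) \<and>
        x = (\<Sum>n\<in>Poly_Mapping.keys c'. Poly_Mapping.lookup c' n)"
    then show "c = c'"
      using component[of c] component[of c'] by (intro poly_mapping_eqI) simp
  qed
qed

lemma comult_graded:
  assumes "x \<in> pnsym_comp n"
  shows "pnsym_comult x \<in> tensor_comp pnsym_comp n"
proof -
  have "pnsym_comult (basis p) \<in> tensor_comp pnsym_comp n" if "p \<in> Poly_Mapping.keys x" for p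
  proof -
    obtain A :: "nat multiset" and \<kappa> :: "nat \<Rightarrow> nat" where p: "p = mop A \<kappa>" "inj_on \<kappa> (set_mset A)"
      by (rule mop_exhaust)
    have n: "size A = n" using assms that deg_mop[OF p(2)] by (auto simp: mem_pnsym_comp_iff p(1))
    show ?thesis
      unfolding p(1) pnsym_comult_mop[OF p(2)] tensor_comp_def
    proof (rule submodule_sum[OF submodule_kspan])
      fix S assume "S \<in> splits A"
      then obtain B C where S: "S = (B, C)" "(B, C) \<in> splits A" by (cases S) auto
      have "deg (mop B \<kappa>) + deg (mop C \<kappa>) = n"
        using S(2) n by (auto simp: deg_mop splits_inj[OF p(2) S(2)] splits_def)
      then show "(case S of (B, C) \<Rightarrow> basis (mop B \<kappa>, mop C \<kappa>)) \<in>
          kspan {tensor x y |x y i j. x \<in> pnsym_comp i \<and> y \<in> pnsym_comp j \<and> i + j = n}"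
        unfolding S(1) prod.case tensor_basis[symmetric]
        using basis_in_pnsym_comp by (intro kspan_superset) blast
    qed
  qed
  then show ?thesis
    unfolding linear_map_expand[OF linear_map_comult, of x] tensor_comp_def
    by (intro submodule_sum[OF submodule_kspan] submodule_scale[OF submodule_kspan])
      (simp add: tensor_comp_def)
qed

lemma counit_graded:
  assumes "x \<in> pnsym_comp n" "n \<noteq> 0" shows "pnsym_counit x = 0"
proof (rule ccontr)
  assume "pnsym_counit x \<noteq> 0"
  then have "mop_one \<in> Poly_Mapping.keys x" by (simp add: pnsym_counit_def in_keys_iff)
  then show False using assms deg_eq_0_iff[of mop_one] by (simp add: mem_pnsym_comp_iff)
qed

lemma pnsym_comp_0: "pnsym_comp 0 = {scale c pnsym_one |c. True}"
proof (intro set_eqI iffI)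
  fix x :: "'a pnsym" assume "x \<in> pnsym_comp 0"
  then have "Poly_Mapping.keys x \<subseteq> {mop_one}" by (auto simp: mem_pnsym_comp_iff deg_eq_0_iff)
  then have "x = scale (pnsym_counit x) pnsym_one"
    by (intro poly_mapping_eqI) (auto simp: pnsym_counit_def scale_single lookup_single when_def in_keys_iff)
  then show "x \<in> {scale c pnsym_one |c. True}" by blast
next
  fix x :: "'a pnsym" assume "x \<in> {scale c pnsym_one |c. True}"
  then show "x \<in> pnsym_comp 0"
    using submodule_pnsym_comp[of 0] basis_in_pnsym_comp[of mop_one] deg_eq_0_iff[of mop_one]
    by (auto simp: submodule_def)
qed

section \<open>The antipode\<close>

text \<open>\<open>conv_pow k\<close> is the \<open>k\<close>-th convolution power of \<open>f = \<eta>\<epsilon> - id\<close>. As \<open>f\<close> kills the unity, its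
  \<open>k\<close>-th power vanishes in degrees below \<open>k\<close>, and the geometric series of \<open>f\<close> inverts
  \<open>\<eta>\<epsilon> - f = id\<close>.\<close>

definition neg_aug :: "'k::{comm_ring,comm_monoid_mult} pnsym \<Rightarrow> 'k pnsym" where
  "neg_aug x = scale (pnsym_counit x) pnsym_one - x"

primrec conv_pow :: "nat \<Rightarrow> 'k::{comm_ring,comm_monoid_mult} pnsym \<Rightarrow> 'k pnsym" where
  "conv_pow 0 = (\<lambda>x. scale (pnsym_counit x) pnsym_one)"
| "conv_pow (Suc k) = (\<lambda>x. mult_map ext_mult (tensor_map (conv_pow k) neg_aug (pnsym_comult x)))"

text \<open>On a basis element the geometric series stops at its degree. The cut-off depends on p,
  hence the definition on the basis with linear extension.\<close>

definition pnsym_antipode :: "'k::{comm_ring,comm_monoid_mult} pnsym \<Rightarrow> 'k pnsym" where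
  "pnsym_antipode = linear_ext (\<lambda>p. \<Sum>k\<le>deg p. conv_pow k (basis p))"

text \<open>The convolution of f and g as a sum over splittings. \<open>tensor_map\<close> evaluates
  f and g at basis elements only, so the formula holds for arbitrary functions.\<close>

lemma convolution_mop:
  assumes "inj_on \<kappa> (set_mset A)"
  shows "mult_map ext_mult (tensor_map f g (pnsym_comult (basis (mop A \<kappa>)))) =
    (\<Sum>(B, C)\<in>splits A. ext_mult (f (basis (mop B \<kappa>))) (g (basis (mop C \<kappa>))))"
  unfolding pnsym_comult_mop[OF assms] linear_map_sum[OF linear_map_tensor_map]
    linear_map_sum[OF linear_map_mult_map]
  by (simp add: split_beta tensor_map_basis mult_map_tensor[OF bilinear_map_ext_mult])

lemma ext_mult_zero [simp]: "ext_mult 0 x = 0" "ext_mult x 0 = 0"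
proof -
  show "ext_mult 0 x = 0"
    using linear_map_zero[of scale scale "\<lambda>y. ext_mult y x"] bilinear_map_ext_mult
    unfolding bilinear_map_def by blast
  show "ext_mult x 0 = 0"
    using linear_map_zero[of scale scale "\<lambda>y. ext_mult x y"] bilinear_map_ext_mult
    unfolding bilinear_map_def by blast
qed

lemma ext_mult_one [simp]: "ext_mult pnsym_one x = x" "ext_mult x pnsym_one = x"
proof -
  interpret bialgebra ext_mult pnsym_one pnsym_comult "pnsym_counit :: 'a pnsym \<Rightarrow> 'a"
    by (rule bialgebra_ext_mult)
  show "ext_mult pnsym_one x = x" "ext_mult x pnsym_one = x"
    by (rule unity_left, rule unity_right)
qed

lemma ext_mult_assoc: "ext_mult (ext_mult x y) z = ext_mult x (ext_mult y z)"
  by (rule bilinear_map_assocI[OF bilinear_map_ext_mult]) (simp add: ext_mult_basis mop_mult_assoc)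

lemma ext_mult_sum_left: "ext_mult (\<Sum>i\<in>I. h i) y = (\<Sum>i\<in>I. ext_mult (h i) y)"
  unfolding ext_mult_def by (rule bilinear_ext_sum_left)

lemma ext_mult_sum_right: "ext_mult x (\<Sum>i\<in>I. h i) = (\<Sum>i\<in>I. ext_mult x (h i))"
  unfolding ext_mult_def by (rule bilinear_ext_sum_right)

lemma ext_mult_diff: "ext_mult (x - x') y = ext_mult x y - ext_mult x' y"
  "ext_mult y (x - x') = ext_mult y x - ext_mult y x'"
proof -
  have add: "ext_mult (u + v) y = ext_mult u y + ext_mult v y" "ext_mult y (u + v) = ext_mult y u + ext_mult y v" for u v
    using bilinear_map_ext_mult unfolding bilinear_map_def linear_map_def by blast+
  show "ext_mult (x - x') y = ext_mult x y - ext_mult x' y"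
    "ext_mult y (x - x') = ext_mult y x - ext_mult y x'"
    using add[of "x - x'" x'] by simp_all
qed

lemma conv_pow_0_mop:
  "inj_on \<kappa> (set_mset A) \<Longrightarrow> conv_pow 0 (basis (mop A \<kappa>)) = (if A = {#} then pnsym_one else 0)"
  by (simp add: counit_mop)

lemma neg_aug_mop:
  "inj_on \<kappa> (set_mset A) \<Longrightarrow> neg_aug (basis (mop A \<kappa>)) = (if A = {#} then 0 else - basis (mop A \<kappa>))"
  by (auto simp: neg_aug_def counit_mop mop_empty)

lemma conv_pow_Suc_mop:
  assumes "inj_on \<kappa> (set_mset A)"
  shows "conv_pow (Suc k) (basis (mop A \<kappa>)) =
    (\<Sum>(B, C)\<in>splits A. ext_mult (conv_pow k (basis (mop B \<kappa>))) (neg_aug (basis (mop C \<kappa>))))"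
  by (simp only: conv_pow.simps(2) convolution_mop[OF assms])

text \<open>\<open>conv_pow 0\<close> is the unit of convolution. With h a function of multisets,
  any second factor evaluated on the basis fits.\<close>

lemma conv_pow_0_left:
  assumes "inj_on \<kappa> (set_mset A)"
  shows "(\<Sum>(B, C)\<in>splits A. ext_mult (conv_pow 0 (basis (mop B \<kappa>))) (h C)) = h A"
proof -
  have "(\<Sum>(B, C)\<in>splits A. ext_mult (conv_pow 0 (basis (mop B \<kappa>))) (h C)) =
      (\<Sum>(B, C)\<in>splits A. if B = {#} then h C else 0)"
    by (intro sum.cong refl) (auto simp: conv_pow_0_mop splits_inj[OF assms] simp del: conv_pow.simps)
  then show ?thesis by (simp only: sum_splits_empty_left)
qed

lemma conv_pow_0_right:
  assumes "inj_on \<kappa> (set_mset A)"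
  shows "(\<Sum>(B, C)\<in>splits A. ext_mult (h B) (conv_pow 0 (basis (mop C \<kappa>)))) = h A"
proof -
  have "(\<Sum>(B, C)\<in>splits A. ext_mult (h B) (conv_pow 0 (basis (mop C \<kappa>)))) =
      (\<Sum>(B, C)\<in>splits A. if C = {#} then h B else 0)"
    by (intro sum.cong refl) (auto simp: conv_pow_0_mop splits_inj[OF assms] simp del: conv_pow.simps)
  then show ?thesis by (simp only: sum_splits_empty_right)
qed

text \<open>The recursion appends the new factor on the right, while the right antipode law needs it
  on the left. The two agree because convolution is associative: \<open>ext_mult_assoc\<close>
  together with \<open>sum_splits_assoc\<close>.\<close>

lemma conv_pow_Suc_mop':
  assumes "inj_on \<kappa> (set_mset A)"
  shows "conv_pow (Suc k) (basis (mop A \<kappa>)) =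
    (\<Sum>(B, C)\<in>splits A. ext_mult (neg_aug (basis (mop B \<kappa>))) (conv_pow k (basis (mop C \<kappa>)))
      :: 'k::{comm_ring,comm_monoid_mult} pnsym)"
  using assms
proof (induction k arbitrary: A)
  case 0
  show ?case
    unfolding conv_pow_Suc_mop[OF 0] conv_pow_0_left[OF 0] conv_pow_0_right[OF 0] ..
next
  case (Suc k)
  let ?f = "\<lambda>A. neg_aug (basis (mop A \<kappa>)) :: 'k pnsym" and ?g = "\<lambda>A. conv_pow k (basis (mop A \<kappa>)) :: 'k pnsym"
  have "conv_pow (Suc (Suc k)) (basis (mop A \<kappa>)) =
      (\<Sum>(B, C)\<in>splits A. ext_mult (conv_pow (Suc k) (basis (mop B \<kappa>))) (?f C))"
    by (rule conv_pow_Suc_mop[OF Suc.prems])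
  also have "\<dots> = (\<Sum>(B, C)\<in>splits A. \<Sum>(B1, B2)\<in>splits B. ext_mult (?f B1) (ext_mult (?g B2) (?f C)))"
  proof (intro sum.cong refl)
    fix S assume "S \<in> splits A"
    then obtain B C where S: "S = (B, C)" "(B, C) \<in> splits A" by (cases S) auto
    show "(case S of (B, C) \<Rightarrow> ext_mult (conv_pow (Suc k) (basis (mop B \<kappa>))) (?f C)) =
        (case S of (B, C) \<Rightarrow> \<Sum>(B1, B2)\<in>splits B. ext_mult (?f B1) (ext_mult (?g B2) (?f C)))"
      unfolding S(1) prod.case Suc.IH[OF splits_inj(1)[OF Suc.prems S(2)]] ext_mult_sum_left
      by (simp only: case_prod_unfold ext_mult_assoc)
  qed
  also have "\<dots> = (\<Sum>(B, C)\<in>splits A. \<Sum>(C1, C2)\<in>splits C. ext_mult (?f B) (ext_mult (?g C1) (?f C2)))"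
    by (rule sum_splits_assoc)
  also have "\<dots> = (\<Sum>(B, C)\<in>splits A. ext_mult (?f B) (conv_pow (Suc k) (basis (mop C \<kappa>))))"
  proof (intro sum.cong refl)
    fix S assume "S \<in> splits A"
    then obtain B C where S: "S = (B, C)" "(B, C) \<in> splits A" by (cases S) auto
    show "(case S of (B, C) \<Rightarrow> \<Sum>(C1, C2)\<in>splits C. ext_mult (?f B) (ext_mult (?g C1) (?f C2))) =
        (case S of (B, C) \<Rightarrow> ext_mult (?f B) (conv_pow (Suc k) (basis (mop C \<kappa>))))"
      unfolding S(1) prod.case conv_pow_Suc_mop[OF splits_inj(2)[OF Suc.prems S(2)]] ext_mult_sum_right
      by (simp only: case_prod_unfold)
  qed
  finally show ?case .
qed

text \<open>\<open>neg_aug\<close> kills the unity, so every factor must take a nonempty part of A,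
  and fewer than k elements cannot supply k such parts.\<close>

lemma conv_pow_vanish:
  assumes "inj_on \<kappa> (set_mset A)" "size A < k"
  shows "conv_pow k (basis (mop A \<kappa>)) = (0 :: 'k::{comm_ring,comm_monoid_mult} pnsym)"
  using assms
proof (induction k arbitrary: A)
  case (Suc k)
  have "ext_mult (conv_pow k (basis (mop B \<kappa>))) (neg_aug (basis (mop C \<kappa>))) = (0 :: 'k pnsym)" if BC: "(B, C) \<in> splits A" for B C
  proof (cases "C = {#}")
    case True
    then show ?thesis by (simp add: neg_aug_mop)
  next
    case False
    have "size B + size C = size A" using BC by (auto simp: splits_def)
    moreover have "0 < size C" using False by (simp add: nonempty_has_size)
    ultimately have "size B < k" using Suc.prems(2) by simp
    then have "conv_pow k (basis (mop B \<kappa>)) = (0 :: 'k pnsym)"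
      by (rule Suc.IH[OF splits_inj(1)[OF Suc.prems(1) BC]])
    then show ?thesis by simp
  qed
  then show ?case unfolding conv_pow_Suc_mop[OF Suc.prems(1)] by (intro sum.neutral) auto
qed simp

text \<open>The added terms vanish. A larger bound lets all parts of one multiset share the same
  cut-off.\<close>

lemma antipode_mop:
  assumes "inj_on \<kappa> (set_mset A)" "size A \<le> n"
  shows "pnsym_antipode (basis (mop A \<kappa>)) = (\<Sum>k\<le>n. conv_pow k (basis (mop A \<kappa>)))"
proof -
  have "pnsym_antipode (basis (mop A \<kappa>)) = (\<Sum>k\<le>size A. conv_pow k (basis (mop A \<kappa>)))"
    by (simp add: pnsym_antipode_def deg_mop assms(1))
  also have "\<dots> = (\<Sum>k\<le>n. conv_pow k (basis (mop A \<kappa>)))"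
    by (rule sum.mono_neutral_left) (use assms in \<open>auto intro: conv_pow_vanish\<close>)
  finally show ?thesis .
qed

lemma basis_eq_diff: "basis p = conv_pow 0 (basis p) - neg_aug (basis p)"
  by (simp add: neg_aug_def)

text \<open>With the common cut-off \<open>size A\<close>, the sum over k moves outside the sum over
  splittings. By \<open>basis_eq_diff\<close> the identity is the convolution unit minus
  \<open>neg_aug\<close>, so the sum telescopes to the power 0 minus the power
  \<open>Suc (size A)\<close>, and the latter vanishes on A.\<close>

lemma antipode_left_mop:
  fixes A :: "'i::linorder multiset" and \<kappa> :: "'i \<Rightarrow> 'o::linorder"
  assumes inj: "inj_on \<kappa> (set_mset A)"
  shows "mult_map ext_mult (tensor_map pnsym_antipode id (pnsym_comult (basis (mop A \<kappa>)))) =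
    (scale (pnsym_counit (basis (mop A \<kappa>))) pnsym_one :: 'k::{comm_ring,comm_monoid_mult} pnsym)"
proof -
  let ?b = "\<lambda>A. basis (mop A \<kappa>) :: 'k pnsym"
  have "mult_map ext_mult (tensor_map pnsym_antipode id (pnsym_comult (?b A))) =
      (\<Sum>(B, C)\<in>splits A. \<Sum>k\<le>size A. ext_mult (conv_pow k (?b B)) (conv_pow 0 (?b C)) -
        ext_mult (conv_pow k (?b B)) (neg_aug (?b C)))"
    unfolding convolution_mop[OF inj]
  proof (intro sum.cong refl)
    fix S assume "S \<in> splits A"
    then obtain B C where S: "S = (B, C)" "(B, C) \<in> splits A" by (cases S) auto
    have size: "size B \<le> size A" using S(2) by (auto simp: splits_def)
    show "(case S of (B, C) \<Rightarrow> ext_mult (pnsym_antipode (?b B)) (id (?b C))) =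
        (case S of (B, C) \<Rightarrow> \<Sum>k\<le>size A. ext_mult (conv_pow k (?b B)) (conv_pow 0 (?b C)) -
          ext_mult (conv_pow k (?b B)) (neg_aug (?b C)))"
      unfolding S(1) prod.case antipode_mop[OF splits_inj(1)[OF inj S(2)] size] ext_mult_sum_left id_apply
        ext_mult_diff(2)[symmetric] basis_eq_diff[symmetric] ..
  qed
  also have "\<dots> = (\<Sum>k\<le>size A. \<Sum>(B, C)\<in>splits A. ext_mult (conv_pow k (?b B)) (conv_pow 0 (?b C)) -
        ext_mult (conv_pow k (?b B)) (neg_aug (?b C)))"
    unfolding split_beta by (rule sum.swap)
  also have "\<dots> = (\<Sum>k\<le>size A. conv_pow k (?b A) - conv_pow (Suc k) (?b A))"
  proof (intro sum.cong refl)
    fix k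
    show "(\<Sum>(B, C)\<in>splits A. ext_mult (conv_pow k (?b B)) (conv_pow 0 (?b C)) -
        ext_mult (conv_pow k (?b B)) (neg_aug (?b C))) = conv_pow k (?b A) - conv_pow (Suc k) (?b A)"
      using conv_pow_0_right[OF inj, of "\<lambda>B. conv_pow k (?b B)"]
      by (simp only: case_prod_unfold sum_subtractf conv_pow_Suc_mop[OF inj])
  qed
  also have "\<dots> = conv_pow 0 (?b A)"
    unfolding sum_telescope[of "\<lambda>k. conv_pow k (?b A)"]
    by (simp only: conv_pow_vanish[OF inj lessI] diff_zero)
  finally show ?thesis by simp
qed

text \<open>The mirror image of the left law, with the recursion read from the left by
  \<open>conv_pow_Suc_mop'\<close>.\<close>

lemma antipode_right_mop:
  fixes A :: "'i::linorder multiset" and \<kappa> :: "'i \<Rightarrow> 'o::linorder"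
  assumes inj: "inj_on \<kappa> (set_mset A)"
  shows "mult_map ext_mult (tensor_map id pnsym_antipode (pnsym_comult (basis (mop A \<kappa>)))) =
    (scale (pnsym_counit (basis (mop A \<kappa>))) pnsym_one :: 'k::{comm_ring,comm_monoid_mult} pnsym)"
proof -
  let ?b = "\<lambda>A. basis (mop A \<kappa>) :: 'k pnsym"
  have "mult_map ext_mult (tensor_map id pnsym_antipode (pnsym_comult (?b A))) =
      (\<Sum>(B, C)\<in>splits A. \<Sum>k\<le>size A. ext_mult (conv_pow 0 (?b B)) (conv_pow k (?b C)) -
        ext_mult (neg_aug (?b B)) (conv_pow k (?b C)))"
    unfolding convolution_mop[OF inj]
  proof (intro sum.cong refl)
    fix S assume "S \<in> splits A"
    then obtain B C where S: "S = (B, C)" "(B, C) \<in> splits A" by (cases S) auto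
    have size: "size C \<le> size A" using S(2) by (auto simp: splits_def)
    show "(case S of (B, C) \<Rightarrow> ext_mult (id (?b B)) (pnsym_antipode (?b C))) =
        (case S of (B, C) \<Rightarrow> \<Sum>k\<le>size A. ext_mult (conv_pow 0 (?b B)) (conv_pow k (?b C)) -
          ext_mult (neg_aug (?b B)) (conv_pow k (?b C)))"
      unfolding S(1) prod.case antipode_mop[OF splits_inj(2)[OF inj S(2)] size] ext_mult_sum_right id_apply
        ext_mult_diff(1)[symmetric] basis_eq_diff[symmetric] ..
  qed
  also have "\<dots> = (\<Sum>k\<le>size A. \<Sum>(B, C)\<in>splits A. ext_mult (conv_pow 0 (?b B)) (conv_pow k (?b C)) -
        ext_mult (neg_aug (?b B)) (conv_pow k (?b C)))"
    unfolding split_beta by (rule sum.swap)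
  also have "\<dots> = (\<Sum>k\<le>size A. conv_pow k (?b A) - conv_pow (Suc k) (?b A))"
  proof (intro sum.cong refl)
    fix k
    show "(\<Sum>(B, C)\<in>splits A. ext_mult (conv_pow 0 (?b B)) (conv_pow k (?b C)) -
        ext_mult (neg_aug (?b B)) (conv_pow k (?b C))) = conv_pow k (?b A) - conv_pow (Suc k) (?b A)"
      using conv_pow_0_left[OF inj, of "\<lambda>C. conv_pow k (?b C)"]
      by (simp only: case_prod_unfold sum_subtractf conv_pow_Suc_mop'[OF inj])
  qed
  also have "\<dots> = conv_pow 0 (?b A)"
    unfolding sum_telescope[of "\<lambda>k. conv_pow k (?b A)"]
    by (simp only: conv_pow_vanish[OF inj lessI] diff_zero)
  finally show ?thesis by simp
qed

lemma linear_map_antipode: "linear_map scale scale pnsym_antipode"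
  unfolding pnsym_antipode_def by (rule linear_map_linear_ext)

text \<open>\<open>neg_aug\<close> sends a basis element to 0 or to its negative, and external
  multiplication adds degrees.\<close>

lemma conv_pow_graded:
  assumes "inj_on \<kappa> (set_mset A)"
  shows "conv_pow k (basis (mop A \<kappa>)) \<in> (pnsym_comp (size A) :: 'k::{comm_ring,comm_monoid_mult} pnsym set)"
  using assms
proof (induction k arbitrary: A)
  case 0
  show ?case
    unfolding conv_pow_0_mop[OF 0] using basis_in_pnsym_comp[of mop_one] deg_eq_0_iff[of mop_one]
    by (auto simp: mem_pnsym_comp_iff)
next
  case (Suc k)
  show ?case
    unfolding conv_pow_Suc_mop[OF Suc.prems]
  proof (rule submodule_sum[OF submodule_pnsym_comp])
    fix S assume "S \<in> splits A"
    then obtain B C where S: "S = (B, C)" "(B, C) \<in> splits A" by (cases S) auto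
    have "neg_aug (basis (mop C \<kappa>)) \<in> (pnsym_comp (size C) :: 'k pnsym set)"
      using splits_inj(2)[OF Suc.prems S(2)]
      by (auto simp: neg_aug_mop mem_pnsym_comp_iff deg_mop split: if_splits)
    then have "ext_mult (conv_pow k (basis (mop B \<kappa>))) (neg_aug (basis (mop C \<kappa>))) \<in>
        (pnsym_comp (size B + size C) :: 'k pnsym set)"
      by (intro ext_mult_graded Suc.IH splits_inj(1)[OF Suc.prems S(2)])
    moreover have "size B + size C = size A" using S(2) by (auto simp: splits_def)
    ultimately show "(case S of (B, C) \<Rightarrow> ext_mult (conv_pow k (basis (mop B \<kappa>)))
        (neg_aug (basis (mop C \<kappa>)))) \<in> (pnsym_comp (size A) :: 'k pnsym set)"
      by (simp only: S(1) prod.case)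
  qed
qed

lemma antipode_graded:
  assumes "x \<in> pnsym_comp n" shows "pnsym_antipode x \<in> pnsym_comp n"
  unfolding pnsym_antipode_def
proof (intro submodule_linear_ext submodule_sum submodule_pnsym_comp)
  fix p k assume p: "p \<in> Poly_Mapping.keys x"
  obtain A \<kappa> where A: "p = mop (A :: nat multiset) (\<kappa> :: nat \<Rightarrow> nat)" "inj_on \<kappa> (set_mset A)"
    by (rule mop_exhaust)
  have "size A = n" using p assms deg_mop[OF A(2)] by (simp add: mem_pnsym_comp_iff A(1))
  then show "conv_pow k (basis p) \<in> pnsym_comp n" using conv_pow_graded[OF A(2)] A(1) by blast
qed

lemma comult_cocommutative:
  fixes x :: "'k::{comm_ring,comm_monoid_mult} pnsym"
  shows "tensor_swap (pnsym_comult x) = pnsym_comult x"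
proof (rule linear_map_eqI[of scale "\<lambda>x. tensor_swap (pnsym_comult x)" pnsym_comult])
  show "linear_map scale scale (\<lambda>x :: 'k pnsym. tensor_swap (pnsym_comult x))"
    by (rule linear_map_compose[OF linear_map_comult linear_map_tensor_swap])
  fix p
  obtain A \<kappa> where A: "p = mop (A :: nat multiset) (\<kappa> :: nat \<Rightarrow> nat)" "inj_on \<kappa> (set_mset A)"
    by (rule mop_exhaust)
  have "tensor_swap (pnsym_comult (basis p)) =
      (\<Sum>(B, C)\<in>splits A. basis (mop C \<kappa>, mop B \<kappa>) :: _ \<Rightarrow>\<^sub>0 'k)"
    unfolding A(1) pnsym_comult_mop[OF A(2)] linear_map_sum[OF linear_map_tensor_swap]
    by (simp only: case_prod_unfold tensor_swap_basis)
  also have "\<dots> = pnsym_comult (basis p)"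
    unfolding A(1) pnsym_comult_mop[OF A(2)] by (rule sum_splits_swap)
  finally show "tensor_swap (pnsym_comult (basis p)) = (pnsym_comult (basis p) :: _ \<Rightarrow>\<^sub>0 'k)" .
qed (rule linear_map_comult)

lemma connected_graded_cocommutative_hopf_algebra_pnsym:
  "connected_graded_cocommutative_hopf_algebra
    (pnsym_comp :: nat \<Rightarrow> 'k::{comm_ring,comm_monoid_mult} pnsym set)
    ext_mult pnsym_one pnsym_comult pnsym_counit pnsym_antipode"
proof -
  interpret graded_module "pnsym_comp :: nat \<Rightarrow> 'k pnsym set" by (rule graded_module_pnsym)
  interpret bialgebra ext_mult pnsym_one pnsym_comult "pnsym_counit :: 'k pnsym \<Rightarrow> 'k"
    by (rule bialgebra_ext_mult)
  have lin: "linear_map scale scale (\<lambda>x :: 'k pnsym. mult_map ext_mult (tensor_map f g (pnsym_comult x)))" for f g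
    by (rule linear_map_compose[OF linear_map_compose[OF linear_map_comult linear_map_tensor_map]
          linear_map_mult_map])
  have left: "mult_map ext_mult (tensor_map pnsym_antipode id (pnsym_comult x)) = scale (pnsym_counit x) pnsym_one"
    for x :: "'k pnsym"
  proof (rule linear_map_eqI[OF lin linear_map_scale_fun[OF linear_map_counit]])
    fix p
    obtain A \<kappa> where A: "p = mop (A :: nat multiset) (\<kappa> :: nat \<Rightarrow> nat)" "inj_on \<kappa> (set_mset A)"
      by (rule mop_exhaust)
    show "mult_map ext_mult (tensor_map pnsym_antipode id (pnsym_comult (basis p))) =
        (scale (pnsym_counit (basis p)) pnsym_one :: 'k pnsym)"
      unfolding A(1) by (rule antipode_left_mop[OF A(2)])
  qed
  have right: "mult_map ext_mult (tensor_map id pnsym_antipode (pnsym_comult x)) = scale (pnsym_counit x) pnsym_one"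
    for x :: "'k pnsym"
  proof (rule linear_map_eqI[OF lin linear_map_scale_fun[OF linear_map_counit]])
    fix p
    obtain A \<kappa> where A: "p = mop (A :: nat multiset) (\<kappa> :: nat \<Rightarrow> nat)" "inj_on \<kappa> (set_mset A)"
      by (rule mop_exhaust)
    show "mult_map ext_mult (tensor_map id pnsym_antipode (pnsym_comult (basis p))) =
        (scale (pnsym_counit (basis p)) pnsym_one :: 'k pnsym)"
      unfolding A(1) by (rule antipode_right_mop[OF A(2)])
  qed
  show ?thesis
    using basis_in_pnsym_comp[of mop_one] deg_eq_0_iff[of mop_one]
    by unfold_locales
      (simp_all add: linear_map_antipode left right ext_mult_graded comult_graded counit_graded
        antipode_graded pnsym_comp_0 comult_cocommutative)
qed

theorem theorem2p7:
  shows "(\<exists>unity counit antipode.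
       connected_graded_cocommutative_hopf_algebra
         (pnsym_comp :: nat \<Rightarrow> 'k::{comm_ring,comm_monoid_mult} pnsym set)
         ext_mult unity pnsym_comult counit antipode \<and>
       nonunital_bialgebra int_mult pnsym_comult counit) \<and>
    (\<forall>x y z :: 'k pnsym. ext_mult (ext_mult x y) z = ext_mult x (ext_mult y z)) \<and>
    (\<forall>x y z :: 'k pnsym. int_mult (int_mult x y) z = int_mult x (int_mult y z))"
\<comment> \<open>The witnesses stay schematic until the first \<open>show\<close> fixes them; the
  internal bialgebra then has to use the same counit.\<close>
proof (intro conjI allI exI)
  show "connected_graded_cocommutative_hopf_algebra
      (pnsym_comp :: nat \<Rightarrow> 'k pnsym set) ext_mult pnsym_one pnsym_comult pnsym_counit pnsym_antipode"
    by (rule connected_graded_cocommutative_hopf_algebra_pnsym)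
  show "nonunital_bialgebra int_mult pnsym_comult (pnsym_counit :: 'k pnsym \<Rightarrow> 'k)"
    by (rule nonunital_bialgebra_int_mult)
  fix x y z :: "'k pnsym"
  show "ext_mult (ext_mult x y) z = ext_mult x (ext_mult y z)" by (rule ext_mult_assoc)
  show "int_mult (int_mult x y) z = int_mult x (int_mult y z)"
    by (rule bilinear_map_assocI[OF bilinear_map_int_mult int_mult_assoc_basis])
qed

end
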